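(* Let $n\in\mathbb{N}\setminus\{1,2,4\}$ (so $n=3$ or $n\ge 5$), let $\mathbb{Z}_n=\mathbb{Z}/n\mathbb{Z}$ and $S=\{1,n-1\}$. The quantum group of orientation preserving isometries $\mathrm{QISO}^+(\mathbb{Z}_n,S)$ is isomorphic to $C^*(\mathbb{Z}_n)\oplus C^*(\mathbb{Z}_n)$ as a $C^*$-algebra. Its action on $C^*(\mathbb{Z}_n)$ is given by the formula $$\alpha(\lambda_1)=\lambda_1\otimes A+\lambda_{n-1}\otimes B,$$ where $A$ and $B$ are respectively identified with $\lambda_1\oplus 0$ and $0\oplus\lambda_1$ in $C^*(\mathbb{Z}_n)\oplus C^*(\mathbb{Z}_n)$. The coproduct of $\mathrm{QISO}^+(\mathbb{Z}_n,S)$ can be read out from the condition that $$\begin{pmatrix} A & B \\ B^* & A^* \end{pmatrix}$$ is the fundamental corepresentation.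
   Context: Let $\Gamma$ be a discrete group with a finite symmetric generating set $S$ and associated word-length function $l$. $C^*_r(\Gamma)$ is generated by the left regular representation unitaries $\lambda_\gamma$ on $\ell^2(\Gamma)$ (for $\Gamma$ finite or abelian $C^*_r(\Gamma)=C^*(\Gamma)$), and $\tau$ is the canonical trace, $\tau(\lambda_\gamma)=\delta_{\gamma,e}$. All $C^*$-tensor products are minimal; $\otimes_{\mathrm{alg}}$ is algebraic. A matrix $u=(u_{ij})$ over a compact quantum group $(\mathsf Q,\Delta)$ is a (finite-dimensional) corepresentation if $\Delta(u_{ij})=\sum_k u_{ik}\otimes u_{kj}$; it is fundamental if it is unitary and its entries generate $\mathsf Q$ as a $C^*$-algebra. An action of $(\mathsf Q,\Delta)$ on a unital $C^*$-algebra $\mathsf A$ is a unital $^*$-homomorphism $\alpha:\mathsf A\to\mathsf A\otimes\mathsf Q$ that satisfies the coaction identity with respect to $\Delta$ and for which $\mathrm{Lin}\,\alpha(\mathsf A)(1\otimes\mathsf Q)$ is dense in $\mathsf A\otimes\mathsf Q$. Convention: the order of the two $\mathsf Q$-legs in the coaction identity is the one matching the displayed matrix, namely $(\alpha\otimes\mathrm{id})\alpha=(\mathrm{id}\otimes\sigma\Delta)\alpha$, with $\sigma$ the flip on $\mathsf Q\otimes\mathsf Q$. (With the other common order, $(\alpha\otimes\mathrm{id})\alpha=(\mathrm{id}\otimes\Delta)\alpha$, the coproduct is replaced by its opposite.) $\mathrm{QISO}^+(\Gamma,S)$, the quantum group of orientation preserving isometries of the spectral triple $(\mathbb{C}[\Gamma],\ell^2(\Gamma),D_\Gamma)$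 with $D_\Gamma\delta_\gamma=l(\gamma)\delta_\gamma$, is (characterized, up to isomorphism, as) the universal (initial) object in the category of pairs $(\mathsf Q,\alpha)$, where $\mathsf Q$ is a compact quantum group and $\alpha$ is an action of $\mathsf Q$ on $C^*_r(\Gamma)$ such that $(\tau\otimes\mathrm{id})\alpha(a)=\tau(a)1_{\mathsf Q}$ for all $a$, and $\alpha(\lambda_\gamma)\in\mathrm{Lin}\{\lambda_{\gamma'}:l(\gamma')=l(\gamma)\}\otimes_{\mathrm{alg}}\mathsf Q$ for all $\gamma\in\Gamma$ (i.e. $\alpha$ commutes with the map $\lambda_\gamma\mapsto l(\gamma)\lambda_\gamma$ on $\mathbb{C}[\Gamma]$). Morphisms $(\mathsf Q,\alpha)\to(\mathsf Q',\alpha')$ are compact quantum group morphisms $\Phi:\mathsf Q\to\mathsf Q'$ with $(\mathrm{id}\otimes\Phi)\alpha=\alpha'$. *)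

theory Defs
  imports "HOL-Analysis.Analysis" "HOL-Algebra.Elementary_Groups"
begin

section \<open>Bounded operators on l2\<close>

text \<open>
  A bounded operator T on the Hilbert space l2 over an index type is represented by its matrix
  T i j = <delta i, T (delta j)> (inner product linear in the second argument). A matrix is that of
  an operator of norm at most C iff norm (T x) <= C * norm x for all finitely supported x, which is
  \<open>op_bound\<close>: the supremum over the finite sets F computes the l2-norm of T x.
\<close>

definition op_bound :: "real \<Rightarrow> ('i \<Rightarrow> 'i \<Rightarrow> complex) \<Rightarrow> bool" where
  "op_bound C T \<longleftrightarrow> (\<forall>F G x. finite F \<longrightarrow> finite G \<longrightarrow>
     L2_set (\<lambda>i. cmod (\<Sum>j\<in>G. T i j * x j)) F \<le> C * L2_set (\<lambda>j. cmod (x j)) G)"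

lemma op_boundD:
  "op_bound C T \<Longrightarrow> finite F \<Longrightarrow> finite G \<Longrightarrow>
    L2_set (\<lambda>i. cmod (\<Sum>j\<in>G. T i j * x j)) F \<le> C * L2_set (\<lambda>j. cmod (x j)) G"
  by (auto simp: op_bound_def)

lemma op_boundI:
  "(\<And>F G x. finite F \<Longrightarrow> finite G \<Longrightarrow>
    L2_set (\<lambda>i. cmod (\<Sum>j\<in>G. T i j * x j)) F \<le> C * L2_set (\<lambda>j. cmod (x j)) G) \<Longrightarrow> op_bound C T"
  by (auto simp: op_bound_def)

lemma op_bound_column:
  assumes "op_bound C T" "finite F"
  shows "L2_set (\<lambda>i. cmod (T i j)) F \<le> C"
  using op_boundD[OF assms, of "{j}" "\<lambda>_. 1"] by simp

lemma op_bound_nonneg: "op_bound C T \<Longrightarrow> 0 \<le> C"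
  using op_bound_column[of C T "{}"] by simp

lemma op_bound_entry: "op_bound C T \<Longrightarrow> cmod (T i j) \<le> C"
  using op_bound_column[of C T "{i}" j] by simp

lemma op_bound_zero: "op_bound 0 (\<lambda>i j. 0)"
  by (simp add: op_bound_def L2_set_def)

lemma op_bound_add:
  assumes "op_bound C S" "op_bound D T"
  shows "op_bound (C + D) (\<lambda>i j. S i j + T i j)"
proof (rule op_boundI)
  fix F G :: "'a set" and x :: "'a \<Rightarrow> complex"
  assume fin: "finite F" "finite G"
  have "L2_set (\<lambda>i. cmod (\<Sum>j\<in>G. (S i j + T i j) * x j)) F
      \<le> L2_set (\<lambda>i. cmod (\<Sum>j\<in>G. S i j * x j) + cmod (\<Sum>j\<in>G. T i j * x j)) F"
    by (intro L2_set_mono) (auto simp: distrib_right sum.distrib norm_triangle_ineq)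
  also have "\<dots> \<le> L2_set (\<lambda>i. cmod (\<Sum>j\<in>G. S i j * x j)) F + L2_set (\<lambda>i. cmod (\<Sum>j\<in>G. T i j * x j)) F"
    by (rule L2_set_triangle_ineq)
  also have "\<dots> \<le> (C + D) * L2_set (\<lambda>j. cmod (x j)) G"
    using op_boundD[OF assms(1) fin, of x] op_boundD[OF assms(2) fin, of x] by (simp add: distrib_right)
  finally show "L2_set (\<lambda>i. cmod (\<Sum>j\<in>G. (S i j + T i j) * x j)) F \<le> (C + D) * L2_set (\<lambda>j. cmod (x j)) G" .
qed

lemma op_bound_scale:
  assumes "op_bound C T"
  shows "op_bound (cmod c * C) (\<lambda>i j. c * T i j)"
proof (rule op_boundI)
  fix F G :: "'a set" and x :: "'a \<Rightarrow> complex"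
  assume fin: "finite F" "finite G"
  have "L2_set (\<lambda>i. cmod (\<Sum>j\<in>G. c * T i j * x j)) F = cmod c * L2_set (\<lambda>i. cmod (\<Sum>j\<in>G. T i j * x j)) F"
    by (simp add: mult.assoc sum_distrib_left[symmetric] norm_mult L2_set_right_distrib)
  also have "\<dots> \<le> cmod c * (C * L2_set (\<lambda>j. cmod (x j)) G)"
    using op_boundD[OF assms fin] by (intro mult_left_mono) auto
  finally show "L2_set (\<lambda>i. cmod (\<Sum>j\<in>G. c * T i j * x j)) F \<le> cmod c * C * L2_set (\<lambda>j. cmod (x j)) G"
    by (simp add: mult.assoc)
qed

lemma L2_set_power2: "(L2_set f A)\<^sup>2 = (\<Sum>i\<in>A. (f i)\<^sup>2)"
  by (simp add: L2_set_def sum_nonneg)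

lemma op_bound_star:
  assumes "op_bound C T"
  shows "op_bound C (\<lambda>i j. cnj (T j i))"
proof (rule op_boundI)
  fix F G :: "'a set" and x :: "'a \<Rightarrow> complex"
  assume fin: "finite F" "finite G"
  define y where "y = (\<lambda>i. \<Sum>j\<in>G. cnj (T j i) * x j)"
  define N where "N = L2_set (\<lambda>i. cmod (y i)) F"
  have "complex_of_real (N\<^sup>2) = (\<Sum>i\<in>F. y i * cnj (y i))"
    by (simp add: N_def L2_set_power2 complex_norm_square del: of_real_power)
  also have "\<dots> = (\<Sum>i\<in>F. \<Sum>j\<in>G. x j * cnj (T j i * y i))"
  proof (rule sum.cong)
    fix i
    have "y i * cnj (y i) = (\<Sum>j\<in>G. cnj (T j i) * x j) * cnj (y i)" by (simp only: y_def)
    also have "\<dots> = (\<Sum>j\<in>G. x j * cnj (T j i * y i))"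
      unfolding sum_distrib_right by (intro sum.cong) simp_all
    finally show "y i * cnj (y i) = (\<Sum>j\<in>G. x j * cnj (T j i * y i))" .
  qed simp
  also have "\<dots> = (\<Sum>j\<in>G. x j * cnj (\<Sum>i\<in>F. T j i * y i))"
    by (subst sum.swap) (simp add: sum_distrib_left)
  finally have "N\<^sup>2 = cmod (\<Sum>j\<in>G. x j * cnj (\<Sum>i\<in>F. T j i * y i))"
    by (metis norm_of_real abs_of_nonneg zero_le_power2)
  also have "\<dots> \<le> (\<Sum>j\<in>G. \<bar>cmod (x j)\<bar> * \<bar>cmod (\<Sum>i\<in>F. T j i * y i)\<bar>)"
    by (rule order_trans[OF norm_sum]) (simp only: norm_mult complex_mod_cnj abs_norm_cancel order_refl)
  also have "\<dots> \<le> L2_set (\<lambda>j. cmod (x j)) G * L2_set (\<lambda>j. cmod (\<Sum>i\<in>F. T j i * y i)) G"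
    by (rule L2_set_mult_ineq)
  also have "\<dots> \<le> L2_set (\<lambda>j. cmod (x j)) G * (C * N)"
    unfolding N_def using op_boundD[OF assms fin(2,1)] by (intro mult_left_mono) auto
  finally have *: "N * N \<le> (C * L2_set (\<lambda>j. cmod (x j)) G) * N"
    by (simp add: power2_eq_square mult_ac)
  have "N \<ge> 0" by (simp add: N_def)
  have "0 \<le> C * L2_set (\<lambda>j. cmod (x j)) G" using op_bound_nonneg[OF assms] by simp
  with * \<open>N \<ge> 0\<close> have "N \<le> C * L2_set (\<lambda>j. cmod (x j)) G"
    by (cases "N = 0") (auto simp: mult_le_cancel_right)
  then show "L2_set (\<lambda>i. cmod (\<Sum>j\<in>G. cnj (T j i) * x j)) F \<le> C * L2_set (\<lambda>j. cmod (x j)) G"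
    by (simp add: N_def y_def)
qed

lemma op_bound_row:
  assumes "op_bound C T" "finite F"
  shows "L2_set (\<lambda>j. cmod (T i j)) F \<le> C"
  using op_bound_column[OF op_bound_star[OF assms(1)] assms(2), of i] by simp

lemma summable_L2_mult:
  assumes "\<And>F. finite F \<Longrightarrow> L2_set (\<lambda>k. cmod (s k)) F \<le> C"
      and "\<And>F. finite F \<Longrightarrow> L2_set (\<lambda>k. cmod (r k)) F \<le> D"
  shows "(\<lambda>k. s k * r k) summable_on UNIV"
proof (rule abs_summable_summable, subst abs_summable_iff_bdd_above, rule bdd_aboveI2)
  fix F :: "'a set" assume "F \<in> {F. F \<subseteq> UNIV \<and> finite F}"
  then have F: "finite F" by simp
  have "(\<Sum>k\<in>F. norm (s k * r k)) \<le> L2_set (\<lambda>k. cmod (s k)) F * L2_set (\<lambda>k. cmod (r k)) F"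
    using L2_set_mult_ineq[of "\<lambda>k. cmod (s k)" "\<lambda>k. cmod (r k)" F] by (simp add: norm_mult)
  also have "\<dots> \<le> C * D"
    using assms(1)[OF F] assms(2)[OF F] assms(1)[of "{}"]
    by (intro mult_mono) auto
  finally show "(\<Sum>k\<in>F. norm (s k * r k)) \<le> C * D" .
qed

lemma summable_matrix_mult:
  assumes "op_bound C S" "op_bound D T"
  shows "(\<lambda>k. S i k * T k j) summable_on UNIV"
  by (rule summable_L2_mult[OF op_bound_row[OF assms(1)] op_bound_column[OF assms(2)]])

lemma has_sum_finite_sum:
  fixes f :: "'b \<Rightarrow> 'a \<Rightarrow> complex"
  assumes "finite G" "\<And>j. j \<in> G \<Longrightarrow> (f j has_sum c j) A"
  shows "((\<lambda>k. \<Sum>j\<in>G. f j k) has_sum (\<Sum>j\<in>G. c j)) A"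
  using assms by (induction G rule: finite_induct) (auto intro!: has_sum_add)

lemma op_bound_mult:
  assumes S: "op_bound C S" and T: "op_bound D T"
  shows "op_bound (C * D) (\<lambda>i j. \<Sum>\<^sub>\<infinity>k. S i k * T k j)"
proof (rule op_boundI)
  fix F G :: "'a set" and x :: "'a \<Rightarrow> complex"
  assume fin: "finite F" "finite G"
  define z where "z = (\<lambda>k. \<Sum>j\<in>G. T k j * x j)"
  have z: "((\<lambda>k. S i k * z k) has_sum (\<Sum>j\<in>G. (\<Sum>\<^sub>\<infinity>k. S i k * T k j) * x j)) UNIV" for i
  proof -
    have "((\<lambda>k. \<Sum>j\<in>G. S i k * T k j * x j) has_sum (\<Sum>j\<in>G. (\<Sum>\<^sub>\<infinity>k. S i k * T k j) * x j)) UNIV"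
      by (intro has_sum_finite_sum has_sum_cmult_left has_sum_infsum summable_matrix_mult[OF S T] fin)
    then show ?thesis by (simp add: z_def sum_distrib_left mult_ac)
  qed
  have lim: "((\<lambda>K. L2_set (\<lambda>i. cmod (\<Sum>k\<in>K. S i k * z k)) F) \<longlongrightarrow>
      L2_set (\<lambda>i. cmod (\<Sum>j\<in>G. (\<Sum>\<^sub>\<infinity>k. S i k * T k j) * x j)) F) (finite_subsets_at_top UNIV)"
    unfolding L2_set_def using z[unfolded has_sum_def] by (intro tendsto_intros) 
  show "L2_set (\<lambda>i. cmod (\<Sum>j\<in>G. (\<Sum>\<^sub>\<infinity>k. S i k * T k j) * x j)) F \<le> C * D * L2_set (\<lambda>j. cmod (x j)) G"
  proof (rule tendsto_upperbound[OF lim])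
    show "\<forall>\<^sub>F K in finite_subsets_at_top UNIV.
      L2_set (\<lambda>i. cmod (\<Sum>k\<in>K. S i k * z k)) F \<le> C * D * L2_set (\<lambda>j. cmod (x j)) G"
    proof (rule eventually_finite_subsets_at_top_weakI)
      fix K :: "'a set" assume K: "finite K"
      have "L2_set (\<lambda>i. cmod (\<Sum>k\<in>K. S i k * z k)) F \<le> C * L2_set (\<lambda>k. cmod (z k)) K"
        by (rule op_boundD[OF S fin(1) K])
      also have "\<dots> \<le> C * (D * L2_set (\<lambda>j. cmod (x j)) G)"
        unfolding z_def by (intro mult_left_mono op_boundD[OF T K fin(2)] op_bound_nonneg[OF S])
      finally show "L2_set (\<lambda>i. cmod (\<Sum>k\<in>K. S i k * z k)) F \<le> C * D * L2_set (\<lambda>j. cmod (x j)) G"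
        by (simp add: mult.assoc)
    qed
  qed simp
qed

lemma matrix_mult_assoc:
  assumes S: "op_bound C S" and T: "op_bound D T" and R: "op_bound E R"
  shows "(\<Sum>\<^sub>\<infinity>l. (\<Sum>\<^sub>\<infinity>k. S i k * T k l) * R l j) = (\<Sum>\<^sub>\<infinity>k. S i k * (\<Sum>\<^sub>\<infinity>l. T k l * R l j))"
proof (rule infsumI)
  define s where "s = (\<lambda>k. S i k)"
  define r where "r = (\<lambda>l. R l j)"
  define Tr where "Tr = (\<lambda>k. \<Sum>\<^sub>\<infinity>l. T k l * r l)"
  have Tr_sum: "((\<lambda>l. T k l * r l) has_sum Tr k) UNIV" for k
    unfolding Tr_def r_def by (intro has_sum_infsum summable_matrix_mult[OF T R])
  have TR: "op_bound (D * E) (\<lambda>k j. \<Sum>\<^sub>\<infinity>l. T k l * R l j)" by (rule op_bound_mult[OF T R])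
  have sTr: "((\<lambda>k. s k * Tr k) has_sum (\<Sum>\<^sub>\<infinity>k. s k * Tr k)) UNIV"
    unfolding s_def Tr_def r_def by (intro has_sum_infsum summable_matrix_mult[OF S TR])
  have r2: "(\<lambda>l. (cmod (r l))\<^sup>2) summable_on UNIV"
  proof (rule nonneg_bdd_above_summable_on, simp, rule bdd_aboveI2)
    fix F :: "'a set" assume "F \<in> {F. F \<subseteq> UNIV \<and> finite F}"
    then have "finite F" by simp
    from op_bound_column[OF R this, of j] have "(L2_set (\<lambda>l. cmod (r l)) F)\<^sup>2 \<le> E\<^sup>2"
      unfolding r_def by (intro power_mono) auto
    then show "(\<Sum>l\<in>F. (cmod (r l))\<^sup>2) \<le> E\<^sup>2" by (simp add: L2_set_power2)
  qed
  define \<rho> where "\<rho> = (\<Sum>\<^sub>\<infinity>l. (cmod (r l))\<^sup>2)"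
  have \<rho>: "((\<lambda>F. \<Sum>l\<in>F. (cmod (r l))\<^sup>2) \<longlongrightarrow> \<rho>) (finite_subsets_at_top UNIV)"
    using infsum_tendsto[OF r2] by (simp add: \<rho>_def)
  define A where "A = (\<lambda>F. \<Sum>l\<in>F. (\<Sum>\<^sub>\<infinity>k. S i k * T k l) * R l j)"
  have bound: "cmod ((\<Sum>\<^sub>\<infinity>k. s k * Tr k) - A F) \<le> C * D * sqrt (\<rho> - (\<Sum>l\<in>F. (cmod (r l))\<^sup>2))"
    if F: "finite F" for F
  proof -
    define q where "q = (\<lambda>k. Tr k - (\<Sum>l\<in>F. T k l * r l))"
    have AF: "((\<lambda>k. s k * (\<Sum>l\<in>F. T k l * r l)) has_sum A F) UNIV"
    proof -
      have "((\<lambda>k. \<Sum>l\<in>F. S i k * T k l * r l) has_sum (\<Sum>l\<in>F. (\<Sum>\<^sub>\<infinity>k. S i k * T k l) * r l)) UNIV"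
        by (intro has_sum_finite_sum has_sum_cmult_left has_sum_infsum summable_matrix_mult[OF S T] F)
      then show ?thesis by (simp add: A_def s_def r_def sum_distrib_left mult_ac)
    qed
    have sq: "((\<lambda>k. s k * q k) has_sum ((\<Sum>\<^sub>\<infinity>k. s k * Tr k) - A F)) UNIV"
      using has_sum_add[OF sTr has_sum_uminusI[OF AF]]
      by (simp add: q_def algebra_simps)
    have qK: "L2_set (\<lambda>k. cmod (q k)) K \<le> D * sqrt (\<rho> - (\<Sum>l\<in>F. (cmod (r l))\<^sup>2))"
      if K: "finite K" for K
    proof -
      have qlim: "((\<lambda>G. L2_set (\<lambda>k. cmod (\<Sum>l\<in>G - F. T k l * r l)) K)
          \<longlongrightarrow> L2_set (\<lambda>k. cmod (q k)) K) (finite_subsets_at_top UNIV)"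
      proof -
        have "((\<lambda>G. (\<Sum>l\<in>G. T k l * r l) - (\<Sum>l\<in>F. T k l * r l)) \<longlongrightarrow> q k)
            (finite_subsets_at_top UNIV)" for k
          unfolding q_def using Tr_sum[of k, unfolded has_sum_def] by (intro tendsto_intros) 
        moreover have "\<forall>\<^sub>F G in finite_subsets_at_top UNIV.
            (\<Sum>l\<in>G. T k l * r l) - (\<Sum>l\<in>F. T k l * r l) = (\<Sum>l\<in>G - F. T k l * r l)" for k
          unfolding eventually_finite_subsets_at_top
          by (rule exI[of _ F]) (use F in \<open>auto simp: sum_diff\<close>)
        ultimately have "((\<lambda>G. \<Sum>l\<in>G - F. T k l * r l) \<longlongrightarrow> q k) (finite_subsets_at_top UNIV)" for k
          by (rule Lim_transform_eventually)
        then show ?thesis unfolding L2_set_def by (intro tendsto_intros) 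
      qed
      show ?thesis
      proof (rule tendsto_upperbound[OF qlim])
        show "\<forall>\<^sub>F G in finite_subsets_at_top UNIV. L2_set (\<lambda>k. cmod (\<Sum>l\<in>G - F. T k l * r l)) K
            \<le> D * sqrt (\<rho> - (\<Sum>l\<in>F. (cmod (r l))\<^sup>2))"
          unfolding eventually_finite_subsets_at_top
        proof (rule exI[of _ F], intro conjI F allI impI, simp)
          fix G assume G: "finite G \<and> F \<subseteq> G \<and> G \<subseteq> UNIV"
          have "(\<Sum>l\<in>G. (cmod (r l))\<^sup>2) \<le> \<rho>"
            unfolding \<rho>_def using G by (intro finite_sum_le_infsum r2) auto
          then have le: "(\<Sum>l\<in>G - F. (cmod (r l))\<^sup>2) \<le> \<rho> - (\<Sum>l\<in>F. (cmod (r l))\<^sup>2)"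
            using G F by (simp add: sum_diff)
          have "L2_set (\<lambda>k. cmod (\<Sum>l\<in>G - F. T k l * r l)) K \<le> D * L2_set (\<lambda>l. cmod (r l)) (G - F)"
            using G by (intro op_boundD[OF T K]) auto
          also have "\<dots> \<le> D * sqrt (\<rho> - (\<Sum>l\<in>F. (cmod (r l))\<^sup>2))"
            unfolding L2_set_def using le by (intro mult_left_mono op_bound_nonneg[OF T]) auto
          finally show "L2_set (\<lambda>k. cmod (\<Sum>l\<in>G - F. T k l * r l)) K
            \<le> D * sqrt (\<rho> - (\<Sum>l\<in>F. (cmod (r l))\<^sup>2))" .
        qed
      qed simp
    qed
    have lim: "((\<lambda>K. cmod (\<Sum>k\<in>K. s k * q k)) \<longlongrightarrow> cmod ((\<Sum>\<^sub>\<infinity>k. s k * Tr k) - A F))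
        (finite_subsets_at_top UNIV)"
      using sq[unfolded has_sum_def] by (intro tendsto_intros) 
    show ?thesis
    proof (rule tendsto_upperbound[OF lim])
      show "\<forall>\<^sub>F K in finite_subsets_at_top UNIV. cmod (\<Sum>k\<in>K. s k * q k)
          \<le> C * D * sqrt (\<rho> - (\<Sum>l\<in>F. (cmod (r l))\<^sup>2))"
      proof (rule eventually_finite_subsets_at_top_weakI)
        fix K :: "'a set" assume K: "finite K"
        have "cmod (\<Sum>k\<in>K. s k * q k) \<le> (\<Sum>k\<in>K. \<bar>cmod (s k)\<bar> * \<bar>cmod (q k)\<bar>)"
          by (rule order_trans[OF norm_sum]) (simp add: norm_mult)
        also have "\<dots> \<le> L2_set (\<lambda>k. cmod (s k)) K * L2_set (\<lambda>k. cmod (q k)) K"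
          by (rule L2_set_mult_ineq)
        also have "\<dots> \<le> C * (D * sqrt (\<rho> - (\<Sum>l\<in>F. (cmod (r l))\<^sup>2)))"
          unfolding s_def by (intro mult_mono qK[OF K] op_bound_row[OF S K] op_bound_nonneg[OF S]) auto
        finally show "cmod (\<Sum>k\<in>K. s k * q k) \<le> C * D * sqrt (\<rho> - (\<Sum>l\<in>F. (cmod (r l))\<^sup>2))"
          by (simp add: mult.assoc)
      qed
    qed simp
  qed
  have lim0: "((\<lambda>F. C * D * sqrt (\<rho> - (\<Sum>l\<in>F. (cmod (r l))\<^sup>2))) \<longlongrightarrow> 0) (finite_subsets_at_top UNIV)"
  proof -
    have "((\<lambda>F. C * D * sqrt (\<rho> - (\<Sum>l\<in>F. (cmod (r l))\<^sup>2))) \<longlongrightarrow> C * D * sqrt (\<rho> - \<rho>)) (finite_subsets_at_top UNIV)"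
      by (intro tendsto_intros \<rho>)
    then show ?thesis by simp
  qed
  have "((\<lambda>F. (\<Sum>\<^sub>\<infinity>k. s k * Tr k) - A F) \<longlongrightarrow> 0) (finite_subsets_at_top UNIV)"
    by (rule Lim_null_comparison[OF eventually_finite_subsets_at_top_weakI lim0]) (rule bound)
  from tendsto_diff[OF tendsto_const this]
  have "((\<lambda>F. (\<Sum>\<^sub>\<infinity>k. s k * Tr k) - ((\<Sum>\<^sub>\<infinity>k. s k * Tr k) - A F)) \<longlongrightarrow>
      (\<Sum>\<^sub>\<infinity>k. s k * Tr k) - 0) (finite_subsets_at_top UNIV)" .
  then have "(A \<longlongrightarrow> (\<Sum>\<^sub>\<infinity>k. s k * Tr k)) (finite_subsets_at_top UNIV)"
    by simp
  then show "((\<lambda>l. (\<Sum>\<^sub>\<infinity>k. S i k * T k l) * R l j) has_sum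
      (\<Sum>\<^sub>\<infinity>k. S i k * (\<Sum>\<^sub>\<infinity>l. T k l * R l j))) UNIV"
    by (simp add: has_sum_def A_def s_def Tr_def r_def)
qed

lemma op_bound_tensor:
  fixes S :: "'a \<Rightarrow> 'a \<Rightarrow> complex" and T :: "'b \<Rightarrow> 'b \<Rightarrow> complex"
  assumes S: "op_bound C S" and T: "op_bound D T"
  shows "op_bound (C * D) (\<lambda>p q. S (fst p) (fst q) * T (snd p) (snd q))"
proof (rule op_boundI)
  fix F G :: "('a \<times> 'b) set" and x :: "'a \<times> 'b \<Rightarrow> complex"
  assume fin: "finite F" "finite G"
  define F1 where "F1 = fst ` F"
  define F2 where "F2 = snd ` F"
  define G1 where "G1 = fst ` G"
  define G2 where "G2 = snd ` G"
  have fins: "finite F1" "finite F2" "finite G1" "finite G2"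
    using fin by (auto simp: F1_def F2_def G1_def G2_def)
  have FF: "F \<subseteq> F1 \<times> F2" and GG: "G \<subseteq> G1 \<times> G2"
    by (force simp: F1_def F2_def G1_def G2_def)+
  define x' where "x' = (\<lambda>p. if p \<in> G then x p else 0)"
  define z where "z = (\<lambda>k j. \<Sum>l\<in>G2. T j l * x' (k, l))"
  have C0: "0 \<le> C" and D0: "0 \<le> D" using op_bound_nonneg S T by blast+
  have eq: "(\<Sum>q\<in>G. S i (fst q) * T j (snd q) * x q) = (\<Sum>k\<in>G1. S i k * z k j)" for i j
  proof -
    have "(\<Sum>q\<in>G. S i (fst q) * T j (snd q) * x q) = (\<Sum>q\<in>G1 \<times> G2. S i (fst q) * T j (snd q) * x' q)"
      using GG fins by (intro sum.mono_neutral_cong_left) (auto simp: x'_def)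
    also have "\<dots> = (\<Sum>k\<in>G1. S i k * z k j)"
      by (subst sum.cartesian_product') (simp add: z_def sum_distrib_left mult_ac split_def)
    finally show ?thesis .
  qed
  have 1: "(\<Sum>i\<in>F1. (cmod (\<Sum>k\<in>G1. S i k * z k j))\<^sup>2) \<le> C\<^sup>2 * (\<Sum>k\<in>G1. (cmod (z k j))\<^sup>2)" for j
  proof -
    have "(L2_set (\<lambda>i. cmod (\<Sum>k\<in>G1. S i k * z k j)) F1)\<^sup>2 \<le> (C * L2_set (\<lambda>k. cmod (z k j)) G1)\<^sup>2"
      by (intro power_mono op_boundD[OF S] fins) auto
    then show ?thesis by (simp only: L2_set_power2 power_mult_distrib)
  qed
  have 2: "(\<Sum>j\<in>F2. (cmod (z k j))\<^sup>2) \<le> D\<^sup>2 * (\<Sum>l\<in>G2. (cmod (x' (k, l)))\<^sup>2)" for k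
  proof -
    have "(L2_set (\<lambda>j. cmod (z k j)) F2)\<^sup>2 \<le> (D * L2_set (\<lambda>l. cmod (x' (k, l))) G2)\<^sup>2"
      unfolding z_def by (intro power_mono op_boundD[OF T] fins) auto
    then show ?thesis by (simp only: L2_set_power2 power_mult_distrib)
  qed
  have "(L2_set (\<lambda>p. cmod (\<Sum>q\<in>G. S (fst p) (fst q) * T (snd p) (snd q) * x q)) F)\<^sup>2
      = (\<Sum>p\<in>F. (cmod (\<Sum>k\<in>G1. S (fst p) k * z k (snd p)))\<^sup>2)"
    by (simp only: L2_set_power2 eq)
  also have "\<dots> \<le> (\<Sum>p\<in>F1 \<times> F2. (cmod (\<Sum>k\<in>G1. S (fst p) k * z k (snd p)))\<^sup>2)"
    using FF fins by (intro sum_mono2) auto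
  also have "\<dots> = (\<Sum>j\<in>F2. \<Sum>i\<in>F1. (cmod (\<Sum>k\<in>G1. S i k * z k j))\<^sup>2)"
    by (subst sum.swap) (simp add: sum.cartesian_product split_def)
  also have "\<dots> \<le> (\<Sum>j\<in>F2. C\<^sup>2 * (\<Sum>k\<in>G1. (cmod (z k j))\<^sup>2))"
    by (intro sum_mono 1)
  also have "\<dots> = C\<^sup>2 * (\<Sum>k\<in>G1. \<Sum>j\<in>F2. (cmod (z k j))\<^sup>2)"
    by (subst sum.swap) (simp add: sum_distrib_left)
  also have "\<dots> \<le> C\<^sup>2 * (\<Sum>k\<in>G1. D\<^sup>2 * (\<Sum>l\<in>G2. (cmod (x' (k, l)))\<^sup>2))"
    by (intro mult_left_mono sum_mono 2) auto
  also have "\<dots> = C\<^sup>2 * D\<^sup>2 * (\<Sum>p\<in>G1 \<times> G2. (cmod (x' p))\<^sup>2)"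
    by (simp add: sum_distrib_left[symmetric] sum.cartesian_product split_def)
  also have "(\<Sum>p\<in>G1 \<times> G2. (cmod (x' p))\<^sup>2) = (\<Sum>p\<in>G. (cmod (x p))\<^sup>2)"
    using GG fins by (intro sum.mono_neutral_cong_right) (auto simp: x'_def)
  finally have "(L2_set (\<lambda>p. cmod (\<Sum>q\<in>G. S (fst p) (fst q) * T (snd p) (snd q) * x q)) F)\<^sup>2
      \<le> (C * D * L2_set (\<lambda>p. cmod (x p)) G)\<^sup>2"
    by (simp add: power_mult_distrib L2_set_power2)
  then show "L2_set (\<lambda>p. cmod (\<Sum>q\<in>G. S (fst p) (fst q) * T (snd p) (snd q) * x q)) F
      \<le> C * D * L2_set (\<lambda>p. cmod (x p)) G"
    by (rule power2_le_imp_le) (use C0 D0 in auto)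
qed

lemma op_bound_compress:
  fixes T :: "'a \<Rightarrow> 'a \<Rightarrow> complex" and f :: "'b \<Rightarrow> 'a"
  assumes T: "op_bound C T" and f: "inj f"
  shows "op_bound C (\<lambda>i j :: 'b. T (f i) (f j))"
proof (rule op_boundI)
  fix F G :: "'b set" and x :: "'b \<Rightarrow> complex"
  assume fin: "finite F" "finite G"
  have i: "inj_on f A" for A using f by (simp add: inj_on_def)
  have [simp]: "inv_into UNIV f (f j) = j" for j using f by simp
  have "L2_set (\<lambda>i. cmod (\<Sum>j\<in>f ` G. T i j * x (inv_into UNIV f j))) (f ` F)
      \<le> C * L2_set (\<lambda>j. cmod (x (inv_into UNIV f j))) (f ` G)"
    using fin by (intro op_boundD[OF T]) auto
  then show "L2_set (\<lambda>i. cmod (\<Sum>j\<in>G. T (f i) (f j) * x j)) F \<le> C * L2_set (\<lambda>j. cmod (x j)) G"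
    by (simp add: L2_set_def sum.reindex[OF i])
qed


lemma op_bound_pad:
  fixes T :: "'a \<Rightarrow> 'a \<Rightarrow> complex" and f :: "'a \<Rightarrow> 'b"
  assumes T: "op_bound C T" and f: "inj f"
    and M: "\<And>i j. M (f i) (f j) = T i j"
    and M0: "\<And>p q. p \<notin> range f \<or> q \<notin> range f \<Longrightarrow> M p q = 0"
  shows "op_bound C M"
proof (rule op_boundI)
  fix F G :: "'b set" and x :: "'b \<Rightarrow> complex"
  assume fin: "finite F" "finite G"
  define F' where "F' = f -` F"
  define G' where "G' = f -` G"
  have fin': "finite F'" "finite G'" using fin f by (auto simp: F'_def G'_def intro: finite_vimageI)
  have i: "inj_on f A" for A using f by (simp add: inj_on_def)
  have sub: "f ` F' \<subseteq> F" "f ` G' \<subseteq> G" by (auto simp: F'_def G'_def)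
  have eq: "(\<Sum>q\<in>G. M (f i) q * x q) = (\<Sum>j\<in>G'. T i j * x (f j))" for i
  proof -
    have "(\<Sum>q\<in>G. M (f i) q * x q) = (\<Sum>q\<in>f ` G'. M (f i) q * x q)"
      using sub fin by (intro sum.mono_neutral_right) (auto simp: G'_def intro!: M0)
    then show ?thesis by (simp add: sum.reindex[OF i] M)
  qed
  have "L2_set (\<lambda>p. cmod (\<Sum>q\<in>G. M p q * x q)) F = L2_set (\<lambda>p. cmod (\<Sum>q\<in>G. M p q * x q)) (f ` F')"
  proof -
    have "(\<Sum>p\<in>F. (cmod (\<Sum>q\<in>G. M p q * x q))\<^sup>2) = (\<Sum>p\<in>f ` F'. (cmod (\<Sum>q\<in>G. M p q * x q))\<^sup>2)"
    proof (rule sum.mono_neutral_right)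
      show "\<forall>p\<in>F - f ` F'. (cmod (\<Sum>q\<in>G. M p q * x q))\<^sup>2 = 0"
      proof
        fix p assume "p \<in> F - f ` F'"
        then have "p \<notin> range f" by (auto simp: F'_def)
        then have "M p q = 0" for q by (simp add: M0)
        then show "(cmod (\<Sum>q\<in>G. M p q * x q))\<^sup>2 = 0" by simp
      qed
    qed (use sub fin in auto)
    then show ?thesis by (simp add: L2_set_def)
  qed
  also have "\<dots> = L2_set (\<lambda>i. cmod (\<Sum>j\<in>G'. T i j * x (f j))) F'"
    by (simp add: L2_set_def sum.reindex[OF i] eq)
  also have "\<dots> \<le> C * L2_set (\<lambda>j. cmod (x (f j))) G'"
    by (rule op_boundD[OF T fin'])
  also have "\<dots> = C * L2_set (\<lambda>q. cmod (x q)) (f ` G')"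
    by (simp add: L2_set_def sum.reindex[OF i])
  also have "\<dots> \<le> C * L2_set (\<lambda>q. cmod (x q)) G"
    unfolding L2_set_def using sub fin
    by (intro mult_left_mono op_bound_nonneg[OF T] real_sqrt_le_mono sum_mono2) auto
  finally show "L2_set (\<lambda>p. cmod (\<Sum>q\<in>G. M p q * x q)) F \<le> C * L2_set (\<lambda>q. cmod (x q)) G" .
qed

lemma op_bound_direct_sum:
  fixes S :: "'a \<Rightarrow> 'a \<Rightarrow> complex" and T :: "'b \<Rightarrow> 'b \<Rightarrow> complex"
  assumes S: "op_bound C S" and T: "op_bound D T"
  shows "op_bound (C + D) (\<lambda>p q. case (p, q) of (Inl i, Inl j) \<Rightarrow> S i j
           | (Inr i, Inr j) \<Rightarrow> T i j | _ \<Rightarrow> 0)"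
proof -
  define M where "M = (\<lambda>(p :: 'a + 'b) (q :: 'a + 'b). case (p, q) of (Inl i, Inl j) \<Rightarrow> S i j | _ \<Rightarrow> (0::complex))"
  define N where "N = (\<lambda>(p :: 'a + 'b) (q :: 'a + 'b). case (p, q) of (Inr i, Inr j) \<Rightarrow> T i j | _ \<Rightarrow> (0::complex))"
  have "op_bound C M"
  proof (rule op_bound_pad[OF S, where f = Inl])
    fix p q :: "'a + 'b" assume "p \<notin> range Inl \<or> q \<notin> range Inl"
    then show "M p q = 0" by (cases p; cases q) (simp_all add: M_def)
  qed (simp_all add: M_def)
  moreover have "op_bound D N"
  proof (rule op_bound_pad[OF T, where f = Inr])
    fix p q :: "'a + 'b" assume "p \<notin> range Inr \<or> q \<notin> range Inr"
    then show "N p q = 0" by (cases p; cases q) (simp_all add: N_def)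
  qed (simp_all add: N_def)
  moreover have "(\<lambda>p q. case (p, q) of (Inl i, Inl j) \<Rightarrow> S i j
           | (Inr i, Inr j) \<Rightarrow> T i j | _ \<Rightarrow> 0) = (\<lambda>p q. M p q + N p q)"
  proof (intro ext)
    fix p q
    show "(case (p, q) of (Inl i, Inl j) \<Rightarrow> S i j | (Inr i, Inr j) \<Rightarrow> T i j | _ \<Rightarrow> 0) = M p q + N p q"
      by (cases p; cases q) (simp_all add: M_def N_def)
  qed
  ultimately show ?thesis by (simp only: op_bound_add)
qed

lemma op_bound_partial_injection:
  assumes f: "inj_on f K"
  shows "op_bound 1 (\<lambda>i j. of_bool (j \<in> K \<and> i = f j))"
proof (rule op_boundI)
  fix F G :: "'a set" and x :: "'a \<Rightarrow> complex"
  assume fin: "finite F" "finite G"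
  have 1: "(cmod (\<Sum>j\<in>G. of_bool (j \<in> K \<and> i = f j) * x j))\<^sup>2
      = (\<Sum>j\<in>G. of_bool (j \<in> K \<and> i = f j) * (cmod (x j))\<^sup>2)" for i
  proof (cases "\<exists>k\<in>G. k \<in> K \<and> i = f k")
    case True
    then obtain k where k: "k \<in> G" "k \<in> K" "i = f k" by blast
    have iff: "(j \<in> K \<and> i = f j) = (j = k)" for j
      using k f by (auto dest: inj_onD)
    show ?thesis using k(1) fin unfolding iff by (simp add: of_bool_def if_distrib if_distribR cong: if_cong)
  next
    case False
    then have "(\<Sum>j\<in>G. of_bool (j \<in> K \<and> i = f j) * x j) = 0"
      and "(\<Sum>j\<in>G. of_bool (j \<in> K \<and> i = f j) * (cmod (x j))\<^sup>2) = 0"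
      by (auto intro!: sum.neutral)
    then show ?thesis by simp
  qed
  have "(L2_set (\<lambda>i. cmod (\<Sum>j\<in>G. of_bool (j \<in> K \<and> i = f j) * x j)) F)\<^sup>2
      = (\<Sum>j\<in>G. \<Sum>i\<in>F. of_bool (j \<in> K \<and> i = f j) * (cmod (x j))\<^sup>2)"
    unfolding L2_set_power2 1 by (rule sum.swap)
  also have "\<dots> \<le> (\<Sum>j\<in>G. (cmod (x j))\<^sup>2)"
  proof (rule sum_mono)
    fix j
    have "(\<Sum>i\<in>F. of_bool (j \<in> K \<and> i = f j) * (cmod (x j))\<^sup>2) \<le> (\<Sum>i\<in>F. if i = f j then (cmod (x j))\<^sup>2 else 0)"
      by (intro sum_mono) auto
    also have "\<dots> \<le> (cmod (x j))\<^sup>2" using fin by simp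
    finally show "(\<Sum>i\<in>F. of_bool (j \<in> K \<and> i = f j) * (cmod (x j))\<^sup>2) \<le> (cmod (x j))\<^sup>2" .
  qed
  finally have "(L2_set (\<lambda>i. cmod (\<Sum>j\<in>G. of_bool (j \<in> K \<and> i = f j) * x j)) F)\<^sup>2
      \<le> (L2_set (\<lambda>j. cmod (x j)) G)\<^sup>2" by (simp add: L2_set_power2)
  then show "L2_set (\<lambda>i. cmod (\<Sum>j\<in>G. of_bool (j \<in> K \<and> i = f j) * x j)) F
      \<le> 1 * L2_set (\<lambda>j. cmod (x j)) G"
    unfolding mult_1 by (rule power2_le_imp_le) simp
qed

subsection \<open>The normed algebra of bounded operators\<close>

typedef 'i bop = "{T :: 'i \<Rightarrow> 'i \<Rightarrow> complex. \<exists>C. op_bound C T}"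
  morphisms entry Bop
  using op_bound_zero by blast

setup_lifting type_definition_bop

lemma bop_eqI: "(\<And>i j. entry S i j = entry T i j) \<Longrightarrow> S = T"
  by (metis entry_inject ext)

instantiation bop :: (type) real_normed_algebra
begin

lift_definition zero_bop :: "'a bop" is "\<lambda>i j. 0"
  using op_bound_zero by blast

lift_definition plus_bop :: "'a bop \<Rightarrow> 'a bop \<Rightarrow> 'a bop" is "\<lambda>S T i j. S i j + T i j"
  using op_bound_add by blast

lift_definition uminus_bop :: "'a bop \<Rightarrow> 'a bop" is "\<lambda>T i j. - T i j"
  using op_bound_scale[of _ _ "- 1"] by auto

definition minus_bop :: "'a bop \<Rightarrow> 'a bop \<Rightarrow> 'a bop" where
  "minus_bop S T = S + (- T)"

lift_definition scaleR_bop :: "real \<Rightarrow> 'a bop \<Rightarrow> 'a bop" is "\<lambda>r T i j. of_real r * T i j"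
  using op_bound_scale by blast

lift_definition times_bop :: "'a bop \<Rightarrow> 'a bop \<Rightarrow> 'a bop" is
  "\<lambda>S T i j. \<Sum>\<^sub>\<infinity>k. S i k * T k j"
  using op_bound_mult by blast

definition norm_bop :: "'a bop \<Rightarrow> real" where
  "norm_bop T = Inf {C. op_bound C (entry T)}"

definition dist_bop :: "'a bop \<Rightarrow> 'a bop \<Rightarrow> real" where
  "dist_bop S T = norm (S - T)"

definition sgn_bop :: "'a bop \<Rightarrow> 'a bop" where
  "sgn_bop T = scaleR (inverse (norm T)) T"

definition uniformity_bop :: "('a bop \<times> 'a bop) filter" where
  "uniformity_bop = (INF e\<in>{0 <..}. principal {(S, T). dist S T < e})"

definition open_bop :: "'a bop set \<Rightarrow> bool" where
  "open_bop U \<longleftrightarrow> (\<forall>T\<in>U. eventually (\<lambda>(T', S). T' = T \<longrightarrow> S \<in> U) uniformity)"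

lemma bop_norm_le: "op_bound C (entry T) \<Longrightarrow> norm T \<le> C" for T :: "'a bop"
  unfolding norm_bop_def
  by (rule cInf_lower) (auto intro!: bdd_belowI[of _ 0] dest: op_bound_nonneg)

lemma bop_op_bound_norm: "op_bound (norm T) (entry T)" for T :: "'a bop"
proof (rule op_boundI)
  fix F G :: "'a set" and x :: "'a \<Rightarrow> complex"
  assume fin: "finite F" "finite G"
  let ?l = "L2_set (\<lambda>i. cmod (\<Sum>j\<in>G. entry T i j * x j)) F"
  let ?r = "L2_set (\<lambda>j. cmod (x j)) G"
  obtain C where C: "op_bound C (entry T)" using entry by blast
  show "?l \<le> norm T * ?r"
  proof (cases "?r = 0")
    case True
    then show ?thesis using op_boundD[OF C fin, of x] by simp
  next
    case False
    then have r: "?r > 0" using L2_set_nonneg by (metis less_eq_real_def)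
    have "?l / ?r \<le> norm T"
      unfolding norm_bop_def
    proof (rule cInf_greatest)
      show "{C. op_bound C (entry T)} \<noteq> {}" using C by blast
      fix D assume "D \<in> {C. op_bound C (entry T)}"
      then show "?l / ?r \<le> D" using op_boundD[OF _ fin, of D "entry T" x] r
        by (simp add: divide_le_eq)
    qed
    then show ?thesis using r by (simp add: divide_le_eq)
  qed
qed

instance
proof
  fix R S T :: "'a bop" and a b :: real
  note simps = plus_bop.rep_eq uminus_bop.rep_eq zero_bop.rep_eq scaleR_bop.rep_eq times_bop.rep_eq
  show "S - T = S + - T" by (rule minus_bop_def)
  show "R + S + T = R + (S + T)" by (rule bop_eqI) (simp add: simps)
  show "S + T = T + S" by (rule bop_eqI) (simp add: simps)
  show "0 + T = T" by (rule bop_eqI) (simp add: simps)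
  show "- T + T = 0" by (rule bop_eqI) (simp add: simps)
  show "a *\<^sub>R (S + T) = a *\<^sub>R S + a *\<^sub>R T" by (rule bop_eqI) (simp add: simps algebra_simps)
  show "(a + b) *\<^sub>R T = a *\<^sub>R T + b *\<^sub>R T" by (rule bop_eqI) (simp add: simps algebra_simps)
  show "a *\<^sub>R b *\<^sub>R T = (a * b) *\<^sub>R T" by (rule bop_eqI) (simp add: simps)
  show "1 *\<^sub>R T = T" by (rule bop_eqI) (simp add: simps)
  have summ: "(\<lambda>k. entry S i k * entry T k j) summable_on UNIV" for S T :: "'a bop" and i j
    by (rule summable_matrix_mult[OF bop_op_bound_norm bop_op_bound_norm])
  show "R * S * T = R * (S * T)"
    by (rule bop_eqI)
      (simp add: simps matrix_mult_assoc[OF bop_op_bound_norm bop_op_bound_norm bop_op_bound_norm])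
  show "(R + S) * T = R * T + S * T"
    by (rule bop_eqI) (simp add: simps distrib_right infsum_add[OF summ summ])
  show "R * (S + T) = R * S + R * T"
    by (rule bop_eqI) (simp add: simps distrib_left infsum_add[OF summ summ])
  show "a *\<^sub>R S * T = a *\<^sub>R (S * T)"
    by (rule bop_eqI) (simp add: simps mult.assoc infsum_cmult_right')
  show "S * a *\<^sub>R T = a *\<^sub>R (S * T)"
    by (rule bop_eqI) (simp add: simps mult.left_commute infsum_cmult_right')
  show "dist S T = norm (S - T)" by (rule dist_bop_def)
  show "sgn T = inverse (norm T) *\<^sub>R T" by (rule sgn_bop_def)
  show "uniformity = (INF e\<in>{0 <..}. principal {(S :: 'a bop, T). dist S T < e})"
    by (rule uniformity_bop_def)
  show "open U \<longleftrightarrow> (\<forall>T\<in>U. \<forall>\<^sub>F (T', S) in uniformity. T' = T \<longrightarrow> S \<in> U)" for U :: "'a bop set"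
    by (rule open_bop_def)
  show "norm T = 0 \<longleftrightarrow> T = 0"
  proof
    assume "norm T = 0"
    then have "cmod (entry T i j) \<le> 0" for i j
      using op_bound_entry[OF bop_op_bound_norm[of T], of i j] by simp
    then show "T = 0" by (intro bop_eqI) (simp add: simps)
  next
    assume "T = 0"
    then have "op_bound 0 (entry T)" using op_bound_zero by (simp add: zero_bop.rep_eq)
    then have "norm T \<le> 0" by (rule bop_norm_le)
    then show "norm T = 0" using op_bound_nonneg[OF bop_op_bound_norm[of T]] by simp
  qed
  show "norm (S + T) \<le> norm S + norm T"
    by (rule bop_norm_le) (unfold plus_bop.rep_eq, rule op_bound_add[OF bop_op_bound_norm bop_op_bound_norm])
  have scale_le: "norm (a *\<^sub>R T) \<le> \<bar>a\<bar> * norm T" for a and T :: "'a bop"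
    by (rule bop_norm_le, unfold scaleR_bop.rep_eq)
      (use op_bound_scale[OF bop_op_bound_norm, of "of_real a" T] in simp)
  show "norm (a *\<^sub>R T) = \<bar>a\<bar> * norm T"
  proof (cases "a = 0")
    case True
    have "norm (0 *\<^sub>R T) \<le> 0" using scale_le[of 0 T] by simp
    then show ?thesis using True op_bound_nonneg[OF bop_op_bound_norm[of "0 *\<^sub>R T"]] by simp
  next
    case False
    have "inverse a *\<^sub>R (a *\<^sub>R T) = T" using False by (intro bop_eqI) (simp add: simps)
    then have "norm T \<le> \<bar>inverse a\<bar> * norm (a *\<^sub>R T)" using scale_le[of "inverse a" "a *\<^sub>R T"] by simp
    then have "\<bar>a\<bar> * norm T \<le> norm (a *\<^sub>R T)" using False by (simp add: field_simps)
    then show ?thesis using scale_le[of a T] by simp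
  qed
  show "norm (S * T) \<le> norm S * norm T"
    by (rule bop_norm_le) (unfold times_bop.rep_eq, rule op_bound_mult[OF bop_op_bound_norm bop_op_bound_norm])
qed

end

text \<open>
  \<open>real_normed_algebra\<close> only knows the real scalars; the complex ones are added by hand.
\<close>

lift_definition scaleC :: "complex \<Rightarrow> 'i bop \<Rightarrow> 'i bop" (infixr \<open>*\<^sub>C\<close> 75) is
  "\<lambda>c T i j. c * T i j"
  using op_bound_scale by blast

lemma vector_space_scaleC: "vector_space (scaleC :: complex \<Rightarrow> 'i bop \<Rightarrow> 'i bop)"
  by unfold_locales (auto intro!: bop_eqI simp: scaleC.rep_eq plus_bop.rep_eq algebra_simps)

lift_definition star :: "'i bop \<Rightarrow> 'i bop" is "\<lambda>T i j. cnj (T j i)"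
  using op_bound_star by blast

text \<open>
  l2 over a product type is the Hilbert space tensor product, and l2 over a sum type the Hilbert
  space direct sum.
\<close>

lift_definition tensor :: "'i bop \<Rightarrow> 'j bop \<Rightarrow> ('i \<times> 'j) bop" (infixr \<open>\<otimes>\<^sub>o\<close> 72) is
  "\<lambda>S T p q. S (fst p) (fst q) * T (snd p) (snd q)"
  using op_bound_tensor by blast

lift_definition direct_sum :: "'i bop \<Rightarrow> 'j bop \<Rightarrow> ('i + 'j) bop" (infixr \<open>\<oplus>\<^sub>o\<close> 65) is
  "\<lambda>S T p q. case (p, q) of (Inl i, Inl j) \<Rightarrow> S i j | (Inr i, Inr j) \<Rightarrow> T i j | _ \<Rightarrow> 0"
  using op_bound_direct_sum by blast

lift_definition flip :: "('i \<times> 'j) bop \<Rightarrow> ('j \<times> 'i) bop" is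
  "\<lambda>T p q. T (prod.swap p) (prod.swap q)"
  using op_bound_compress[OF _ inj_swap] by blast

lift_definition assoc_op :: "(('i \<times> 'j) \<times> 'k) bop \<Rightarrow> ('i \<times> 'j \<times> 'k) bop" is
  "\<lambda>T p q. T ((fst p, fst (snd p)), snd (snd p)) ((fst q, fst (snd q)), snd (snd q))"
proof -
  fix T :: "('i \<times> 'j) \<times> 'k \<Rightarrow> ('i \<times> 'j) \<times> 'k \<Rightarrow> complex"
  assume "\<exists>C. op_bound C T"
  then obtain C where C: "op_bound C T" ..
  have inj: "inj (\<lambda>p :: 'i \<times> 'j \<times> 'k. ((fst p, fst (snd p)), snd (snd p)))"
    by (rule injI) (simp add: prod_eq_iff)
  show "\<exists>C. op_bound C (\<lambda>p q :: 'i \<times> 'j \<times> 'k.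
      T ((fst p, fst (snd p)), snd (snd p)) ((fst q, fst (snd q)), snd (snd q)))"
    by (rule exI, rule op_bound_compress[OF C inj])
qed

text \<open>
  \<open>slice i\<close> is the slice map (w \<otimes> id) of the vector state w(T) = T i i.
\<close>

lift_definition slice :: "'i \<Rightarrow> ('i \<times> 'j) bop \<Rightarrow> 'j bop" is
  "\<lambda>i0 T i j. T (i0, i) (i0, j)"
proof -
  fix i0 :: 'i and T :: "'i \<times> 'j \<Rightarrow> 'i \<times> 'j \<Rightarrow> complex"
  assume "\<exists>C. op_bound C T"
  then obtain C where C: "op_bound C T" ..
  have inj: "inj (Pair i0 :: 'j \<Rightarrow> 'i \<times> 'j)"
    by (rule injI) simp
  show "\<exists>C. op_bound C (\<lambda>i j. T (i0, i) (i0, j))"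
    by (rule exI, rule op_bound_compress[OF C inj])
qed


section \<open>C*-algebras and minimal tensor products\<close>

text \<open>
  C*-algebras are taken in their concrete form, as norm-closed *-subalgebras of some B(l2(I))
  (Gelfand-Naimark). The unit of a unital C*-algebra need not be the identity operator of l2(I).
\<close>

definition cspan :: "'i bop set \<Rightarrow> 'i bop set" where
  "cspan = module.span scaleC"

definition cstar_algebra :: "'i bop set \<Rightarrow> bool" where
  "cstar_algebra A \<longleftrightarrow> module.subspace scaleC A \<and> closed A \<and>
     (\<forall>a\<in>A. \<forall>b\<in>A. a * b \<in> A) \<and> (\<forall>a\<in>A. star a \<in> A)"

definition is_unit_of :: "'i bop set \<Rightarrow> 'i bop \<Rightarrow> bool" where
  "is_unit_of A e \<longleftrightarrow> e \<in> A \<and> (\<forall>a\<in>A. e * a = a \<and> a * e = a)"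

definition unit_of :: "'i bop set \<Rightarrow> 'i bop" where
  "unit_of A = (THE e. is_unit_of A e)"

definition unital_cstar_algebra :: "'i bop set \<Rightarrow> bool" where
  "unital_cstar_algebra A \<longleftrightarrow> cstar_algebra A \<and> (\<exists>e. is_unit_of A e)"

definition direct_sum_algebra :: "'i bop set \<Rightarrow> 'j bop set \<Rightarrow> ('i + 'j) bop set" where
  "direct_sum_algebra A B = {a \<oplus>\<^sub>o b | a b. a \<in> A \<and> b \<in> B}"

definition alg_tensor :: "'i bop set \<Rightarrow> 'j bop set \<Rightarrow> ('i \<times> 'j) bop set" where
  "alg_tensor A B = cspan {a \<otimes>\<^sub>o b | a b. a \<in> A \<and> b \<in> B}"

definition min_tensor :: "'i bop set \<Rightarrow> 'j bop set \<Rightarrow> ('i \<times> 'j) bop set" where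
  "min_tensor A B = closure (alg_tensor A B)"

text \<open>Continuity is automatic for *-homomorphisms between C*-algebras.\<close>

definition star_hom :: "'i bop set \<Rightarrow> 'j bop set \<Rightarrow> ('i bop \<Rightarrow> 'j bop) \<Rightarrow> bool" where
  "star_hom A B \<phi> \<longleftrightarrow> \<phi> \<in> A \<rightarrow> B \<and>
     (\<forall>a\<in>A. \<forall>b\<in>A. \<phi> (a + b) = \<phi> a + \<phi> b \<and> \<phi> (a * b) = \<phi> a * \<phi> b) \<and>
     (\<forall>c. \<forall>a\<in>A. \<phi> (c *\<^sub>C a) = c *\<^sub>C \<phi> a) \<and>
     (\<forall>a\<in>A. \<phi> (star a) = star (\<phi> a))"

definition unital_star_hom :: "'i bop set \<Rightarrow> 'j bop set \<Rightarrow> ('i bop \<Rightarrow> 'j bop) \<Rightarrow> bool" where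
  "unital_star_hom A B \<phi> \<longleftrightarrow> star_hom A B \<phi> \<and> \<phi> (unit_of A) = unit_of B"

text \<open>
  \<open>tensor_hom A B C D \<phi> \<psi> F\<close>: on the minimal tensor product of A and B, F is \<open>\<phi> \<otimes> \<psi>\<close>.
  For *-homomorphisms \<open>\<phi>\<close> from A to C and \<open>\<psi>\<close> from B to D such an F always exists and is unique
  on its domain, so quantifying it existentially amounts to writing \<open>\<phi> \<otimes> \<psi>\<close>.
\<close>

definition tensor_hom :: "'i bop set \<Rightarrow> 'j bop set \<Rightarrow> 'k bop set \<Rightarrow> 'l bop set \<Rightarrow>
    ('i bop \<Rightarrow> 'k bop) \<Rightarrow> ('j bop \<Rightarrow> 'l bop) \<Rightarrow> (('i \<times> 'j) bop \<Rightarrow> ('k \<times> 'l) bop) \<Rightarrow> bool" where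
  "tensor_hom A B C D \<phi> \<psi> F \<longleftrightarrow> star_hom (min_tensor A B) (min_tensor C D) F \<and>
     (\<forall>a\<in>A. \<forall>b\<in>B. F (a \<otimes>\<^sub>o b) = \<phi> a \<otimes>\<^sub>o \<psi> b)"

section \<open>Compact quantum groups and their actions\<close>

definition coassociative :: "'i bop set \<Rightarrow> ('i bop \<Rightarrow> ('i \<times> 'i) bop) \<Rightarrow> bool" where
  "coassociative Q \<Delta> \<longleftrightarrow> (\<exists>F G.
     tensor_hom Q Q (min_tensor Q Q) Q \<Delta> id F \<and> tensor_hom Q Q Q (min_tensor Q Q) id \<Delta> G \<and>
     (\<forall>a\<in>Q. assoc_op (F (\<Delta> a)) = G (\<Delta> a)))"

definition compact_quantum_group :: "'i bop set \<Rightarrow> ('i bop \<Rightarrow> ('i \<times> 'i) bop) \<Rightarrow> bool" where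
  "compact_quantum_group Q \<Delta> \<longleftrightarrow> unital_cstar_algebra Q \<and>
     unital_star_hom Q (min_tensor Q Q) \<Delta> \<and> coassociative Q \<Delta> \<and>
     closure (cspan {\<Delta> a * (unit_of Q \<otimes>\<^sub>o b) | a b. a \<in> Q \<and> b \<in> Q}) = min_tensor Q Q \<and>
     closure (cspan {\<Delta> a * (b \<otimes>\<^sub>o unit_of Q) | a b. a \<in> Q \<and> b \<in> Q}) = min_tensor Q Q"

definition cqg_morphism :: "'i bop set \<Rightarrow> ('i bop \<Rightarrow> ('i \<times> 'i) bop) \<Rightarrow>
    'j bop set \<Rightarrow> ('j bop \<Rightarrow> ('j \<times> 'j) bop) \<Rightarrow> ('i bop \<Rightarrow> 'j bop) \<Rightarrow> bool" where
  "cqg_morphism Q \<Delta> Q' \<Delta>' \<Phi> \<longleftrightarrow> unital_star_hom Q Q' \<Phi> \<and>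
     (\<exists>F. tensor_hom Q Q Q' Q' \<Phi> \<Phi> F \<and> (\<forall>a\<in>Q. F (\<Delta> a) = \<Delta>' (\<Phi> a)))"

definition corepresentation :: "'i bop set \<Rightarrow> ('i bop \<Rightarrow> ('i \<times> 'i) bop) \<Rightarrow> 'i bop^'m^'m \<Rightarrow> bool" where
  "corepresentation Q \<Delta> u \<longleftrightarrow> (\<forall>i j. u $ i $ j \<in> Q) \<and>
     (\<forall>i j. \<Delta> (u $ i $ j) = (\<Sum>k\<in>UNIV. u $ i $ k \<otimes>\<^sub>o u $ k $ j))"

definition unitary_matrix :: "'i bop set \<Rightarrow> 'i bop^'m^'m \<Rightarrow> bool" where
  "unitary_matrix Q u \<longleftrightarrow> (\<forall>i j.
     (\<Sum>k\<in>UNIV. u $ i $ k * star (u $ j $ k)) = (if i = j then unit_of Q else 0) \<and>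
     (\<Sum>k\<in>UNIV. star (u $ k $ i) * u $ k $ j) = (if i = j then unit_of Q else 0))"

definition fundamental_corepresentation ::
    "'i bop set \<Rightarrow> ('i bop \<Rightarrow> ('i \<times> 'i) bop) \<Rightarrow> 'i bop^'m^'m \<Rightarrow> bool" where
  "fundamental_corepresentation Q \<Delta> u \<longleftrightarrow> corepresentation Q \<Delta> u \<and> unitary_matrix Q u \<and>
     cstar_algebra hull {u $ i $ j | i j. True} = Q"

text \<open>
  The coaction identity is \<open>(\<alpha> \<otimes> id) \<alpha> = (id \<otimes> \<sigma>\<Delta>) \<alpha>\<close> with the flip \<open>\<sigma>\<close>.
\<close>

definition cqg_action :: "'g bop set \<Rightarrow> 'i bop set \<Rightarrow> ('i bop \<Rightarrow> ('i \<times> 'i) bop) \<Rightarrow>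
    ('g bop \<Rightarrow> ('g \<times> 'i) bop) \<Rightarrow> bool" where
  "cqg_action A Q \<Delta> \<alpha> \<longleftrightarrow> unital_star_hom A (min_tensor A Q) \<alpha> \<and>
     (\<exists>F G. tensor_hom A Q (min_tensor A Q) Q \<alpha> id F \<and>
            tensor_hom A Q A (min_tensor Q Q) id (flip \<circ> \<Delta>) G \<and>
            (\<forall>a\<in>A. assoc_op (F (\<alpha> a)) = G (\<alpha> a))) \<and>
     closure (cspan {\<alpha> a * (unit_of A \<otimes>\<^sub>o q) | a q. a \<in> A \<and> q \<in> Q}) = min_tensor A Q"

section \<open>Reduced group C*-algebras and quantum isometry groups\<close>

text \<open>
  l2 of the group is the subspace of l2 over the whole element type spanned by the delta h with h in
  the carrier; the operators below vanish on its orthogonal complement.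
\<close>

definition left_regular :: "('g, 'm) monoid_scheme \<Rightarrow> 'g \<Rightarrow> 'g bop" where
  "left_regular G g = Bop (\<lambda>i j. of_bool (j \<in> carrier G \<and> i = g \<otimes>\<^bsub>G\<^esub> j))"

lemma entry_left_regular:
  assumes "group G" "g \<in> carrier G"
  shows "entry (left_regular G g) i j = of_bool (j \<in> carrier G \<and> i = g \<otimes>\<^bsub>G\<^esub> j)"
proof -
  interpret group G by fact
  have "inj_on (\<lambda>j. g \<otimes>\<^bsub>G\<^esub> j) (carrier G)"
    using assms by (auto intro: inj_onI)
  from op_bound_partial_injection[OF this] show ?thesis
    unfolding left_regular_def by (subst Bop_inverse) auto
qed

definition group_cstar :: "('g, 'm) monoid_scheme \<Rightarrow> 'g bop set" where
  "group_cstar G = closure (cspan (left_regular G ` carrier G))"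

definition canonical_trace :: "('g, 'm) monoid_scheme \<Rightarrow> 'g bop \<Rightarrow> complex" where
  "canonical_trace G a = entry a \<one>\<^bsub>G\<^esub> \<one>\<^bsub>G\<^esub>"

lemma canonical_trace_left_regular:
  assumes "group G" "g \<in> carrier G"
  shows "canonical_trace G (left_regular G g) = (if g = \<one>\<^bsub>G\<^esub> then 1 else 0)"
proof -
  interpret group G by fact
  show ?thesis using assms by (auto simp: canonical_trace_def entry_left_regular)
qed

definition word_length :: "('g, 'm) monoid_scheme \<Rightarrow> 'g set \<Rightarrow> 'g \<Rightarrow> nat" where
  "word_length G S g = (LEAST k. \<exists>ws. length ws = k \<and> set ws \<subseteq> S \<and> foldr (mult G) ws \<one>\<^bsub>G\<^esub> = g)"

definition symmetric_generating_set :: "('g, 'm) monoid_scheme \<Rightarrow> 'g set \<Rightarrow> bool" where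
  "symmetric_generating_set G S \<longleftrightarrow> finite S \<and> S \<subseteq> carrier G \<and>
     (\<forall>s\<in>S. inv\<^bsub>G\<^esub> s \<in> S) \<and> generate G S = carrier G"

text \<open>
  Pairs (Q, \<alpha>) whose action preserves the trace, \<open>(\<tau> \<otimes> id) \<alpha>(a) = \<tau>(a) 1\<close>, and the spans of the
  spheres of the word length. As \<open>\<tau>\<close> is the vector state of the delta at the neutral element,
  \<open>slice \<one>\<close> is \<open>\<tau> \<otimes> id\<close>.
\<close>

definition qiso_object :: "('g, 'm) monoid_scheme \<Rightarrow> 'g set \<Rightarrow> 'i bop set \<Rightarrow>
    ('i bop \<Rightarrow> ('i \<times> 'i) bop) \<Rightarrow> ('g bop \<Rightarrow> ('g \<times> 'i) bop) \<Rightarrow> bool" where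
  "qiso_object G S Q \<Delta> \<alpha> \<longleftrightarrow> compact_quantum_group Q \<Delta> \<and> cqg_action (group_cstar G) Q \<Delta> \<alpha> \<and>
     (\<forall>a\<in>group_cstar G. slice \<one>\<^bsub>G\<^esub> (\<alpha> a) = canonical_trace G a *\<^sub>C unit_of Q) \<and>
     (\<forall>g\<in>carrier G. \<alpha> (left_regular G g) \<in>
        alg_tensor (cspan {left_regular G h | h. h \<in> carrier G \<and> word_length G S h = word_length G S g}) Q)"

definition qiso_morphism :: "('g, 'm) monoid_scheme \<Rightarrow>
    'i bop set \<Rightarrow> ('i bop \<Rightarrow> ('i \<times> 'i) bop) \<Rightarrow> ('g bop \<Rightarrow> ('g \<times> 'i) bop) \<Rightarrow>
    'j bop set \<Rightarrow> ('j bop \<Rightarrow> ('j \<times> 'j) bop) \<Rightarrow> ('g bop \<Rightarrow> ('g \<times> 'j) bop) \<Rightarrow>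
    ('i bop \<Rightarrow> 'j bop) \<Rightarrow> bool" where
  "qiso_morphism G Q \<Delta> \<alpha> Q' \<Delta>' \<alpha>' \<Phi> \<longleftrightarrow> cqg_morphism Q \<Delta> Q' \<Delta>' \<Phi> \<and>
     (\<exists>F. tensor_hom (group_cstar G) Q (group_cstar G) Q' id \<Phi> F \<and>
          (\<forall>a\<in>group_cstar G. F (\<alpha> a) = \<alpha>' a))"

text \<open>
  QISO+(G, S) is the initial object among these pairs. A formula of HOL cannot quantify over types,
  so the index type of the l2-space carrying the test objects is a parameter, which has to be left
  as a free (that is, universally quantified) type variable. Maps are identified with their
  restriction to the C*-algebra, whence the extensional function space.
\<close>

definition is_QISO :: "'k itself \<Rightarrow> ('g, 'm) monoid_scheme \<Rightarrow> 'g set \<Rightarrow> 'i bop set \<Rightarrow>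
    ('i bop \<Rightarrow> ('i \<times> 'i) bop) \<Rightarrow> ('g bop \<Rightarrow> ('g \<times> 'i) bop) \<Rightarrow> bool" where
  "is_QISO _ G S Q \<Delta> \<alpha> \<longleftrightarrow> group G \<and> symmetric_generating_set G S \<and> qiso_object G S Q \<Delta> \<alpha> \<and>
     (\<forall>(Q' :: 'k bop set) \<Delta>' \<alpha>'. qiso_object G S Q' \<Delta>' \<alpha>' \<longrightarrow>
        (\<exists>!\<Phi>. \<Phi> \<in> Q \<rightarrow>\<^sub>E Q' \<and> qiso_morphism G Q \<Delta> \<alpha> Q' \<Delta>' \<alpha>' \<Phi>))"

end

theory Submission
  imports Defs
begin

text \<open>
  The algebra \<open>C*(\<int>\<^sub>n) \<oplus> C*(\<int>\<^sub>n)\<close> is the algebra of functions on the dihedral group of order \<open>2n\<close>,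
  which acts on the dual of \<open>\<int>\<^sub>n\<close> by rotations and by the reflection coming from inversion. That it acts
  on \<open>C*(\<int>\<^sub>n)\<close> isometrically has nothing to do with cyclicity: for every finite abelian group \<open>G\<close> the
  formulas

  \<open>\<alpha>(\<lambda>\<^sub>g) = \<lambda>\<^sub>g \<otimes> A\<^sub>g + \<lambda>\<^bsub>-g\<^esub> \<otimes> B\<^sub>g\<close>,
  \<open>\<Delta>(A\<^sub>g) = A\<^sub>g \<otimes> A\<^sub>g + B\<^sub>g \<otimes> B\<^bsub>-g\<^esub>\<close>, \<open>\<Delta>(B\<^sub>g) = A\<^sub>g \<otimes> B\<^sub>g + B\<^sub>g \<otimes> A\<^bsub>-g\<^esub>\<close>,

  where \<open>A\<^sub>g = \<lambda>\<^sub>g \<oplus> 0\<close> and \<open>B\<^sub>g = 0 \<oplus> \<lambda>\<^sub>g\<close>, make \<open>C*(G) \<oplus> C*(G)\<close> a compact quantum group acting on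
  \<open>C*(G)\<close> as required (\<open>qiso_object_QG\<close>). The maps exist because the right-hand sides multiply like
  \<open>\<lambda>\<^sub>g\<close> (\<open>star_hom_group_cstar_exists\<close>, \<open>star_hom_QG_exists\<close>), and everything is finite-dimensional, so that
  tensor products of maps can be defined on bases (\<open>tensor_hom_exists\<close>) and no completion intervenes
  (\<open>closed_cspan\<close>).

  The point of the theorem is universality. If \<open>z\<close> generates \<open>\<int>\<^sub>n\<close>, the sphere of radius 1 is \<open>{z, -z}\<close>,
  so any competing action has the form \<open>\<lambda>\<^sub>z \<mapsto> \<lambda>\<^sub>z \<otimes> a + \<lambda>\<^bsub>-z\<^esub> \<otimes> b\<close>. As \<open>n\<close> is not 1, 2 or 4, the elements
  \<open>0\<close>, \<open>2z\<close>, \<open>-2z\<close> are distinct, and unitarity of the image yields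
  \<open>aa* + bb* = 1 = a*a + b*b\<close> and \<open>ab* = ba* = a*b = b*a = 0\<close>. Invariance of the trace, applied to
  \<open>\<lambda>\<^bsub>2z\<^esub>\<close>, gives \<open>ab + ba = 0\<close>. These relations are enough
  (\<open>orthogonal_normal_partial_isometries\<close>): \<open>ab = ab(a*a + b*b) = abb*b = -b(ab*)b = 0\<close>, so \<open>a\<close> and \<open>b\<close>
  generate two orthogonal corners, in each of which one of them is unitary. Comparing the
  action on \<open>\<lambda>\<^bsub>kz\<^esub>\<close> for different \<open>k\<close> shows that both have an \<open>n\<close>-th power equal to the unit of their
  corner, so \<open>A \<mapsto> a\<close>, \<open>B \<mapsto> b\<close> extends to a *-homomorphism (\<open>qiso_object_universal_map\<close>). The coaction
  identity forces the coproduct on \<open>a\<close> and \<open>b\<close> (\<open>qiso_object_coproduct\<close>), so this map is a morphism;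
  its values on the generators leave no other choice (\<open>qiso_morphism_values\<close>).
\<close>

section \<open>Algebraic operations on bounded operators\<close>

interpretation bop: vector_space "scaleC :: complex \<Rightarrow> 'i bop \<Rightarrow> 'i bop"
  by (rule vector_space_scaleC)

interpretation bop_pair: vector_space_pair "scaleC :: complex \<Rightarrow> 'i bop \<Rightarrow> 'i bop"
    "scaleC :: complex \<Rightarrow> 'j bop \<Rightarrow> 'j bop"
  by unfold_locales

lemmas bop_entry_simps = plus_bop.rep_eq uminus_bop.rep_eq zero_bop.rep_eq scaleC.rep_eq star.rep_eq
  tensor.rep_eq direct_sum.rep_eq flip.rep_eq assoc_op.rep_eq slice.rep_eq

lemma entry_sum: "entry (\<Sum>k\<in>K. f k) i j = (\<Sum>k\<in>K. entry (f k) i j)"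
  by (induction K rule: infinite_finite_induct) (auto simp: bop_entry_simps)

lemma summable_entry_mult: "(\<lambda>k. entry S i k * entry T k j) summable_on UNIV"
  by (rule summable_matrix_mult[OF bop_op_bound_norm bop_op_bound_norm])

lemma scaleC_mult_left [simp]: "(c *\<^sub>C S) * T = c *\<^sub>C (S * T)"
  by (rule bop_eqI) (simp add: times_bop.rep_eq scaleC.rep_eq mult.assoc infsum_cmult_right')

lemma scaleC_mult_right [simp]: "S * (c *\<^sub>C T) = c *\<^sub>C (S * T)"
  by (rule bop_eqI) (simp add: times_bop.rep_eq scaleC.rep_eq mult.left_commute infsum_cmult_right')

lemma star_star [simp]: "star (star T) = T"
  by (rule bop_eqI) (simp add: bop_entry_simps)

lemma star_zero [simp]: "star 0 = 0"
  by (rule bop_eqI) (simp add: bop_entry_simps)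

lemma star_add [simp]: "star (S + T) = star S + star T"
  by (rule bop_eqI) (simp add: bop_entry_simps)

lemma star_scaleC [simp]: "star (c *\<^sub>C T) = cnj c *\<^sub>C star T"
  by (rule bop_eqI) (simp add: bop_entry_simps)

lemma star_mult [simp]: "star (S * T) = star T * star S"
proof (rule bop_eqI)
  fix i j
  have "cnj (\<Sum>\<^sub>\<infinity>k. entry S j k * entry T k i) = (\<Sum>\<^sub>\<infinity>k. cnj (entry S j k * entry T k i))"
    by (rule infsum_cnj[symmetric])
  then show "entry (star (S * T)) i j = entry (star T * star S) i j"
    by (simp add: times_bop.rep_eq star.rep_eq mult.commute)
qed

lemma tensor_add_left: "(S + T) \<otimes>\<^sub>o R = S \<otimes>\<^sub>o R + T \<otimes>\<^sub>o R"
  by (rule bop_eqI) (simp add: bop_entry_simps algebra_simps)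

lemma tensor_add_right: "R \<otimes>\<^sub>o (S + T) = R \<otimes>\<^sub>o S + R \<otimes>\<^sub>o T"
  by (rule bop_eqI) (simp add: bop_entry_simps algebra_simps)

lemma tensor_scaleC_left: "(c *\<^sub>C S) \<otimes>\<^sub>o R = c *\<^sub>C (S \<otimes>\<^sub>o R)"
  by (rule bop_eqI) (simp add: bop_entry_simps)

lemma tensor_scaleC_right: "S \<otimes>\<^sub>o (c *\<^sub>C R) = c *\<^sub>C (S \<otimes>\<^sub>o R)"
  by (rule bop_eqI) (simp add: bop_entry_simps)

lemma tensor_zero [simp]: "0 \<otimes>\<^sub>o R = 0" "R \<otimes>\<^sub>o 0 = 0"
  by (rule bop_eqI, simp add: bop_entry_simps)+

lemma star_tensor [simp]: "star (S \<otimes>\<^sub>o T) = star S \<otimes>\<^sub>o star T"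
  by (rule bop_eqI) (simp add: bop_entry_simps)

lemma tensor_mult [simp]: "(S \<otimes>\<^sub>o T) * (S' \<otimes>\<^sub>o T') = (S * S') \<otimes>\<^sub>o (T * T')"
proof (rule bop_eqI)
  fix p q
  let ?f = "\<lambda>k l. entry S (fst p) k * entry S' k (fst q) * (entry T (snd p) l * entry T' l (snd q))"
  have "(\<lambda>k. entry (S \<otimes>\<^sub>o T) p k * entry (S' \<otimes>\<^sub>o T') k q) summable_on UNIV"
    by (rule summable_entry_mult)
  then have sm: "(\<lambda>(k, l). ?f k l) summable_on UNIV \<times> UNIV"
    by (simp add: tensor.rep_eq split_def mult_ac)
  have "entry ((S \<otimes>\<^sub>o T) * (S' \<otimes>\<^sub>o T')) p q = (\<Sum>\<^sub>\<infinity>(k, l)\<in>UNIV \<times> UNIV. ?f k l)"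
    by (simp add: times_bop.rep_eq tensor.rep_eq split_def mult_ac)
  also have "\<dots> = (\<Sum>\<^sub>\<infinity>k. \<Sum>\<^sub>\<infinity>l. ?f k l)"
    using infsum_Sigma'_banach[OF sm] by simp
  also have "\<dots> = entry ((S * S') \<otimes>\<^sub>o (T * T')) p q"
    by (simp add: times_bop.rep_eq tensor.rep_eq infsum_cmult_right' infsum_cmult_left')
  finally show "entry ((S \<otimes>\<^sub>o T) * (S' \<otimes>\<^sub>o T')) p q = entry ((S * S') \<otimes>\<^sub>o (T * T')) p q" .
qed

lemma direct_sum_add: "(S \<oplus>\<^sub>o T) + (S' \<oplus>\<^sub>o T') = (S + S') \<oplus>\<^sub>o (T + T')"
  by (rule bop_eqI) (simp add: bop_entry_simps split: sum.split)

lemma direct_sum_scaleC: "c *\<^sub>C (S \<oplus>\<^sub>o T) = (c *\<^sub>C S) \<oplus>\<^sub>o (c *\<^sub>C T)"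
  by (rule bop_eqI) (simp add: bop_entry_simps split: sum.split)

lemma direct_sum_zero: "0 \<oplus>\<^sub>o 0 = 0"
  by (rule bop_eqI) (simp add: bop_entry_simps split: sum.split)

lemma star_direct_sum [simp]: "star (S \<oplus>\<^sub>o T) = star S \<oplus>\<^sub>o star T"
  by (rule bop_eqI) (simp add: bop_entry_simps split: sum.split)

lemma direct_sum_mult [simp]: "(S \<oplus>\<^sub>o T) * (S' \<oplus>\<^sub>o T') = (S * S') \<oplus>\<^sub>o (T * T')"
proof (rule bop_eqI)
  fix p q
  let ?f = "\<lambda>k. entry (S \<oplus>\<^sub>o T) p k * entry (S' \<oplus>\<^sub>o T') k q"
  have "(\<Sum>\<^sub>\<infinity>k. ?f k) = entry ((S * S') \<oplus>\<^sub>o (T * T')) p q"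
  proof (cases p)
    case (Inl i)
    have "(\<Sum>\<^sub>\<infinity>k. ?f k) = (\<Sum>\<^sub>\<infinity>k\<in>range Inl. ?f k)"
      by (rule infsum_cong_neutral) (auto simp: Inl direct_sum.rep_eq split: sum.split)
    also have "\<dots> = (\<Sum>\<^sub>\<infinity>k. ?f (Inl k))"
      by (subst infsum_reindex) (auto simp: o_def)
    finally show ?thesis by (simp add: Inl direct_sum.rep_eq times_bop.rep_eq split: sum.split)
  next
    case (Inr i)
    have "(\<Sum>\<^sub>\<infinity>k. ?f k) = (\<Sum>\<^sub>\<infinity>k\<in>range Inr. ?f k)"
      by (rule infsum_cong_neutral) (auto simp: Inr direct_sum.rep_eq split: sum.split)
    also have "\<dots> = (\<Sum>\<^sub>\<infinity>k. ?f (Inr k))"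
      by (subst infsum_reindex) (auto simp: o_def)
    finally show ?thesis by (simp add: Inr direct_sum.rep_eq times_bop.rep_eq split: sum.split)
  qed
  then show "entry ((S \<oplus>\<^sub>o T) * (S' \<oplus>\<^sub>o T')) p q = entry ((S * S') \<oplus>\<^sub>o (T * T')) p q"
    by (simp add: times_bop.rep_eq)
qed

lemma flip_tensor [simp]: "flip (S \<otimes>\<^sub>o T) = T \<otimes>\<^sub>o S"
  by (rule bop_eqI) (simp add: bop_entry_simps)

lemma flip_add [simp]: "flip (S + T) = flip S + flip T"
  by (rule bop_eqI) (simp add: bop_entry_simps)

lemma flip_scaleC [simp]: "flip (c *\<^sub>C T) = c *\<^sub>C flip T"
  by (rule bop_eqI) (simp add: bop_entry_simps)

lemma assoc_op_tensor [simp]: "assoc_op ((S \<otimes>\<^sub>o T) \<otimes>\<^sub>o R) = S \<otimes>\<^sub>o T \<otimes>\<^sub>o R"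
  by (rule bop_eqI) (simp add: bop_entry_simps)

lemma assoc_op_add [simp]: "assoc_op (S + T) = assoc_op S + assoc_op T"
  by (rule bop_eqI) (simp add: bop_entry_simps)

lemma assoc_op_scaleC [simp]: "assoc_op (c *\<^sub>C T) = c *\<^sub>C assoc_op T"
  by (rule bop_eqI) (simp add: bop_entry_simps)

lemma slice_add [simp]: "slice i (S + T) = slice i S + slice i T"
  by (rule bop_eqI) (simp add: bop_entry_simps)

lemma slice_scaleC [simp]: "slice i (c *\<^sub>C T) = c *\<^sub>C slice i T"
  by (rule bop_eqI) (simp add: bop_entry_simps)

section \<open>Finite-dimensional spans are closed\<close>

lemma norm_scaleC: "norm (c *\<^sub>C T) = cmod c * norm T"
proof -
  have le: "norm (c *\<^sub>C T) \<le> cmod c * norm T" for c and T :: "'a bop"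
    by (rule bop_norm_le, unfold scaleC.rep_eq) (rule op_bound_scale[OF bop_op_bound_norm])
  show ?thesis
  proof (cases "c = 0")
    case False
    have "norm T = norm (inverse c *\<^sub>C c *\<^sub>C T)" using False by simp
    also have "\<dots> \<le> inverse (cmod c) * norm (c *\<^sub>C T)"
      using le[of "inverse c" "c *\<^sub>C T"] by (simp only: norm_inverse)
    finally have "cmod c * norm T \<le> norm (c *\<^sub>C T)"
      using False by (simp add: field_simps)
    with le[of c T] show ?thesis by simp
  qed simp
qed

text \<open>
  If \<open>v\<close> has distance \<open>d > 0\<close> from \<open>M\<close>, then \<open>\<bar>c\<bar> d \<le> \<parallel>m + c v\<parallel>\<close>; hence the coefficients of \<open>v\<close> along a
  convergent sequence are a Cauchy sequence, and both components converge.
\<close>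

lemma closed_add_line:
  fixes M :: "'i bop set"
  assumes M: "bop.subspace M" "closed M" and v: "v \<notin> M"
  shows "closed {m + c *\<^sub>C v | m c. m \<in> M}"
proof -
  have "M \<noteq> {}" using bop.subspace_0[OF M(1)] by blast
  define d where "d = infdist v M"
  have d: "d > 0"
    unfolding d_def using M(2) v \<open>M \<noteq> {}\<close> by (simp add: infdist_pos_not_in_closed)
  have dist: "cmod c * d \<le> norm (m + c *\<^sub>C v)" if "m \<in> M" for m c
  proof (cases "c = 0")
    case False
    have "- (inverse c *\<^sub>C m) \<in> M" using M(1) that by (simp add: bop.subspace_neg bop.subspace_scale)
    then have "d \<le> dist v (- (inverse c *\<^sub>C m))" unfolding d_def by (rule infdist_le)
    also have "\<dots> = norm (inverse c *\<^sub>C (m + c *\<^sub>C v))"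
      using False by (simp add: dist_norm bop.scale_right_distrib add.commute)
    also have "\<dots> = norm (m + c *\<^sub>C v) / cmod c"
      by (simp add: norm_scaleC norm_inverse divide_inverse mult.commute)
    finally show ?thesis using False by (simp add: field_simps)
  qed simp
  show ?thesis
    unfolding closed_sequential_limits
  proof (intro allI impI)
    fix x l
    assume "(\<forall>n. x n \<in> {m + c *\<^sub>C v | m c. m \<in> M}) \<and> x \<longlonglongrightarrow> l"
    then have x: "\<forall>n. \<exists>m c. x n = m + c *\<^sub>C v \<and> m \<in> M" and l: "x \<longlonglongrightarrow> l" by blast+
    from x obtain m c where mc: "\<And>n. x n = m n + c n *\<^sub>C v" "\<And>n. m n \<in> M" by metis
    have "Cauchy x" using l by (rule LIMSEQ_imp_Cauchy)
    have "Cauchy c"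
    proof (rule metric_CauchyI)
      fix e :: real assume "e > 0"
      with d have "e * d > 0" by simp
      then obtain N where N: "\<And>k l. k \<ge> N \<Longrightarrow> l \<ge> N \<Longrightarrow> dist (x k) (x l) < e * d"
        using \<open>Cauchy x\<close> by (meson metric_CauchyD)
      have "dist (c k) (c l) < e" if "k \<ge> N" "l \<ge> N" for k l
      proof -
        have "dist (c k) (c l) * d \<le> norm ((m k - m l) + (c k - c l) *\<^sub>C v)"
          unfolding dist_norm using dist M(1) mc(2) by (simp add: bop.subspace_diff)
        also have "\<dots> = dist (x k) (x l)"
          by (simp add: mc(1) dist_norm bop.scale_left_diff_distrib algebra_simps)
        also have "\<dots> < e * d" by (rule N[OF that])
        finally show ?thesis using d by simp
      qed
      then show "\<exists>N. \<forall>k\<ge>N. \<forall>l\<ge>N. dist (c k) (c l) < e" by blast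
    qed
    then obtain c0 where c0: "c \<longlonglongrightarrow> c0" by (auto simp: Cauchy_convergent_iff convergent_def)
    have "(\<lambda>n. c n *\<^sub>C v) \<longlonglongrightarrow> c0 *\<^sub>C v"
    proof (rule LIM_zero_cancel, rule Lim_null_comparison)
      show "\<forall>\<^sub>F n in sequentially. norm (c n *\<^sub>C v - c0 *\<^sub>C v) \<le> cmod (c n - c0) * norm v"
        by (simp add: norm_scaleC[symmetric] bop.scale_left_diff_distrib)
      show "(\<lambda>n. cmod (c n - c0) * norm v) \<longlonglongrightarrow> 0"
        using c0 by (intro tendsto_mult_left_zero) (simp add: tendsto_norm_zero LIM_zero)
    qed
    with l have "(\<lambda>n. x n - c n *\<^sub>C v) \<longlonglongrightarrow> l - c0 *\<^sub>C v" by (intro tendsto_diff)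
    then have "m \<longlonglongrightarrow> l - c0 *\<^sub>C v" by (simp add: mc(1))
    then have "l - c0 *\<^sub>C v \<in> M"
      using M(2) mc(2) closed_sequentially by blast
    then show "l \<in> {m + c *\<^sub>C v | m c. m \<in> M}"
      by (intro CollectI exI[of _ "l - c0 *\<^sub>C v"] exI[of _ c0]) simp
  qed
qed

lemma closed_cspan:
  assumes "finite X"
  shows "closed (cspan X)"
  using assms
proof (induction X rule: finite_induct)
  case (insert v X)
  show ?case
  proof (cases "v \<in> cspan X")
    case True
    then have "cspan (insert v X) = cspan X" by (simp add: cspan_def bop.span_redundant)
    then show ?thesis using insert by simp
  next
    case False
    have "closed {m + c *\<^sub>C v | m c. m \<in> cspan X}"
      using insert.IH False by (intro closed_add_line) (simp_all add: cspan_def)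
    moreover have "cspan (insert v X) = {m + c *\<^sub>C v | m c. m \<in> cspan X}"
      unfolding cspan_def
    proof (intro equalityI subsetI)
      fix x assume "x \<in> bop.span (insert v X)"
      then obtain k where "x - k *\<^sub>C v \<in> bop.span X" by (auto simp: bop.span_breakdown_eq)
      then show "x \<in> {m + c *\<^sub>C v | m c. m \<in> bop.span X}"
        by (intro CollectI exI[of _ "x - k *\<^sub>C v"] exI[of _ k]) simp
    next
      fix x assume "x \<in> {m + c *\<^sub>C v | m c. m \<in> bop.span X}"
      then obtain m c where "x = m + c *\<^sub>C v" "m \<in> bop.span X" by blast
      then show "x \<in> bop.span (insert v X)"
        unfolding bop.span_breakdown_eq by (intro exI[of _ c]) simp
    qed
    ultimately show ?thesis by simp
  qed
qed (simp add: cspan_def)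

section \<open>Complex spans, linear maps and *-homomorphisms\<close>

lemma cspan_base: "x \<in> X \<Longrightarrow> x \<in> cspan X"
  by (simp add: cspan_def bop.span_base)

lemma cspan_zero: "0 \<in> cspan X"
  by (simp add: cspan_def bop.span_zero)

lemma cspan_add: "x \<in> cspan X \<Longrightarrow> y \<in> cspan X \<Longrightarrow> x + y \<in> cspan X"
  by (simp add: cspan_def bop.span_add)

lemma cspan_scaleC: "x \<in> cspan X \<Longrightarrow> c *\<^sub>C x \<in> cspan X"
  by (simp add: cspan_def bop.span_scale)

lemma subspace_cspan: "bop.subspace (cspan X)"
  by (simp add: cspan_def bop.subspace_span)

lemma cspan_minimal: "X \<subseteq> T \<Longrightarrow> bop.subspace T \<Longrightarrow> cspan X \<subseteq> T"
  by (simp add: cspan_def bop.span_minimal)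

lemma cspan_induct [consumes 1, case_names base zero add scale]:
  assumes "x \<in> cspan X"
    and "\<And>x. x \<in> X \<Longrightarrow> P x" and "P 0"
    and "\<And>x y. x \<in> cspan X \<Longrightarrow> y \<in> cspan X \<Longrightarrow> P x \<Longrightarrow> P y \<Longrightarrow> P (x + y)"
    and "\<And>c x. x \<in> cspan X \<Longrightarrow> P x \<Longrightarrow> P (c *\<^sub>C x)"
  shows "P x"
proof -
  have "cspan X \<subseteq> {x \<in> cspan X. P x}"
    using assms(2-) by (intro cspan_minimal bop.subspaceI) (auto simp: cspan_base cspan_zero cspan_add cspan_scaleC)
  with assms(1) show ?thesis by blast
qed

definition clinear_on :: "'i bop set \<Rightarrow> ('i bop \<Rightarrow> 'j bop) \<Rightarrow> bool" where
  "clinear_on A f \<longleftrightarrow> (\<forall>x\<in>A. \<forall>y\<in>A. f (x + y) = f x + f y) \<and> (\<forall>c. \<forall>x\<in>A. f (c *\<^sub>C x) = c *\<^sub>C f x)"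

lemma clinear_on_eqI:
  assumes "clinear_on (cspan X) f" "clinear_on (cspan X) g"
    and "\<And>x. x \<in> X \<Longrightarrow> f x = g x" and x: "x \<in> cspan X"
  shows "f x = g x"
  using x
proof (induction rule: cspan_induct)
  case zero
  have "f (0 *\<^sub>C 0) = g (0 *\<^sub>C 0)"
    using assms(1,2) cspan_zero[of X] unfolding clinear_on_def by (metis bop.scale_zero_left)
  then show ?case by simp
qed (use assms in \<open>auto simp: clinear_on_def\<close>)

lemma star_hom_clinear: "star_hom A B \<phi> \<Longrightarrow> clinear_on A \<phi>"
  by (simp add: star_hom_def clinear_on_def)

lemma star_hom_in: "star_hom A B \<phi> \<Longrightarrow> a \<in> A \<Longrightarrow> \<phi> a \<in> B"
  by (auto simp: star_hom_def)

lemma star_hom_add: "star_hom A B \<phi> \<Longrightarrow> a \<in> A \<Longrightarrow> b \<in> A \<Longrightarrow> \<phi> (a + b) = \<phi> a + \<phi> b"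
  by (simp add: star_hom_def)

lemma star_hom_mult: "star_hom A B \<phi> \<Longrightarrow> a \<in> A \<Longrightarrow> b \<in> A \<Longrightarrow> \<phi> (a * b) = \<phi> a * \<phi> b"
  by (simp add: star_hom_def)

lemma star_hom_star: "star_hom A B \<phi> \<Longrightarrow> a \<in> A \<Longrightarrow> \<phi> (star a) = star (\<phi> a)"
  by (simp add: star_hom_def)

lemma star_hom_comp: "star_hom A B \<phi> \<Longrightarrow> star_hom B C \<psi> \<Longrightarrow> star_hom A C (\<psi> \<circ> \<phi>)"
  by (simp add: star_hom_def Pi_iff)

lemma star_hom_mono: "star_hom A B \<phi> \<Longrightarrow> B \<subseteq> B' \<Longrightarrow> star_hom A B' \<phi>"
  by (auto simp: star_hom_def)

lemma star_hom_cong: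
  assumes "star_hom A B \<phi>" "cstar_algebra A" "\<And>a. a \<in> A \<Longrightarrow> \<psi> a = \<phi> a"
  shows "star_hom A B \<psi>"
  using assms unfolding star_hom_def cstar_algebra_def bop.subspace_def by (simp add: Pi_iff)

lemma star_hom_id: "star_hom A A id"
  by (simp add: star_hom_def)

text \<open>
  Multiplicativity and compatibility with the involution are (sesqui)linear in each argument, so they
  can be tested on spanning sets. Linearity is required on the whole operator space, so that products of
  elements of \<open>X\<close> may leave the span.
\<close>

lemma star_hom_cspan:
  assumes lin: "clinear_on UNIV \<phi>" and B: "bop.subspace B"
    and X: "\<And>x. x \<in> X \<Longrightarrow> \<phi> x \<in> B"
    and mult: "\<And>x y. x \<in> X \<Longrightarrow> y \<in> X \<Longrightarrow> \<phi> (x * y) = \<phi> x * \<phi> y"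
    and star: "\<And>x. x \<in> X \<Longrightarrow> \<phi> (star x) = star (\<phi> x)"
  shows "star_hom (cspan X) B \<phi>"
proof -
  have add: "\<phi> (x + y) = \<phi> x + \<phi> y" and scale: "\<phi> (c *\<^sub>C x) = c *\<^sub>C \<phi> x" for x y c
    using lin by (simp_all add: clinear_on_def)
  have zero: "\<phi> 0 = 0" using scale[of 0 0] by simp
  have "\<phi> x \<in> B" if "x \<in> cspan X" for x
    using that by (induction rule: cspan_induct) (use B in \<open>auto simp: X add scale zero bop.subspace_def\<close>)
  moreover have 1: "\<phi> (x * y) = \<phi> x * \<phi> y" if "x \<in> X" "y \<in> cspan X" for x y
    using that(2) by (induction rule: cspan_induct) (auto simp: that(1) mult add scale zero distrib_left)
  have "\<phi> (x * y) = \<phi> x * \<phi> y" if "x \<in> cspan X" "y \<in> cspan X" for x y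
    using that(1) by (induction rule: cspan_induct) (auto simp: 1 that(2) add scale zero distrib_right)
  moreover have "\<phi> (star x) = star (\<phi> x)" if "x \<in> cspan X" for x
    using that by (induction rule: cspan_induct) (auto simp: star add scale zero)
  ultimately show ?thesis by (auto simp: star_hom_def add scale)
qed

section \<open>Tensor products of finite-dimensional algebras\<close>

lemma unit_of_eqI: "is_unit_of A e \<Longrightarrow> unit_of A = e"
  unfolding unit_of_def is_unit_of_def by (rule the_equality) metis+

lemma is_unit_of_unit_of: "unital_cstar_algebra A \<Longrightarrow> is_unit_of A (unit_of A)"
  using unit_of_eqI unfolding unital_cstar_algebra_def by metis

lemma alg_tensor_base: "a \<in> A \<Longrightarrow> b \<in> B \<Longrightarrow> a \<otimes>\<^sub>o b \<in> alg_tensor A B"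
  unfolding alg_tensor_def by (rule cspan_base) blast

lemma alg_tensor_subset_min_tensor: "alg_tensor A B \<subseteq> min_tensor A B"
  by (simp add: min_tensor_def closure_subset)

lemma min_tensor_base: "a \<in> A \<Longrightarrow> b \<in> B \<Longrightarrow> a \<otimes>\<^sub>o b \<in> min_tensor A B"
  using alg_tensor_base alg_tensor_subset_min_tensor by blast

text \<open>
  The unit equations hold on elementary tensors and define a closed subspace.
\<close>

lemma is_unit_of_min_tensor:
  assumes e: "is_unit_of A e" and f: "is_unit_of B f"
  shows "is_unit_of (min_tensor A B) (e \<otimes>\<^sub>o f)"
proof -
  let ?S = "{T. (e \<otimes>\<^sub>o f) * T = T \<and> T * (e \<otimes>\<^sub>o f) = T}"
  have "bop.subspace ?S"
    by (rule bop.subspaceI) (auto simp: distrib_left distrib_right)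
  moreover have "{a \<otimes>\<^sub>o b |a b. a \<in> A \<and> b \<in> B} \<subseteq> ?S"
    using e f by (auto simp: is_unit_of_def)
  ultimately have "alg_tensor A B \<subseteq> ?S"
    unfolding alg_tensor_def by (intro cspan_minimal)
  moreover have "closed ?S"
    by (intro closed_Collect_conj closed_Collect_eq continuous_intros)
  ultimately have "min_tensor A B \<subseteq> ?S" unfolding min_tensor_def by (rule closure_minimal)
  moreover have "e \<otimes>\<^sub>o f \<in> min_tensor A B"
    using e f by (intro min_tensor_base) (auto simp: is_unit_of_def)
  ultimately show ?thesis by (auto simp: is_unit_of_def)
qed

definition fd_cstar_algebra :: "'i bop set \<Rightarrow> bool" where
  "fd_cstar_algebra A \<longleftrightarrow> cstar_algebra A \<and> (\<exists>X. finite X \<and> A = cspan X)"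

lemma fd_cstar_algebraI:
  assumes "finite X"
    and "\<And>x y. x \<in> X \<Longrightarrow> y \<in> X \<Longrightarrow> x * y \<in> cspan X"
    and "\<And>x. x \<in> X \<Longrightarrow> star x \<in> cspan X"
  shows "fd_cstar_algebra (cspan X)"
proof -
  have 1: "x * y \<in> cspan X" if "x \<in> X" "y \<in> cspan X" for x y
    using that(2) by (induction rule: cspan_induct) (auto simp: that(1) assms(2) distrib_left intro: cspan_zero cspan_add cspan_scaleC)
  have "x * y \<in> cspan X" if "x \<in> cspan X" "y \<in> cspan X" for x y
    using that(1) by (induction rule: cspan_induct) (auto simp: 1 that(2) distrib_right intro: cspan_zero cspan_add cspan_scaleC)
  moreover have "star x \<in> cspan X" if "x \<in> cspan X" for x
    using that by (induction rule: cspan_induct) (auto simp: assms(3) intro: cspan_zero cspan_add cspan_scaleC)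
  ultimately show ?thesis
    using assms(1) closed_cspan[OF assms(1)] subspace_cspan
    unfolding fd_cstar_algebra_def cstar_algebra_def by blast
qed

lemma alg_tensor_cspan:
  "alg_tensor (cspan X) (cspan Y) = cspan {x \<otimes>\<^sub>o y | x y. x \<in> X \<and> y \<in> Y}" (is "?L = ?R")
proof
  have 0: "x \<otimes>\<^sub>o y \<in> ?R" if "x \<in> X" "y \<in> Y" for x y
    using that by (intro cspan_base) blast
  have 1: "x \<otimes>\<^sub>o b \<in> ?R" if "x \<in> X" "b \<in> cspan Y" for x b
    using that(2)
    by (induction rule: cspan_induct) (auto simp: tensor_add_right tensor_scaleC_right that(1)
        intro: 0 cspan_zero cspan_add cspan_scaleC)
  have "a \<otimes>\<^sub>o b \<in> ?R" if "a \<in> cspan X" "b \<in> cspan Y" for a b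
    using that(1)
    by (induction rule: cspan_induct) (auto simp: tensor_add_left tensor_scaleC_left that(2)
        intro: 1 cspan_zero cspan_add cspan_scaleC)
  then show "?L \<subseteq> ?R"
    unfolding alg_tensor_def by (intro cspan_minimal subspace_cspan) blast
  show "?R \<subseteq> ?L"
    by (rule cspan_minimal) (auto intro: alg_tensor_base cspan_base, simp add: alg_tensor_def subspace_cspan)
qed

lemma min_tensor_fd:
  assumes "fd_cstar_algebra A" "fd_cstar_algebra B"
  shows "min_tensor A B = alg_tensor A B"
proof -
  from assms obtain X Y where "finite X" "A = cspan X" "finite Y" "B = cspan Y"
    by (auto simp: fd_cstar_algebra_def)
  then show ?thesis
    unfolding min_tensor_def by (simp add: alg_tensor_cspan closed_cspan finite_image_set2)
qed

lemma fd_cstar_algebra_min_tensor: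
  assumes "fd_cstar_algebra A" "fd_cstar_algebra B"
  shows "fd_cstar_algebra (min_tensor A B)"
proof -
  from assms obtain X Y where X: "finite X" "A = cspan X" and Y: "finite Y" "B = cspan Y"
    by (auto simp: fd_cstar_algebra_def)
  let ?Z = "{x \<otimes>\<^sub>o y | x y. x \<in> X \<and> y \<in> Y}"
  have eq: "min_tensor A B = cspan ?Z"
    using assms X Y by (simp add: min_tensor_fd alg_tensor_cspan)
  have in_Z: "a \<otimes>\<^sub>o b \<in> cspan ?Z" if "a \<in> A" "b \<in> B" for a b
    using min_tensor_base[OF that] by (simp add: eq)
  have cl: "\<forall>x\<in>X. \<forall>x'\<in>X. x * x' \<in> A" "\<forall>x\<in>X. star x \<in> A" "\<forall>x\<in>Y. \<forall>x'\<in>Y. x * x' \<in> B" "\<forall>x\<in>Y. star x \<in> B"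
    using assms X(2) Y(2) cspan_base unfolding fd_cstar_algebra_def cstar_algebra_def by blast+
  show ?thesis
    unfolding eq
  proof (rule fd_cstar_algebraI)
    show "finite ?Z" using X Y by (simp add: finite_image_set2)
    fix x assume "x \<in> ?Z"
    then obtain a b where x: "x = a \<otimes>\<^sub>o b" "a \<in> X" "b \<in> Y" by blast
    then show "star x \<in> cspan ?Z" using cl by (simp add: in_Z)
    fix y assume "y \<in> ?Z"
    then obtain a' b' where "y = a' \<otimes>\<^sub>o b'" "a' \<in> X" "b' \<in> Y" by blast
    with x show "x * y \<in> cspan ?Z" using cl by (simp add: in_Z)
  qed
qed

lemma bop_independentD:
  assumes "bop.independent E" "finite E" "(\<Sum>e\<in>E. c e *\<^sub>C e) = 0" "e \<in> E"
  shows "c e = 0"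
  using assms by (auto simp: bop.dependent_finite)

text \<open>
  A matrix entry of the second factor turns the relation into one among the elements of \<open>E\<close>, with
  coefficients that are entries of linear combinations of \<open>F\<close>; these vanish for all entries.
\<close>

lemma tensor_family_independent:
  assumes E: "bop.independent E" "finite E" and F: "bop.independent F" "finite F"
    and z: "(\<Sum>p\<in>E \<times> F. c p *\<^sub>C (fst p \<otimes>\<^sub>o snd p)) = 0" and ef: "e \<in> E" "f \<in> F"
  shows "c (e, f) = 0"
proof -
  have "(\<Sum>e\<in>E. (\<Sum>f\<in>F. c (e, f) * entry f k l) *\<^sub>C e) = 0" for k l
  proof (rule bop_eqI)
    fix i j
    have "entry (\<Sum>e\<in>E. (\<Sum>f\<in>F. c (e, f) * entry f k l) *\<^sub>C e) i j
        = (\<Sum>e\<in>E. \<Sum>f\<in>F. c (e, f) * (entry e i j * entry f k l))"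
      by (simp add: entry_sum bop_entry_simps sum_distrib_left mult_ac)
    also have "\<dots> = (\<Sum>(e, f)\<in>E \<times> F. c (e, f) * (entry e i j * entry f k l))"
      by (rule sum.cartesian_product)
    also have "\<dots> = entry (\<Sum>p\<in>E \<times> F. c p *\<^sub>C (fst p \<otimes>\<^sub>o snd p)) (i, k) (j, l)"
      by (simp add: entry_sum bop_entry_simps split_def)
    finally show "entry (\<Sum>e\<in>E. (\<Sum>f\<in>F. c (e, f) * entry f k l) *\<^sub>C e) i j = entry 0 i j"
      by (simp add: z zero_bop.rep_eq)
  qed
  from bop_independentD[OF E this ef(1)]
  have "(\<Sum>f\<in>F. c (e, f) * entry f k l) = 0" for k l by simp
  then have "(\<Sum>f\<in>F. c (e, f) *\<^sub>C f) = 0"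
    by (intro bop_eqI) (simp add: entry_sum bop_entry_simps)
  from bop_independentD[OF F this ef(2)] show ?thesis .
qed

text \<open>
  Choose bases \<open>E\<close> and \<open>F\<close> of the two algebras. The elementary tensors of basis elements are linearly
  independent, so \<open>\<phi> \<otimes> \<psi>\<close> can be prescribed on them and extended linearly. As the algebraic tensor
  product is already complete, the extension is defined on the minimal one.
\<close>

lemma tensor_hom_exists:
  fixes A :: "'i bop set" and B :: "'j bop set" and C :: "'k bop set" and D :: "'l bop set"
  assumes fd: "fd_cstar_algebra A" "fd_cstar_algebra B"
    and \<phi>: "star_hom A C \<phi>" and \<psi>: "star_hom B D \<psi>"
  shows "\<exists>F. tensor_hom A B C D \<phi> \<psi> F"
proof -
  have basis: "\<exists>E. finite E \<and> bop.independent E \<and> A' = cspan E" if "fd_cstar_algebra A'" for A' :: "'m bop set"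
  proof -
    from that obtain X where X: "finite X" "A' = cspan X" by (auto simp: fd_cstar_algebra_def)
    obtain E where E: "E \<subseteq> X" "bop.independent E" "X \<subseteq> cspan E"
      using bop.maximal_independent_subset[of X] unfolding cspan_def by blast
    have "E \<subseteq> cspan X" using E(1) cspan_base by blast
    then have "cspan E = cspan X"
      using E(3) by (intro equalityI cspan_minimal subspace_cspan)
    moreover have "finite E" using X(1) E(1) by (rule rev_finite_subset)
    ultimately show ?thesis using X(2) E(2) by auto
  qed
  obtain E where E: "finite E" "bop.independent E" "A = cspan E" using basis[OF fd(1)] by blast
  obtain F where F: "finite F" "bop.independent F" "B = cspan F" using basis[OF fd(2)] by blast
  define t where "t = (\<lambda>p :: 'i bop \<times> 'j bop. fst p \<otimes>\<^sub>o snd p)"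
  have indep: "c p = 0" if "(\<Sum>p\<in>E \<times> F. c p *\<^sub>C t p) = 0" "p \<in> E \<times> F" for c p
    using tensor_family_independent[OF E(2,1) F(2,1), of c "fst p" "snd p"] that by (auto simp: t_def)
  have fin: "finite (E \<times> F)" using E F by simp
  have inj: "inj_on t (E \<times> F)"
  proof (rule inj_onI, rule ccontr)
    fix p q assume pq: "p \<in> E \<times> F" "q \<in> E \<times> F" "t p = t q" "p \<noteq> q"
    \<comment> \<open>equal tensors of two different basis pairs would be a linear relation\<close>
    let ?c = "\<lambda>r. of_bool (r = p) - of_bool (r = q) :: complex"
    have d: "(\<Sum>r\<in>E \<times> F. of_bool (r = s) *\<^sub>C t r) = t s" if "s \<in> E \<times> F" for s
    proof -
      have "(\<Sum>r\<in>E \<times> F. of_bool (r = s) *\<^sub>C t r) = (\<Sum>r\<in>E \<times> F. if r = s then t r else 0)"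
        by (intro sum.cong) auto
      then show ?thesis using that fin by simp
    qed
    have "(\<Sum>r\<in>E \<times> F. ?c r *\<^sub>C t r) = 0"
      by (simp only: bop.scale_left_diff_distrib sum_subtractf d[OF pq(1)] d[OF pq(2)] pq(3)) simp
    from indep[OF this pq(1)] pq(4) show False by simp
  qed
  have ind: "bop.independent (t ` (E \<times> F))"
  proof -
    have "u v = 0" if "(\<Sum>v\<in>t ` (E \<times> F). u v *\<^sub>C v) = 0" "v \<in> t ` (E \<times> F)" for u v
    proof -
      from that(1) have "(\<Sum>p\<in>E \<times> F. u (t p) *\<^sub>C t p) = 0" by (simp add: sum.reindex[OF inj])
      from indep[OF this] that(2) show ?thesis by blast
    qed
    then show ?thesis using fin by (auto simp: bop.dependent_finite)
  qed
  define g where "g = (\<lambda>T. \<phi> (fst (inv_into (E \<times> F) t T)) \<otimes>\<^sub>o \<psi> (snd (inv_into (E \<times> F) t T)))"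
  obtain H where H: "Vector_Spaces.linear scaleC scaleC H" "\<forall>T\<in>t ` (E \<times> F). H T = g T"
    using bop_pair.linear_independent_extend[OF ind, of g] by blast
  have lin: "clinear_on UNIV H"
    using H(1) by (auto simp: clinear_on_def Vector_Spaces.linear_iff)
  have add: "H (x + y) = H x + H y" and scale: "H (c *\<^sub>C x) = c *\<^sub>C H x" for x y c
    using lin by (simp_all add: clinear_on_def)
  have 0: "H (e \<otimes>\<^sub>o f) = \<phi> e \<otimes>\<^sub>o \<psi> f" if "e \<in> E" "f \<in> F" for e f
  proof -
    have "(e, f) \<in> E \<times> F" using that by simp
    then have "H (t (e, f)) = g (t (e, f))" "inv_into (E \<times> F) t (t (e, f)) = (e, f)"
      using H(2) inj by (auto simp del: mem_Sigma_iff)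
    then show ?thesis by (simp add: g_def) (simp add: t_def)
  qed
  have 1: "H (a \<otimes>\<^sub>o f) = \<phi> a \<otimes>\<^sub>o \<psi> f" if "a \<in> A" "f \<in> F" for a f
  proof (rule clinear_on_eqI[of E "\<lambda>a. H (a \<otimes>\<^sub>o f)" "\<lambda>a. \<phi> a \<otimes>\<^sub>o \<psi> f" a])
    show "clinear_on (cspan E) (\<lambda>a. H (a \<otimes>\<^sub>o f))"
      by (auto simp: clinear_on_def tensor_add_left tensor_scaleC_left add scale)
    show "clinear_on (cspan E) (\<lambda>a. \<phi> a \<otimes>\<^sub>o \<psi> f)"
      using star_hom_clinear[OF \<phi>] by (auto simp: clinear_on_def tensor_add_left tensor_scaleC_left E(3))
  qed (use that 0 E(3) in auto)
  have 2: "H (a \<otimes>\<^sub>o b) = \<phi> a \<otimes>\<^sub>o \<psi> b" if "a \<in> A" "b \<in> B" for a b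
  proof (rule clinear_on_eqI[of F "\<lambda>b. H (a \<otimes>\<^sub>o b)" "\<lambda>b. \<phi> a \<otimes>\<^sub>o \<psi> b" b])
    show "clinear_on (cspan F) (\<lambda>b. H (a \<otimes>\<^sub>o b))"
      by (auto simp: clinear_on_def tensor_add_right tensor_scaleC_right add scale)
    show "clinear_on (cspan F) (\<lambda>b. \<phi> a \<otimes>\<^sub>o \<psi> b)"
      using star_hom_clinear[OF \<psi>] by (auto simp: clinear_on_def tensor_add_right tensor_scaleC_right F(3))
  qed (use that 1 F(3) in auto)
  have cl: "x * x' \<in> A" "star x \<in> A" if "x \<in> A" "x' \<in> A" for x x'
    using fd(1) that unfolding fd_cstar_algebra_def cstar_algebra_def by blast+
  have cl': "y * y' \<in> B" "star y \<in> B" if "y \<in> B" "y' \<in> B" for y y'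
    using fd(2) that unfolding fd_cstar_algebra_def cstar_algebra_def by blast+
  have "star_hom (cspan {a \<otimes>\<^sub>o b | a b. a \<in> A \<and> b \<in> B}) (alg_tensor C D) H"
  proof (rule star_hom_cspan[OF lin])
    show "bop.subspace (alg_tensor C D)" by (simp add: alg_tensor_def subspace_cspan)
    show "H x \<in> alg_tensor C D" if "x \<in> {a \<otimes>\<^sub>o b | a b. a \<in> A \<and> b \<in> B}" for x
      using that by (auto simp: 2 alg_tensor_base star_hom_in[OF \<phi>] star_hom_in[OF \<psi>])
    show "H (x * y) = H x * H y"
      if "x \<in> {a \<otimes>\<^sub>o b | a b. a \<in> A \<and> b \<in> B}" "y \<in> {a \<otimes>\<^sub>o b | a b. a \<in> A \<and> b \<in> B}" for x y
      using that by (auto simp: 2 cl cl' star_hom_mult[OF \<phi>] star_hom_mult[OF \<psi>])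
    show "H (star x) = star (H x)" if "x \<in> {a \<otimes>\<^sub>o b | a b. a \<in> A \<and> b \<in> B}" for x
      using that by (auto simp: 2 cl cl' star_hom_star[OF \<phi>] star_hom_star[OF \<psi>])
  qed
  then have "star_hom (min_tensor A B) (min_tensor C D) H"
    unfolding min_tensor_fd[OF fd] alg_tensor_def[of A B]
    by (rule star_hom_mono[OF _ alg_tensor_subset_min_tensor])
  with 2 show ?thesis unfolding tensor_hom_def by blast
qed

lemma star_hom_flip:
  assumes "fd_cstar_algebra A" "fd_cstar_algebra B"
  shows "star_hom (min_tensor A B) (min_tensor B A) flip"
  unfolding min_tensor_fd[OF assms] min_tensor_fd[OF assms(2,1)] alg_tensor_def[of A B]
  by (rule star_hom_cspan)
     (auto simp: clinear_on_def subspace_cspan alg_tensor_base, simp add: alg_tensor_def subspace_cspan)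

lemma is_unit_of_cspan:
  assumes "e \<in> cspan X" "\<And>x. x \<in> X \<Longrightarrow> e * x = x \<and> x * e = x"
  shows "is_unit_of (cspan X) e"
proof -
  have "e * x = x \<and> x * e = x" if "x \<in> cspan X" for x
    using that by (induction rule: cspan_induct) (auto simp: assms(2) distrib_left distrib_right)
  with assms(1) show ?thesis by (auto simp: is_unit_of_def)
qed

lemma fd_cstar_algebraD:
  assumes "fd_cstar_algebra A"
  shows "cstar_algebra A" "bop.subspace A" "x \<in> A \<Longrightarrow> y \<in> A \<Longrightarrow> x * y \<in> A" "x \<in> A \<Longrightarrow> star x \<in> A"
    "x \<in> A \<Longrightarrow> y \<in> A \<Longrightarrow> x + y \<in> A"
  using assms unfolding fd_cstar_algebra_def cstar_algebra_def bop.subspace_def by blast+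

lemma tensor_hom_star_hom: "tensor_hom A B C D \<phi> \<psi> F \<Longrightarrow> star_hom (min_tensor A B) (min_tensor C D) F"
  by (simp add: tensor_hom_def)

lemma tensor_hom_tensor:
  "tensor_hom A B C D \<phi> \<psi> F \<Longrightarrow> a \<in> A \<Longrightarrow> b \<in> B \<Longrightarrow> F (a \<otimes>\<^sub>o b) = \<phi> a \<otimes>\<^sub>o \<psi> b"
  by (simp add: tensor_hom_def)

lemma tensor_hom_tensor_add:
  assumes "tensor_hom A B C D \<phi> \<psi> F" "a \<in> A" "b \<in> B" "a' \<in> A" "b' \<in> B"
  shows "F (a \<otimes>\<^sub>o b + a' \<otimes>\<^sub>o b') = \<phi> a \<otimes>\<^sub>o \<psi> b + \<phi> a' \<otimes>\<^sub>o \<psi> b'"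
  using assms star_hom_add[OF tensor_hom_star_hom[OF assms(1)], of "a \<otimes>\<^sub>o b" "a' \<otimes>\<^sub>o b'"]
  by (simp add: min_tensor_base tensor_hom_tensor)

lemma closure_cspan_eq_min_tensor:
  assumes fd: "fd_cstar_algebra (cspan X)" "fd_cstar_algebra (cspan Y)"
    and Z: "Z \<subseteq> min_tensor (cspan X) (cspan Y)"
    and XY: "\<And>x y. x \<in> X \<Longrightarrow> y \<in> Y \<Longrightarrow> x \<otimes>\<^sub>o y \<in> Z"
  shows "closure (cspan Z) = min_tensor (cspan X) (cspan Y)"
proof -
  have fdt: "fd_cstar_algebra (min_tensor (cspan X) (cspan Y))"
    by (rule fd_cstar_algebra_min_tensor[OF fd])
  have "cspan Z = min_tensor (cspan X) (cspan Y)"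
  proof
    show "cspan Z \<subseteq> min_tensor (cspan X) (cspan Y)"
      using Z by (intro cspan_minimal fd_cstar_algebraD(2)[OF fdt])
    show "min_tensor (cspan X) (cspan Y) \<subseteq> cspan Z"
      unfolding min_tensor_fd[OF fd] alg_tensor_cspan
      by (intro cspan_minimal subspace_cspan) (auto intro!: cspan_base XY)
  qed
  moreover have "closed (min_tensor (cspan X) (cspan Y))"
    by (simp add: min_tensor_def)
  ultimately show ?thesis by simp
qed

text \<open>
  The image of the neutral element only has to be a projection: a representation of \<open>G\<close> by unitaries of
  a corner of \<open>D\<close>.
\<close>

definition star_rep :: "('g, 'm) monoid_scheme \<Rightarrow> 'i bop set \<Rightarrow> ('g \<Rightarrow> 'i bop) \<Rightarrow> bool" where
  "star_rep G D U \<longleftrightarrow> (\<forall>g\<in>carrier G. U g \<in> D \<and> star (U g) = U (inv\<^bsub>G\<^esub> g) \<and>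
     (\<forall>h\<in>carrier G. U g * U h = U (g \<otimes>\<^bsub>G\<^esub> h)))"

section \<open>The function algebra of the generalized dihedral group and its action\<close>

text \<open>
  For a finite abelian group \<open>G\<close>, the algebra \<open>QG = C*(G) \<oplus> C*(G)\<close> is the algebra of functions on the
  semidirect product of the dual of \<open>G\<close> with the group of order 2 acting by inversion: each summand is the
  function algebra of one coset of the dual.
\<close>

locale finite_comm_group = comm_group G for G (structure) +
  assumes finite_carrier: "finite (carrier G)"
begin

abbreviation reg :: "'a \<Rightarrow> 'a bop" where "reg g \<equiv> left_regular G g"
abbreviation lreg :: "'a \<Rightarrow> ('a + 'a) bop" where "lreg g \<equiv> left_regular G g \<oplus>\<^sub>o 0"
abbreviation rreg :: "'a \<Rightarrow> ('a + 'a) bop" where "rreg g \<equiv> 0 \<oplus>\<^sub>o left_regular G g"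
abbreviation CG :: "'a bop set" where "CG \<equiv> group_cstar G"
abbreviation QG :: "('a + 'a) bop set" where "QG \<equiv> direct_sum_algebra (group_cstar G) (group_cstar G)"

lemma entry_reg: "g \<in> carrier G \<Longrightarrow> entry (reg g) i j = of_bool (j \<in> carrier G \<and> i = g \<otimes> j)"
  by (rule entry_left_regular[OF is_group])

lemma reg_mult [simp]:
  assumes g: "g \<in> carrier G" and h: "h \<in> carrier G"
  shows "reg g * reg h = reg (g \<otimes> h)"
proof (rule bop_eqI)
  fix i j
  have "(\<Sum>\<^sub>\<infinity>k. entry (reg g) i k * entry (reg h) k j)
      = (\<Sum>\<^sub>\<infinity>k\<in>{h \<otimes> j}. entry (reg g) i k * entry (reg h) k j)"
    by (rule infsum_cong_neutral) (auto simp: entry_reg assms)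
  also have "\<dots> = entry (reg (g \<otimes> h)) i j"
    using assms by (auto simp: entry_reg m_assoc)
  finally show "entry (reg g * reg h) i j = entry (reg (g \<otimes> h)) i j"
    by (simp add: times_bop.rep_eq)
qed

lemma star_reg [simp]:
  assumes g: "g \<in> carrier G"
  shows "star (reg g) = reg (inv g)"
proof (rule bop_eqI)
  fix i j
  have "i \<in> carrier G \<and> j = g \<otimes> i \<longleftrightarrow> j \<in> carrier G \<and> i = inv g \<otimes> j"
    using g by (auto simp: inv_solve_left inv_solve_left' m_assoc[symmetric])
  then show "entry (star (reg g)) i j = entry (reg (inv g)) i j"
    using g by (simp add: star.rep_eq entry_reg)
qed

lemma group_cstar_cspan: "CG = cspan (reg ` carrier G)"
  by (simp add: group_cstar_def closed_cspan finite_carrier)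

lemma fd_group_cstar: "fd_cstar_algebra CG"
  unfolding group_cstar_cspan
  by (rule fd_cstar_algebraI) (auto simp: finite_carrier intro!: cspan_base)

lemma reg_in: "g \<in> carrier G \<Longrightarrow> reg g \<in> CG"
  unfolding group_cstar_cspan by (intro cspan_base) simp

lemma is_unit_of_group_cstar: "is_unit_of CG (reg \<one>)"
  unfolding group_cstar_cspan by (rule is_unit_of_cspan) (auto intro!: cspan_base)

lemma QG_cspan: "QG = cspan (lreg ` carrier G \<union> rreg ` carrier G)" (is "_ = cspan ?X")
proof
  have l: "a \<oplus>\<^sub>o 0 \<in> cspan ?X" if "a \<in> CG" for a
    using that unfolding group_cstar_cspan
  proof (induction rule: cspan_induct)
    case (add x y)
    then show ?case using cspan_add[OF add(3,4)] by (simp add: direct_sum_add)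
  next
    case (scale c x)
    then show ?case using cspan_scaleC[OF scale(2), of c] by (simp add: direct_sum_scaleC)
  qed (auto simp: direct_sum_zero cspan_zero intro!: cspan_base)
  have r: "0 \<oplus>\<^sub>o a \<in> cspan ?X" if "a \<in> CG" for a
    using that unfolding group_cstar_cspan
  proof (induction rule: cspan_induct)
    case (add x y)
    then show ?case using cspan_add[OF add(3,4)] by (simp add: direct_sum_add)
  next
    case (scale c x)
    then show ?case using cspan_scaleC[OF scale(2), of c] by (simp add: direct_sum_scaleC)
  qed (auto simp: direct_sum_zero cspan_zero intro!: cspan_base)
  show "QG \<subseteq> cspan ?X"
  proof
    fix x assume "x \<in> QG"
    then obtain a b where "x = a \<oplus>\<^sub>o b" "a \<in> CG" "b \<in> CG" by (auto simp: direct_sum_algebra_def)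
    then show "x \<in> cspan ?X" using cspan_add[OF l r, of a b] by (simp add: direct_sum_add)
  qed
  have sub: "bop.subspace CG" by (rule fd_cstar_algebraD[OF fd_group_cstar])
  have "bop.subspace QG"
  proof (rule bop.subspaceI)
    show "0 \<in> QG"
      unfolding direct_sum_algebra_def using bop.subspace_0[OF sub] direct_sum_zero by fastforce
    fix x assume "x \<in> QG"
    then obtain a b where x: "x = a \<oplus>\<^sub>o b" "a \<in> CG" "b \<in> CG" by (auto simp: direct_sum_algebra_def)
    show "c *\<^sub>C x \<in> QG" for c
      unfolding direct_sum_algebra_def x(1) direct_sum_scaleC using x sub by (blast intro: bop.subspace_scale)
    fix y assume "y \<in> QG"
    then obtain a' b' where y: "y = a' \<oplus>\<^sub>o b'" "a' \<in> CG" "b' \<in> CG" by (auto simp: direct_sum_algebra_def)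
    show "x + y \<in> QG"
      unfolding direct_sum_algebra_def x(1) y(1) direct_sum_add using x y sub by (blast intro: bop.subspace_add)
  qed
  then show "cspan ?X \<subseteq> QG"
    by (intro cspan_minimal)
      (use bop.subspace_0[OF sub] reg_in in \<open>auto simp: direct_sum_algebra_def\<close>)
qed

lemma fd_QG: "fd_cstar_algebra QG"
  unfolding QG_cspan
  by (rule fd_cstar_algebraI) (auto simp: finite_carrier direct_sum_zero cspan_zero intro: cspan_base)

lemma lreg_in: "g \<in> carrier G \<Longrightarrow> lreg g \<in> QG"
  unfolding QG_cspan by (intro cspan_base) simp

lemma rreg_in: "g \<in> carrier G \<Longrightarrow> rreg g \<in> QG"
  unfolding QG_cspan by (intro cspan_base) simp

lemma is_unit_of_QG: "is_unit_of QG (lreg \<one> + rreg \<one>)"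
  unfolding QG_cspan
proof (rule is_unit_of_cspan)
  show "lreg \<one> + rreg \<one> \<in> cspan (lreg ` carrier G \<union> rreg ` carrier G)"
    by (intro cspan_add cspan_base) auto
qed (auto simp: direct_sum_add)

lemma unit_of_CG: "unit_of CG = reg \<one>"
  by (rule unit_of_eqI[OF is_unit_of_group_cstar])

lemma unit_of_QG: "unit_of QG = lreg \<one> + rreg \<one>"
  by (rule unit_of_eqI[OF is_unit_of_QG])

text \<open>
  On \<open>\<lambda>\<^sub>h\<close> the matrix entry at \<open>(g, 1)\<close> is 1 for \<open>h = g\<close> and 0 otherwise, so it is the coefficient
  functional of \<open>\<lambda>\<^sub>g\<close>, and the linear extension of \<open>U\<close> has an explicit formula.
\<close>

lemma star_hom_group_cstar_exists:
  assumes D: "bop.subspace D" and U: "star_rep G D U"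
  shows "\<exists>\<phi>. star_hom CG D \<phi> \<and> (\<forall>g\<in>carrier G. \<phi> (reg g) = U g)"
proof -
  define \<phi> where "\<phi> = (\<lambda>x. \<Sum>g\<in>carrier G. entry x g \<one> *\<^sub>C U g)"
  have \<phi>: "\<phi> (reg g) = U g" if g: "g \<in> carrier G" for g
  proof -
    have "\<phi> (reg g) = (\<Sum>h\<in>carrier G. if h = g then U h else 0)"
      unfolding \<phi>_def using g by (intro sum.cong) (auto simp: entry_reg)
    then show ?thesis using g finite_carrier by simp
  qed
  have "clinear_on UNIV \<phi>"
    by (auto simp: clinear_on_def \<phi>_def bop_entry_simps bop.scale_left_distrib sum.distrib bop.scale_sum_right)
  then have "star_hom CG D \<phi>"
    unfolding group_cstar_cspan
    by (rule star_hom_cspan) (use D U in \<open>auto simp: \<phi> star_rep_def\<close>)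
  with \<phi> show ?thesis by blast
qed

text \<open>
  A *-homomorphism on a direct sum is a pair of *-homomorphisms with orthogonal ranges.
\<close>

lemma star_hom_QG_exists:
  assumes D: "bop.subspace D" and U: "star_rep G D U" and V: "star_rep G D V"
    and orth: "\<And>g h. g \<in> carrier G \<Longrightarrow> h \<in> carrier G \<Longrightarrow> U g * V h = 0 \<and> V h * U g = 0"
  shows "\<exists>\<phi>. star_hom QG D \<phi> \<and> (\<forall>g\<in>carrier G. \<phi> (lreg g) = U g \<and> \<phi> (rreg g) = V g)"
proof -
  define \<phi> where "\<phi> = (\<lambda>x. (\<Sum>g\<in>carrier G. entry x (Inl g) (Inl \<one>) *\<^sub>C U g)
    + (\<Sum>g\<in>carrier G. entry x (Inr g) (Inr \<one>) *\<^sub>C V g))"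
  have l: "\<phi> (lreg g) = U g" if g: "g \<in> carrier G" for g
  proof -
    have "\<phi> (lreg g) = (\<Sum>h\<in>carrier G. if h = g then U h else 0)"
      unfolding \<phi>_def using g by (auto simp: entry_reg bop_entry_simps intro!: sum.cong)
    then show ?thesis using g finite_carrier by simp
  qed
  have r: "\<phi> (rreg g) = V g" if g: "g \<in> carrier G" for g
  proof -
    have "\<phi> (rreg g) = (\<Sum>h\<in>carrier G. if h = g then V h else 0)"
      unfolding \<phi>_def using g by (auto simp: entry_reg bop_entry_simps intro!: sum.cong)
    then show ?thesis using g finite_carrier by simp
  qed
  have lin: "clinear_on UNIV \<phi>"
    by (auto simp: clinear_on_def \<phi>_def bop_entry_simps bop.scale_left_distrib sum.distrib
        bop.scale_sum_right bop.scale_right_distrib)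
  have z: "\<phi> 0 = 0" by (simp add: \<phi>_def bop_entry_simps)
  from lin have "star_hom QG D \<phi>"
    unfolding QG_cspan
    by (rule star_hom_cspan)
      (use D U V orth in \<open>auto simp: l r star_rep_def direct_sum_zero z\<close>)
  with l r show ?thesis by blast
qed

text \<open>
  The values on \<open>\<lambda>\<^sub>g\<close>, \<open>A\<^sub>g\<close> and \<open>B\<^sub>g\<close> of the action and of the coproduct. They are representations
  of \<open>G\<close> because the mixed products of \<open>A\<close>'s and \<open>B\<close>'s vanish and because inversion is an automorphism of
  an abelian group.
\<close>

abbreviation act :: "'a \<Rightarrow> ('a \<times> ('a + 'a)) bop" where
  "act g \<equiv> reg g \<otimes>\<^sub>o lreg g + reg (inv g) \<otimes>\<^sub>o rreg g"
abbreviation cop_l :: "'a \<Rightarrow> (('a + 'a) \<times> ('a + 'a)) bop" where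
  "cop_l g \<equiv> lreg g \<otimes>\<^sub>o lreg g + rreg g \<otimes>\<^sub>o rreg (inv g)"
abbreviation cop_r :: "'a \<Rightarrow> (('a + 'a) \<times> ('a + 'a)) bop" where
  "cop_r g \<equiv> lreg g \<otimes>\<^sub>o rreg g + rreg g \<otimes>\<^sub>o lreg (inv g)"

lemma fd_CQ: "fd_cstar_algebra (min_tensor CG QG)" and fd_QQ: "fd_cstar_algebra (min_tensor QG QG)"
  by (intro fd_cstar_algebra_min_tensor fd_group_cstar fd_QG)+

lemma star_rep_act: "star_rep G (min_tensor CG QG) act"
  unfolding star_rep_def
  by (auto simp: distrib_left distrib_right inv_mult direct_sum_zero
      intro!: fd_cstar_algebraD(5)[OF fd_CQ] min_tensor_base reg_in lreg_in rreg_in)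

lemma star_rep_cop_l: "star_rep G (min_tensor QG QG) cop_l"
  unfolding star_rep_def
  by (auto simp: distrib_left distrib_right inv_mult direct_sum_zero
      intro!: fd_cstar_algebraD(5)[OF fd_QQ] min_tensor_base lreg_in rreg_in)

lemma star_rep_cop_r: "star_rep G (min_tensor QG QG) cop_r"
  unfolding star_rep_def
  by (auto simp: distrib_left distrib_right inv_mult direct_sum_zero
      intro!: fd_cstar_algebraD(5)[OF fd_QQ] min_tensor_base lreg_in rreg_in)

lemma action_exists:
  "\<exists>\<alpha>. star_hom CG (min_tensor CG QG) \<alpha> \<and> (\<forall>g\<in>carrier G. \<alpha> (reg g) = act g)"
  by (rule star_hom_group_cstar_exists[OF fd_cstar_algebraD(2)[OF fd_CQ] star_rep_act])

lemma coproduct_exists: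
  "\<exists>\<Delta>. star_hom QG (min_tensor QG QG) \<Delta> \<and>
     (\<forall>g\<in>carrier G. \<Delta> (lreg g) = cop_l g \<and> \<Delta> (rreg g) = cop_r g)"
  by (rule star_hom_QG_exists[OF fd_cstar_algebraD(2)[OF fd_QQ] star_rep_cop_l star_rep_cop_r])
     (auto simp: distrib_left distrib_right direct_sum_zero)

lemma unital_action:
  assumes "star_hom CG (min_tensor CG QG) \<alpha>" "\<alpha> (reg \<one>) = act \<one>"
  shows "unital_star_hom CG (min_tensor CG QG) \<alpha>"
  using assms unit_of_eqI[OF is_unit_of_min_tensor[OF is_unit_of_group_cstar is_unit_of_QG]]
  by (simp add: unital_star_hom_def unit_of_CG tensor_add_right)

lemma unital_coproduct:
  assumes "star_hom QG (min_tensor QG QG) \<Delta>" "\<Delta> (lreg \<one>) = cop_l \<one>" "\<Delta> (rreg \<one>) = cop_r \<one>"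
  shows "unital_star_hom QG (min_tensor QG QG) \<Delta>"
  using assms unit_of_eqI[OF is_unit_of_min_tensor[OF is_unit_of_QG is_unit_of_QG]]
  by (simp add: unital_star_hom_def unit_of_QG tensor_add_right tensor_add_left
      star_hom_add[OF assms(1)] lreg_in rreg_in add_ac)

lemma closure_cspan_eq_min_tensor_QG:
  assumes Z: "Z \<subseteq> min_tensor QG QG"
    and ll: "\<And>g h. g \<in> carrier G \<Longrightarrow> h \<in> carrier G \<Longrightarrow> lreg g \<otimes>\<^sub>o lreg h \<in> Z"
    and lr: "\<And>g h. g \<in> carrier G \<Longrightarrow> h \<in> carrier G \<Longrightarrow> lreg g \<otimes>\<^sub>o rreg h \<in> Z"
    and rl: "\<And>g h. g \<in> carrier G \<Longrightarrow> h \<in> carrier G \<Longrightarrow> rreg g \<otimes>\<^sub>o lreg h \<in> Z"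
    and rr: "\<And>g h. g \<in> carrier G \<Longrightarrow> h \<in> carrier G \<Longrightarrow> rreg g \<otimes>\<^sub>o rreg h \<in> Z"
  shows "closure (cspan Z) = min_tensor QG QG"
  unfolding QG_cspan
proof (rule closure_cspan_eq_min_tensor)
  show "x \<otimes>\<^sub>o y \<in> Z"
    if "x \<in> lreg ` carrier G \<union> rreg ` carrier G" "y \<in> lreg ` carrier G \<union> rreg ` carrier G" for x y
    using that by (elim UnE imageE) (simp_all add: ll lr rl rr)
qed (use Z fd_QG in \<open>simp_all flip: QG_cspan\<close>)

text \<open>
  Coassociativity is an identity between finite sums of elementary tensors. Density holds because
  multiplication by a basis element cuts one of the two terms of a coproduct away and makes the
  other one an arbitrary elementary tensor of basis elements.
\<close>

lemma compact_quantum_group_QG: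
  assumes \<Delta>: "star_hom QG (min_tensor QG QG) \<Delta>"
    and l: "\<And>g. g \<in> carrier G \<Longrightarrow> \<Delta> (lreg g) = cop_l g"
    and r: "\<And>g. g \<in> carrier G \<Longrightarrow> \<Delta> (rreg g) = cop_r g"
  shows "compact_quantum_group QG \<Delta>"
proof -
  note Q_in = lreg_in rreg_in
  have coass: "coassociative QG \<Delta>"
  proof -
    obtain F where F: "tensor_hom QG QG (min_tensor QG QG) QG \<Delta> id F"
      using tensor_hom_exists[OF fd_QG fd_QG \<Delta> star_hom_id] by blast
    obtain H where H: "tensor_hom QG QG QG (min_tensor QG QG) id \<Delta> H"
      using tensor_hom_exists[OF fd_QG fd_QG star_hom_id \<Delta>] by blast
    have "assoc_op (F (\<Delta> a)) = H (\<Delta> a)" if "a \<in> QG" for a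
    proof (rule clinear_on_eqI[of "lreg ` carrier G \<union> rreg ` carrier G" "\<lambda>a. assoc_op (F (\<Delta> a))" "\<lambda>a. H (\<Delta> a)"])
      have "clinear_on QG (\<lambda>a. F (\<Delta> a))"
        using star_hom_clinear[OF star_hom_comp[OF \<Delta> tensor_hom_star_hom[OF F]]] by (simp add: o_def)
      then show "clinear_on (cspan (lreg ` carrier G \<union> rreg ` carrier G)) (\<lambda>a. assoc_op (F (\<Delta> a)))"
        by (simp add: clinear_on_def flip: QG_cspan)
      show "clinear_on (cspan (lreg ` carrier G \<union> rreg ` carrier G)) (\<lambda>a. H (\<Delta> a))"
        using star_hom_clinear[OF star_hom_comp[OF \<Delta> tensor_hom_star_hom[OF H]]]
        by (simp add: o_def flip: QG_cspan)
      show "a \<in> cspan (lreg ` carrier G \<union> rreg ` carrier G)" using that by (simp add: QG_cspan)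
      fix x assume "x \<in> lreg ` carrier G \<union> rreg ` carrier G"
      then show "assoc_op (F (\<Delta> x)) = H (\<Delta> x)"
        by (auto simp: l r tensor_hom_tensor_add[OF F] tensor_hom_tensor_add[OF H] Q_in
            tensor_add_left tensor_add_right add_ac)
    qed
    with F H show ?thesis unfolding coassociative_def by blast
  qed
  have in_QQ: "\<Delta> a * (b \<otimes>\<^sub>o c) \<in> min_tensor QG QG" if "a \<in> QG" "b \<in> QG" "c \<in> QG" for a b c
    using that by (intro fd_cstar_algebraD(3)[OF fd_QQ] star_hom_in[OF \<Delta>] min_tensor_base)
  have unit_in: "unit_of QG \<in> QG"
    using is_unit_of_QG by (simp add: unit_of_QG is_unit_of_def)
  let ?Z = "{\<Delta> a * (unit_of QG \<otimes>\<^sub>o b) | a b. a \<in> QG \<and> b \<in> QG}"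
  have dense1: "closure (cspan ?Z) = min_tensor QG QG"
  proof (rule closure_cspan_eq_min_tensor_QG)
    show "?Z \<subseteq> min_tensor QG QG" using in_QQ unit_in by blast
    fix g h assume gh: "g \<in> carrier G" "h \<in> carrier G"
    have "lreg g \<otimes>\<^sub>o lreg h = \<Delta> (lreg g) * (unit_of QG \<otimes>\<^sub>o lreg (inv g \<otimes> h))"
      using gh by (simp add: l unit_of_QG distrib_right distrib_left direct_sum_add direct_sum_zero m_assoc[symmetric])
    then show "lreg g \<otimes>\<^sub>o lreg h \<in> ?Z" using gh by (blast intro: Q_in m_closed inv_closed)
    have "lreg g \<otimes>\<^sub>o rreg h = \<Delta> (rreg g) * (unit_of QG \<otimes>\<^sub>o rreg (inv g \<otimes> h))"
      using gh by (simp add: r unit_of_QG distrib_right distrib_left direct_sum_add direct_sum_zero m_assoc[symmetric])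
    then show "lreg g \<otimes>\<^sub>o rreg h \<in> ?Z" using gh by (blast intro: Q_in m_closed inv_closed)
    have "rreg g \<otimes>\<^sub>o lreg h = \<Delta> (rreg g) * (unit_of QG \<otimes>\<^sub>o lreg (g \<otimes> h))"
      using gh by (simp add: r unit_of_QG distrib_right distrib_left direct_sum_add direct_sum_zero m_assoc[symmetric])
    then show "rreg g \<otimes>\<^sub>o lreg h \<in> ?Z" using gh by (blast intro: Q_in m_closed inv_closed)
    have "rreg g \<otimes>\<^sub>o rreg h = \<Delta> (lreg g) * (unit_of QG \<otimes>\<^sub>o rreg (g \<otimes> h))"
      using gh by (simp add: l unit_of_QG distrib_right distrib_left direct_sum_add direct_sum_zero m_assoc[symmetric])
    then show "rreg g \<otimes>\<^sub>o rreg h \<in> ?Z" using gh by (blast intro: Q_in m_closed inv_closed)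
  qed
  let ?Z' = "{\<Delta> a * (b \<otimes>\<^sub>o unit_of QG) | a b. a \<in> QG \<and> b \<in> QG}"
  have dense2: "closure (cspan ?Z') = min_tensor QG QG"
  proof (rule closure_cspan_eq_min_tensor_QG)
    show "?Z' \<subseteq> min_tensor QG QG" using in_QQ unit_in by blast
    fix g h assume gh: "g \<in> carrier G" "h \<in> carrier G"
    have "lreg g \<otimes>\<^sub>o lreg h = \<Delta> (lreg h) * (lreg (inv h \<otimes> g) \<otimes>\<^sub>o unit_of QG)"
      using gh by (simp add: l unit_of_QG distrib_right distrib_left direct_sum_add direct_sum_zero m_assoc[symmetric])
    then show "lreg g \<otimes>\<^sub>o lreg h \<in> ?Z'" using gh by (blast intro: Q_in m_closed inv_closed)
    have "lreg g \<otimes>\<^sub>o rreg h = \<Delta> (rreg h) * (lreg (inv h \<otimes> g) \<otimes>\<^sub>o unit_of QG)"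
      using gh by (simp add: r unit_of_QG distrib_right distrib_left direct_sum_add direct_sum_zero m_assoc[symmetric])
    then show "lreg g \<otimes>\<^sub>o rreg h \<in> ?Z'" using gh by (blast intro: Q_in m_closed inv_closed)
    have "rreg g \<otimes>\<^sub>o lreg h = \<Delta> (rreg (inv h)) * (rreg (h \<otimes> g) \<otimes>\<^sub>o unit_of QG)"
      using gh by (simp add: r unit_of_QG distrib_right distrib_left direct_sum_add direct_sum_zero m_assoc[symmetric])
    then show "rreg g \<otimes>\<^sub>o lreg h \<in> ?Z'" using gh by (blast intro: Q_in m_closed inv_closed)
    have "rreg g \<otimes>\<^sub>o rreg h = \<Delta> (lreg (inv h)) * (rreg (h \<otimes> g) \<otimes>\<^sub>o unit_of QG)"
      using gh by (simp add: l unit_of_QG distrib_right distrib_left direct_sum_add direct_sum_zero m_assoc[symmetric])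
    then show "rreg g \<otimes>\<^sub>o rreg h \<in> ?Z'" using gh by (blast intro: Q_in m_closed inv_closed)
  qed
  have "unital_cstar_algebra QG"
    unfolding unital_cstar_algebra_def using fd_cstar_algebraD(1)[OF fd_QG] is_unit_of_QG by blast
  then show ?thesis
    unfolding compact_quantum_group_def
    using unital_coproduct[OF \<Delta>] l r coass dense1 dense2 by simp
qed

lemma cqg_action_QG:
  assumes \<Delta>: "star_hom QG (min_tensor QG QG) \<Delta>"
    and l: "\<And>g. g \<in> carrier G \<Longrightarrow> \<Delta> (lreg g) = cop_l g"
    and r: "\<And>g. g \<in> carrier G \<Longrightarrow> \<Delta> (rreg g) = cop_r g"
    and \<alpha>: "star_hom CG (min_tensor CG QG) \<alpha>"
    and a: "\<And>g. g \<in> carrier G \<Longrightarrow> \<alpha> (reg g) = act g"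
  shows "cqg_action CG QG \<Delta> \<alpha>"
proof -
  note Q_in = reg_in lreg_in rreg_in
  have f\<Delta>: "star_hom QG (min_tensor QG QG) (flip \<circ> \<Delta>)"
    by (rule star_hom_comp[OF \<Delta> star_hom_flip[OF fd_QG fd_QG]])
  obtain F where F: "tensor_hom CG QG (min_tensor CG QG) QG \<alpha> id F"
    using tensor_hom_exists[OF fd_group_cstar fd_QG \<alpha> star_hom_id] by blast
  obtain H where H: "tensor_hom CG QG CG (min_tensor QG QG) id (flip \<circ> \<Delta>) H"
    using tensor_hom_exists[OF fd_group_cstar fd_QG star_hom_id f\<Delta>] by blast
  have coact: "assoc_op (F (\<alpha> x)) = H (\<alpha> x)" if "x \<in> CG" for x
  proof (rule clinear_on_eqI[of "reg ` carrier G" "\<lambda>x. assoc_op (F (\<alpha> x))" "\<lambda>x. H (\<alpha> x)"])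
    have "clinear_on CG (\<lambda>x. F (\<alpha> x))"
      using star_hom_clinear[OF star_hom_comp[OF \<alpha> tensor_hom_star_hom[OF F]]] by (simp add: o_def)
    then show "clinear_on (cspan (reg ` carrier G)) (\<lambda>x. assoc_op (F (\<alpha> x)))"
      by (simp add: clinear_on_def flip: group_cstar_cspan)
    show "clinear_on (cspan (reg ` carrier G)) (\<lambda>x. H (\<alpha> x))"
      using star_hom_clinear[OF star_hom_comp[OF \<alpha> tensor_hom_star_hom[OF H]]]
      by (simp add: o_def flip: group_cstar_cspan)
    show "x \<in> cspan (reg ` carrier G)" using that by (simp add: group_cstar_cspan)
    fix y assume "y \<in> reg ` carrier G"
    then show "assoc_op (F (\<alpha> y)) = H (\<alpha> y)"
      by (auto simp: a l r tensor_hom_tensor_add[OF F] tensor_hom_tensor_add[OF H] Q_in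
          tensor_add_left tensor_add_right add_ac)
  qed
  let ?X = "lreg ` carrier G \<union> rreg ` carrier G"
  have fdX: "fd_cstar_algebra (cspan ?X)" using fd_QG by (simp add: QG_cspan)
  have fdC: "fd_cstar_algebra (cspan (reg ` carrier G))" using fd_group_cstar by (simp add: group_cstar_cspan)
  let ?Z = "{\<alpha> x * (unit_of CG \<otimes>\<^sub>o q) | x q. x \<in> CG \<and> q \<in> QG}"
  have "closure (cspan ?Z) = min_tensor (cspan (reg ` carrier G)) (cspan ?X)"
  proof (rule closure_cspan_eq_min_tensor[OF fdC fdX])
    have "\<alpha> x * (unit_of CG \<otimes>\<^sub>o q) \<in> min_tensor CG QG" if "x \<in> CG" "q \<in> QG" for x q
      using that
      by (intro fd_cstar_algebraD(3)[OF fd_CQ] star_hom_in[OF \<alpha>] min_tensor_base) (auto simp: unit_of_CG reg_in)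
    then show "?Z \<subseteq> min_tensor (cspan (reg ` carrier G)) (cspan ?X)"
      unfolding QG_cspan[symmetric] group_cstar_cspan[symmetric] by blast
    have l: "reg g \<otimes>\<^sub>o lreg h \<in> ?Z" if gh: "g \<in> carrier G" "h \<in> carrier G" for g h
    proof -
      have "reg g \<otimes>\<^sub>o lreg h = \<alpha> (reg g) * (unit_of CG \<otimes>\<^sub>o lreg (inv g \<otimes> h))"
        using gh by (simp add: a unit_of_CG distrib_right distrib_left direct_sum_zero m_assoc[symmetric])
      then show ?thesis using gh by (blast intro: Q_in m_closed inv_closed)
    qed
    have r: "reg g \<otimes>\<^sub>o rreg h \<in> ?Z" if gh: "g \<in> carrier G" "h \<in> carrier G" for g h
    proof -
      have "reg g \<otimes>\<^sub>o rreg h = \<alpha> (reg (inv g)) * (unit_of CG \<otimes>\<^sub>o rreg (g \<otimes> h))"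
        using gh by (simp add: a unit_of_CG distrib_right distrib_left direct_sum_zero m_assoc[symmetric])
      then show ?thesis using gh by (blast intro: Q_in m_closed inv_closed)
    qed
    fix x y assume "x \<in> reg ` carrier G" "y \<in> ?X"
    then show "x \<otimes>\<^sub>o y \<in> ?Z"
      by (elim UnE imageE) (simp_all only: l r)
  qed
  then have "closure (cspan ?Z) = min_tensor CG QG"
    unfolding QG_cspan[symmetric] group_cstar_cspan[symmetric] .
  then show ?thesis
    unfolding cqg_action_def using unital_action[OF \<alpha> a[OF one_closed]] F H coact by blast
qed

text \<open>
  Inverting every letter of a word for \<open>g\<close> gives a word for the inverse, as \<open>G\<close> is abelian.
\<close>

lemma word_length_inv:
  assumes S: "symmetric_generating_set G S" and g: "g \<in> carrier G"
  shows "word_length G S (inv g) = word_length G S g"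
proof -
  have S': "S \<subseteq> carrier G" "\<forall>s\<in>S. inv s \<in> S"
    using S by (auto simp: symmetric_generating_set_def)
  have fold: "foldr (\<otimes>) ws \<one> \<in> carrier G \<and> foldr (\<otimes>) (map (m_inv G) ws) \<one> = inv (foldr (\<otimes>) ws \<one>)"
    if "set ws \<subseteq> S" for ws
    using that by (induction ws) (use S' in \<open>auto simp: inv_mult\<close>)
  have 1: "\<exists>ws. length ws = k \<and> set ws \<subseteq> S \<and> foldr (\<otimes>) ws \<one> = inv h"
    if "\<exists>ws. length ws = k \<and> set ws \<subseteq> S \<and> foldr (\<otimes>) ws \<one> = h" for k h
  proof -
    from that obtain ws where "length ws = k" "set ws \<subseteq> S" "foldr (\<otimes>) ws \<one> = h" by blast
    then show ?thesis using fold[of ws] S' by (intro exI[of _ "map (m_inv G) ws"]) auto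
  qed
  have "(\<exists>ws. length ws = k \<and> set ws \<subseteq> S \<and> foldr (\<otimes>) ws \<one> = inv g) \<longleftrightarrow>
        (\<exists>ws. length ws = k \<and> set ws \<subseteq> S \<and> foldr (\<otimes>) ws \<one> = g)" for k
    using 1[of k g] 1[of k "inv g"] g by auto
  then show ?thesis by (simp add: word_length_def)
qed

lemma slice_one_reg_tensor: "h \<in> carrier G \<Longrightarrow> slice \<one> (reg h \<otimes>\<^sub>o T) = of_bool (h = \<one>) *\<^sub>C T"
  by (rule bop_eqI) (auto simp: bop_entry_simps entry_reg)

text \<open>
  The spheres are preserved since \<open>\<alpha>(\<lambda>\<^sub>g)\<close> involves only \<open>g\<close> and its inverse, and the trace since one of
  these is neutral iff both are.
\<close>

lemma qiso_object_QG:
  assumes S: "symmetric_generating_set G S"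
    and \<Delta>: "star_hom QG (min_tensor QG QG) \<Delta>"
    and l: "\<And>g. g \<in> carrier G \<Longrightarrow> \<Delta> (lreg g) = cop_l g"
    and r: "\<And>g. g \<in> carrier G \<Longrightarrow> \<Delta> (rreg g) = cop_r g"
    and \<alpha>: "star_hom CG (min_tensor CG QG) \<alpha>"
    and a: "\<And>g. g \<in> carrier G \<Longrightarrow> \<alpha> (reg g) = act g"
  shows "qiso_object G S QG \<Delta> \<alpha>"
proof -
  have "slice \<one> (\<alpha> x) = canonical_trace G x *\<^sub>C unit_of QG" if "x \<in> CG" for x
  proof (rule clinear_on_eqI[of "reg ` carrier G" "\<lambda>x. slice \<one> (\<alpha> x)" "\<lambda>x. canonical_trace G x *\<^sub>C unit_of QG"])
    show "clinear_on (cspan (reg ` carrier G)) (\<lambda>x. slice \<one> (\<alpha> x))"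
      using star_hom_clinear[OF \<alpha>] by (simp add: clinear_on_def flip: group_cstar_cspan)
    show "clinear_on (cspan (reg ` carrier G)) (\<lambda>x. canonical_trace G x *\<^sub>C unit_of QG)"
      by (simp add: clinear_on_def canonical_trace_def bop_entry_simps bop.scale_left_distrib)
    show "x \<in> cspan (reg ` carrier G)" using that by (simp add: group_cstar_cspan)
    fix y assume "y \<in> reg ` carrier G"
    then obtain g where g: "g \<in> carrier G" "y = reg g" by blast
    show "slice \<one> (\<alpha> y) = canonical_trace G y *\<^sub>C unit_of QG"
      using g by (auto simp: a slice_one_reg_tensor canonical_trace_left_regular unit_of_QG inv_eq_1_iff)
  qed
  moreover have "\<alpha> (reg g) \<in> alg_tensor (cspan {reg h | h. h \<in> carrier G \<and> word_length G S h = word_length G S g}) QG"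
    if g: "g \<in> carrier G" for g
    unfolding a[OF g] using g word_length_inv[OF S g]
    by (intro cspan_add[of _ "{a \<otimes>\<^sub>o b |a b. a \<in> _ \<and> b \<in> _}", folded alg_tensor_def] alg_tensor_base cspan_base lreg_in rreg_in)
      auto
  ultimately show ?thesis
    unfolding qiso_object_def
    using compact_quantum_group_QG[OF \<Delta> l r] cqg_action_QG[OF \<Delta> l r \<alpha> a] by blast
qed

end

section \<open>Normal partial isometries\<close>

text \<open>
  Powers of a normal partial isometry in the corner where it is unitary: the exponent 0 gives the unit
  of the corner, which is the range projection.
\<close>

primrec corner_power :: "'i bop \<Rightarrow> nat \<Rightarrow> 'i bop" where
  "corner_power a 0 = a * star a"
| "corner_power a (Suc k) = a * corner_power a k"

lemma corner_power_add:
  assumes a: "a * star a * a = a"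
  shows "corner_power a k * corner_power a l = corner_power a (k + l)"
proof (induction k)
  case 0
  have "a * star a * (a * x) = a * x" for x
    by (simp only: mult.assoc[symmetric] a)
  then show ?case by (cases l) simp_all
next
  case (Suc k)
  then show ?case by (simp add: mult.assoc)
qed

lemma corner_power_one:
  assumes "a * star a * a = a" "star a * a = a * star a"
  shows "corner_power a (Suc 0) = a"
proof -
  have "corner_power a (Suc 0) = a * (star a * a)" by (simp add: assms(2))
  then show ?thesis by (simp only: mult.assoc[symmetric] assms(1))
qed

lemma star_corner_power_mult:
  assumes a: "a * star a * a = a" and n: "star a * a = a * star a"
  shows "star (corner_power a k) * corner_power a k = corner_power a 0"
proof (induction k)
  case 0
  show ?case by (simp add: mult.assoc[symmetric] a)
next
  case (Suc k)
  have "star (corner_power a (Suc k)) * corner_power a (Suc k)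
      = star (corner_power a k) * ((star a * a) * corner_power a k)"
    by (simp add: mult.assoc)
  also have "(star a * a) * corner_power a k = corner_power a k"
    using corner_power_add[OF a, of 0 k] by (simp add: n)
  finally show ?case using Suc by simp
qed

text \<open>
  Both sides are inverse to the \<open>k\<close>-th power in the corner.
\<close>

lemma star_corner_power:
  assumes a: "a * star a * a = a" and n: "star a * a = a * star a"
    and inv: "corner_power a (k + m) = corner_power a 0"
  shows "star (corner_power a k) = corner_power a m"
proof -
  have "star (corner_power a k) = star (corner_power a 0 * corner_power a k)"
    using corner_power_add[OF a, of 0 k] by simp
  also have "\<dots> = star (corner_power a k) * corner_power a 0" by simp
  also have "\<dots> = star (corner_power a k) * (corner_power a k * corner_power a m)"
    by (simp add: corner_power_add[OF a] inv)
  also have "\<dots> = corner_power a 0 * corner_power a m"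
    by (simp add: mult.assoc[symmetric] star_corner_power_mult[OF a n] del: corner_power.simps)
  also have "\<dots> = corner_power a m" by (simp add: corner_power_add[OF a] del: corner_power.simps)
  finally show ?thesis .
qed

lemma mult_corner_power_zero:
  assumes "a * b = 0"
  shows "a * corner_power b k = 0"
  by (cases k) (simp_all add: mult.assoc[symmetric] assms)

lemma corner_power_mult_zero:
  assumes "a * star a * a = a" "a * b = 0"  "star a * b = 0"
  shows "corner_power a k * corner_power b l = 0"
  using assms by (induction k) (simp_all add: mult.assoc mult_corner_power_zero)

lemma corner_power_in:
  assumes "cstar_algebra A" "a \<in> A"
  shows "corner_power a k \<in> A"
  using assms by (induction k) (auto simp: cstar_algebra_def)

text \<open>
  The relations that unitarity and trace invariance impose on the coefficients of an action. The
  anticommutation lets \<open>b\<close> move to the front of \<open>a b = a b b* b\<close>, where \<open>a b* = 0\<close> kills the product. Then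
  \<open>a* b* = b* a* = 0\<close> as well, and inserting the unit in \<open>a a*\<close> on the right and in \<open>a* a\<close> on the left
  gives the same element \<open>a a* a* a\<close>.
\<close>

lemma orthogonal_normal_partial_isometries:
  assumes unit: "\<And>x. x \<in> {a, b, star a, star b} \<Longrightarrow> e * x = x \<and> x * e = x"
    and rows: "a * star a + b * star b = e" and cols: "star a * a + star b * b = e"
    and orth: "a * star b = 0" "b * star a = 0" "star a * b = 0" "star b * a = 0"
    and anti: "a * b + b * a = 0"
  shows "a * b = 0" "b * a = 0" "a * star a * a = a" "b * star b * b = b"
    "star a * a = a * star a" "star b * b = b * star b"
proof -
  have ba: "b * a = - (a * b)" using anti by (simp add: eq_neg_iff_add_eq_0 add.commute)
  have "a * b = a * (b * e)" using unit by simp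
  also have "\<dots> = (a * b) * (star b * b) + a * (b * star a) * a"
    unfolding cols[symmetric] by (simp add: distrib_left mult.assoc)
  also have "(a * b) * (star b * b) = (- (b * a)) * (star b * b)" by (simp add: ba)
  also have "\<dots> = - (b * (a * star b) * b)" by (simp add: mult.assoc)
  finally show ab: "a * b = 0" by (simp add: orth)
  with ba show ba0: "b * a = 0" by simp
  have "a = e * a" using unit by simp
  also have "\<dots> = a * star a * a + b * (star b * a)"
    unfolding rows[symmetric] by (simp add: distrib_right mult.assoc)
  finally show a: "a * star a * a = a" by (simp add: orth)
  have "b = e * b" using unit by simp
  also have "\<dots> = a * (star a * b) + b * star b * b"
    unfolding rows[symmetric] by (simp add: distrib_right mult.assoc)
  finally show b: "b * star b * b = b" by (simp add: orth)
  have sab: "star a * star b = 0" "star b * star a = 0"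
    using ab ba0 by (metis star_mult star_zero)+
  have "a * star a = a * (star a * e)" using unit by simp
  also have "\<dots> = (a * star a) * (star a * a) + a * (star a * star b) * b"
    unfolding cols[symmetric] by (simp add: distrib_left mult.assoc)
  finally have 1: "a * star a = (a * star a) * (star a * a)" by (simp add: sab)
  have "star a * a = e * star a * a" using unit by simp
  also have "\<dots> = (a * star a) * (star a * a) + b * (star b * star a) * a"
    unfolding rows[symmetric] by (simp add: distrib_right mult.assoc)
  finally show na: "star a * a = a * star a" using 1 by (simp add: sab)
  show "star b * b = b * star b"
    using rows cols na by (metis add_left_cancel)
qed

section \<open>Competing actions on the algebra of a cyclic group\<close>

lemma alg_tensor_cspan_pair:
  assumes D: "bop.subspace D" and x: "x \<in> alg_tensor (cspan {u, v}) D"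
  shows "\<exists>a\<in>D. \<exists>b\<in>D. x = u \<otimes>\<^sub>o a + v \<otimes>\<^sub>o b"
proof -
  let ?T = "{u \<otimes>\<^sub>o a + v \<otimes>\<^sub>o b | a b. a \<in> D \<and> b \<in> D}"
  have add: "y + y' \<in> ?T" if yy: "y \<in> ?T" "y' \<in> ?T" for y y'
  proof -
    from yy obtain a b a' b' where "y = u \<otimes>\<^sub>o a + v \<otimes>\<^sub>o b" "y' = u \<otimes>\<^sub>o a' + v \<otimes>\<^sub>o b'"
      and in_D: "a \<in> D" "b \<in> D" "a' \<in> D" "b' \<in> D" by blast
    then have "y + y' = u \<otimes>\<^sub>o (a + a') + v \<otimes>\<^sub>o (b + b')" by (simp add: tensor_add_right)
    then show ?thesis using in_D D by (blast intro: bop.subspace_add)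
  qed
  have scale: "c *\<^sub>C y \<in> ?T" if yy: "y \<in> ?T" for c y
  proof -
    from yy obtain a b where "y = u \<otimes>\<^sub>o a + v \<otimes>\<^sub>o b" and in_D: "a \<in> D" "b \<in> D" by blast
    then have "c *\<^sub>C y = u \<otimes>\<^sub>o (c *\<^sub>C a) + v \<otimes>\<^sub>o (c *\<^sub>C b)"
      by (simp add: tensor_scaleC_right bop.scale_right_distrib)
    then show ?thesis using in_D D by (blast intro: bop.subspace_scale)
  qed
  have D0: "0 \<in> D" by (rule bop.subspace_0[OF D])
  have zero: "0 \<in> ?T" using D0 by (intro CollectI exI[of _ 0]) simp
  have sub: "bop.subspace ?T" by (rule bop.subspaceI) (fact zero, fact add, fact scale)
  have "y \<otimes>\<^sub>o d \<in> ?T" if "y \<in> cspan {u, v}" and d: "d \<in> D" for y d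
    using that(1)
  proof (induction rule: cspan_induct)
    case (base w)
    then consider "w = u" | "w = v" by blast
    then show ?case
    proof cases
      case 1 then show ?thesis using d D0 by (intro CollectI exI[of _ d] exI[of _ 0]) simp
    next
      case 2 then show ?thesis using d D0 by (intro CollectI exI[of _ 0] exI[of _ d]) simp
    qed
  next
    case zero
    show ?case using \<open>0 \<in> ?T\<close> by simp
  next
    case (add y y')
    then show ?case using \<open>\<And>y y'. y \<in> ?T \<Longrightarrow> y' \<in> ?T \<Longrightarrow> y + y' \<in> ?T\<close> by (simp only: tensor_add_left)
  next
    case (scale c y)
    then show ?case using \<open>\<And>y c. y \<in> ?T \<Longrightarrow> c *\<^sub>C y \<in> ?T\<close> by (simp only: tensor_scaleC_left)
  qed
  then have "alg_tensor (cspan {u, v}) D \<subseteq> ?T"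
    unfolding alg_tensor_def by (intro cspan_minimal sub) blast
  with x show ?thesis by blast
qed

text \<open>
  The three operators have disjoint sets of nonzero entries, so the second legs are uniquely
  determined.
\<close>

lemma (in finite_comm_group) reg_tensor_eqD:
  assumes "g \<in> carrier G" "h \<in> carrier G" "k \<in> carrier G" "g \<noteq> h" "g \<noteq> k" "h \<noteq> k"
    and eq: "reg g \<otimes>\<^sub>o x + reg h \<otimes>\<^sub>o y + reg k \<otimes>\<^sub>o w = reg g \<otimes>\<^sub>o x' + reg h \<otimes>\<^sub>o y' + reg k \<otimes>\<^sub>o w'"
  shows "x = x'" "y = y'" "w = w'"
proof -
  have eq': "entry (reg g \<otimes>\<^sub>o x + reg h \<otimes>\<^sub>o y + reg k \<otimes>\<^sub>o w) (f, i) (\<one>, j)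
      = entry (reg g \<otimes>\<^sub>o x' + reg h \<otimes>\<^sub>o y' + reg k \<otimes>\<^sub>o w') (f, i) (\<one>, j)" for f i j
    by (simp only: eq)
  show "x = x'" by (rule bop_eqI) (use eq'[of g] assms(1-6) in \<open>simp add: bop_entry_simps entry_reg\<close>)
  show "y = y'" by (rule bop_eqI) (use eq'[of h] assms(1-6) in \<open>simp add: bop_entry_simps entry_reg\<close>)
  show "w = w'" by (rule bop_eqI) (use eq'[of k] assms(1-6) in \<open>simp add: bop_entry_simps entry_reg\<close>)
qed

text \<open>
  The last two conditions say that the order of the generator is not 1, 2 or 4; together they make
  \<open>1\<close>, \<open>z\<^sup>2\<close> and \<open>z\<^bsup>-2\<^esup>\<close> distinct.
\<close>

locale finite_cyclic_group = finite_comm_group G for G (structure) +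
  fixes z
  assumes z_in [simp]: "z \<in> carrier G"
    and generated: "carrier G \<subseteq> range (\<lambda>k::nat. z [^] k)"
    and order_not_2: "z \<otimes> z \<noteq> \<one>"
    and order_not_4: "z \<otimes> z \<noteq> inv z \<otimes> inv z"
begin

lemma z_not_one: "z \<noteq> \<one>"
  using order_not_2 by auto

lemma inv_z_neq: "inv z \<noteq> z"
  using order_not_2 by (metis l_inv z_in)

lemma symmetric_generating_set_z: "symmetric_generating_set G {z, inv z}"
proof -
  have "z [^] k \<in> generate G {z, inv z}" for k :: nat
    by (induction k) (auto intro: generate.intros)
  then have "carrier G \<subseteq> generate G {z, inv z}" using generated by blast
  then show ?thesis
    using generate_incl[of "{z, inv z}"] by (auto simp: symmetric_generating_set_def)
qed

text \<open>
  The generator has length 1, being a letter and not neutral; conversely an element of length 1 is a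
  letter. Every element has some word, so its length is attained.
\<close>

lemma word_length_z_sphere:
  assumes h: "h \<in> carrier G" and eq: "word_length G {z, inv z} h = word_length G {z, inv z} z"
  shows "h \<in> {z, inv z}"
proof -
  let ?W = "\<lambda>g k. \<exists>ws. length ws = k \<and> set ws \<subseteq> {z, inv z} \<and> foldr (\<otimes>) ws \<one> = g"
  have z1: "word_length G {z, inv z} z = 1"
    unfolding word_length_def
  proof (rule Least_equality)
    show "?W z 1" by (rule exI[of _ "[z]"]) simp
    show "1 \<le> k" if "?W z k" for k using that z_not_one by (cases k) auto
  qed
  obtain k :: nat where k: "h = z [^] k" using h generated by blast
  have "foldr (\<otimes>) (replicate k z) \<one> = z [^] k"
    by (induction k) (simp_all add: nat_pow_Suc2[symmetric] del: nat_pow_Suc)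
  then have "?W h k" by (intro exI[of _ "replicate k z"]) (auto simp: k)
  then have "?W h (word_length G {z, inv z} h)" unfolding word_length_def by (rule LeastI)
  then have "?W h 1" by (simp only: eq z1)
  then obtain ws where "length ws = 1" "set ws \<subseteq> {z, inv z}" "foldr (\<otimes>) ws \<one> = h" by blast
  then show ?thesis by (cases ws) auto
qed

text \<open>
  The unitary \<open>\<lambda>\<^sub>z\<close> generates \<open>C*(G)\<close> as a *-algebra; the unit is obtained as \<open>\<lambda>\<^sub>z \<lambda>\<^sub>z*\<close>, which lets the
  two maps have different codomains and be non-unital.
\<close>

lemma star_hom_group_cstar_eqI:
  assumes \<phi>: "star_hom CG D \<phi>" and \<psi>: "star_hom CG E \<psi>" and eq: "\<phi> (reg z) = \<psi> (reg z)" and x: "x \<in> CG"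
  shows "\<phi> x = \<psi> x"
proof -
  have one: "reg \<one> = reg z * star (reg z)" by simp
  have "\<phi> (reg (z [^] k)) = \<psi> (reg (z [^] k))" for k :: nat
  proof (induction k)
    case 0
    have "\<phi> (reg z * star (reg z)) = \<psi> (reg z * star (reg z))"
      using fd_cstar_algebraD(4)[OF fd_group_cstar reg_in[OF z_in]]
      by (simp only: star_hom_mult[OF \<phi>] star_hom_mult[OF \<psi>] star_hom_star[OF \<phi>] star_hom_star[OF \<psi>] reg_in z_in eq)
    then show ?case by (simp only: nat_pow_0 one)
  next
    case (Suc k)
    have "\<phi> (reg (z [^] k) * reg z) = \<psi> (reg (z [^] k) * reg z)"
      using Suc by (simp only: star_hom_mult[OF \<phi>] star_hom_mult[OF \<psi>] reg_in z_in nat_pow_closed eq)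
    then show ?case by simp
  qed
  then have gen: "\<phi> y = \<psi> y" if "y \<in> reg ` carrier G" for y
    using that generated by auto
  show ?thesis
    by (rule clinear_on_eqI[of "reg ` carrier G" \<phi> \<psi>])
      (use star_hom_clinear[OF \<phi>] star_hom_clinear[OF \<psi>] gen x in \<open>simp_all add: group_cstar_cspan\<close>)
qed

lemma star_hom_QG_eqI:
  assumes \<phi>: "star_hom QG D \<phi>" and \<psi>: "star_hom QG E \<psi>"
    and eq: "\<phi> (lreg z) = \<psi> (lreg z)" "\<phi> (rreg z) = \<psi> (rreg z)" and x: "x \<in> QG"
  shows "\<phi> x = \<psi> x"
proof -
  have one: "lreg \<one> = lreg z * star (lreg z)" "rreg \<one> = rreg z * star (rreg z)" by simp_all
  have st: "star (lreg z) \<in> QG" "star (rreg z) \<in> QG"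
    by (intro fd_cstar_algebraD(4)[OF fd_QG] lreg_in rreg_in z_in)+
  have "\<phi> (lreg (z [^] k)) = \<psi> (lreg (z [^] k)) \<and> \<phi> (rreg (z [^] k)) = \<psi> (rreg (z [^] k))" for k :: nat
  proof (induction k)
    case 0
    have "\<phi> (lreg z * star (lreg z)) = \<psi> (lreg z * star (lreg z))"
      "\<phi> (rreg z * star (rreg z)) = \<psi> (rreg z * star (rreg z))"
      using st by (simp_all only: star_hom_mult[OF \<phi>] star_hom_mult[OF \<psi>] star_hom_star[OF \<phi>]
          star_hom_star[OF \<psi>] lreg_in rreg_in z_in eq)
    then show ?case by (simp only: nat_pow_0 one)
  next
    case (Suc k)
    have "\<phi> (lreg (z [^] k) * lreg z) = \<psi> (lreg (z [^] k) * lreg z)"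
      "\<phi> (rreg (z [^] k) * rreg z) = \<psi> (rreg (z [^] k) * rreg z)"
      using Suc by (simp_all only: star_hom_mult[OF \<phi>] star_hom_mult[OF \<psi>] lreg_in rreg_in z_in nat_pow_closed eq)
    then show ?case by simp
  qed
  then have gen: "\<phi> y = \<psi> y" if "y \<in> lreg ` carrier G \<union> rreg ` carrier G" for y
    using that generated by auto
  show ?thesis
    by (rule clinear_on_eqI[of "lreg ` carrier G \<union> rreg ` carrier G" \<phi> \<psi>])
      (use star_hom_clinear[OF \<phi>] star_hom_clinear[OF \<psi>] gen x in \<open>simp_all add: QG_cspan\<close>)
qed

end

lemma flip_flip [simp]: "flip (flip T) = T"
  by (rule bop_eqI) (simp add: bop_entry_simps)

lemma (in finite_comm_group) reg_tensor_inject: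
  assumes "g \<in> carrier G" "reg g \<otimes>\<^sub>o x = reg g \<otimes>\<^sub>o y"
  shows "x = y"
proof (rule bop_eqI)
  fix i j
  have "entry (reg g \<otimes>\<^sub>o x) (g, i) (\<one>, j) = entry (reg g \<otimes>\<^sub>o y) (g, i) (\<one>, j)"
    by (simp only: assms(2))
  then show "entry x i j = entry y i j" using assms(1) by (simp add: bop_entry_simps entry_reg)
qed

context finite_cyclic_group
begin

text \<open>
  Expand \<open>\<alpha>'(\<lambda>\<^sub>z) \<alpha>'(\<lambda>\<^sub>z)*\<close> and \<open>\<alpha>'(\<lambda>\<^sub>z)* \<alpha>'(\<lambda>\<^sub>z)\<close>, which are both \<open>1 \<otimes> 1\<close>, and compare the
  coefficients at the distinct elements \<open>1\<close>, \<open>z\<^sup>2\<close>, \<open>z\<^bsup>-2\<^esup>\<close>. The coefficient of \<open>\<alpha>'(\<lambda>\<^sub>z)\<^sup>2\<close> at \<open>1\<close> is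
  \<open>a b + b a\<close>, which is the trace of \<open>\<lambda>\<^sub>z\<^sup>2\<close> and hence 0.
\<close>

lemma qiso_object_coefficients:
  assumes obj: "qiso_object G {z, inv z} Q' \<Delta>' \<alpha>'"
  obtains a b where "a \<in> Q'" "b \<in> Q'" "\<alpha>' (reg z) = reg z \<otimes>\<^sub>o a + reg (inv z) \<otimes>\<^sub>o b"
    "a * star a + b * star b = unit_of Q'"
    "a * b = 0" "b * a = 0" "a * star b = 0" "b * star a = 0" "star a * b = 0" "star b * a = 0"
    "a * star a * a = a" "b * star b * b = b"
    "star a * a = a * star a" "star b * b = b * star b"
proof -
  let ?e = "unit_of Q'"
  have Q': "unital_cstar_algebra Q'" and \<alpha>': "star_hom CG (min_tensor CG Q') \<alpha>'"
    and \<alpha>'1: "\<alpha>' (unit_of CG) = unit_of (min_tensor CG Q')"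
    and trace: "\<And>x. x \<in> CG \<Longrightarrow> slice \<one> (\<alpha>' x) = canonical_trace G x *\<^sub>C ?e"
    and sphere: "\<alpha>' (reg z) \<in> alg_tensor (cspan {reg h | h. h \<in> carrier G \<and>
        word_length G {z, inv z} h = word_length G {z, inv z} z}) Q'"
    using obj by (auto simp: qiso_object_def compact_quantum_group_def cqg_action_def unital_star_hom_def)
  have cst: "cstar_algebra Q'" using Q' by (simp add: unital_cstar_algebra_def)
  then have star_in: "star x \<in> Q'" if "x \<in> Q'" for x using that by (simp add: cstar_algebra_def)
  have sub: "bop.subspace Q'" using cst by (simp add: cstar_algebra_def)
  have e: "is_unit_of Q' ?e" by (rule is_unit_of_unit_of[OF Q'])
  have "{reg h | h. h \<in> carrier G \<and> word_length G {z, inv z} h = word_length G {z, inv z} z}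
      = {reg z, reg (inv z)}"
    using word_length_z_sphere word_length_inv[OF symmetric_generating_set_z z_in] by auto
  with sphere have "\<alpha>' (reg z) \<in> alg_tensor (cspan {reg z, reg (inv z)}) Q'" by simp
  from alg_tensor_cspan_pair[OF sub this] obtain a b
    where ab: "a \<in> Q'" "b \<in> Q'" and \<alpha>z: "\<alpha>' (reg z) = reg z \<otimes>\<^sub>o a + reg (inv z) \<otimes>\<^sub>o b" by blast
  have "\<alpha>' (star (reg z)) = reg (inv z) \<otimes>\<^sub>o star a + reg z \<otimes>\<^sub>o star b"
    using star_hom_star[OF \<alpha>' reg_in[OF z_in]] by (simp add: \<alpha>z)
  then have \<alpha>iz: "\<alpha>' (reg (inv z)) = reg (inv z) \<otimes>\<^sub>o star a + reg z \<otimes>\<^sub>o star b" by simp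
  have \<alpha>one: "\<alpha>' (reg \<one>) = reg \<one> \<otimes>\<^sub>o ?e"
    using \<alpha>'1 unit_of_eqI[OF is_unit_of_min_tensor[OF is_unit_of_group_cstar e]] by (simp add: unit_of_CG)
  have distinct: "\<one> \<noteq> z \<otimes> z" "\<one> \<noteq> inv z \<otimes> inv z" "z \<otimes> z \<noteq> inv z \<otimes> inv z"
    using order_not_2 order_not_4 by (auto simp: inv_mult[symmetric] eq_commute[of \<one>] inv_eq_1_iff)
  have car: "\<one> \<in> carrier G" "z \<otimes> z \<in> carrier G" "inv z \<otimes> inv z \<in> carrier G" by auto
  have "\<alpha>' (reg z * reg (inv z)) = reg \<one> \<otimes>\<^sub>o (a * star a + b * star b)
      + reg (z \<otimes> z) \<otimes>\<^sub>o (a * star b) + reg (inv z \<otimes> inv z) \<otimes>\<^sub>o (b * star a)"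
    by (simp add: star_hom_mult[OF \<alpha>'] reg_in \<alpha>z \<alpha>iz distrib_left distrib_right tensor_add_right add_ac
        del: reg_mult) (simp add: add_ac)
  then have "reg \<one> \<otimes>\<^sub>o (a * star a + b * star b)
      + reg (z \<otimes> z) \<otimes>\<^sub>o (a * star b) + reg (inv z \<otimes> inv z) \<otimes>\<^sub>o (b * star a)
    = reg \<one> \<otimes>\<^sub>o ?e + reg (z \<otimes> z) \<otimes>\<^sub>o 0 + reg (inv z \<otimes> inv z) \<otimes>\<^sub>o 0"
    by (simp add: \<alpha>one)
  note rows = reg_tensor_eqD[OF car distinct this]
  have "\<alpha>' (reg (inv z) * reg z) = reg \<one> \<otimes>\<^sub>o (star a * a + star b * b)
      + reg (z \<otimes> z) \<otimes>\<^sub>o (star b * a) + reg (inv z \<otimes> inv z) \<otimes>\<^sub>o (star a * b)"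
    by (simp add: star_hom_mult[OF \<alpha>'] reg_in \<alpha>z \<alpha>iz distrib_left distrib_right tensor_add_right add_ac
        del: reg_mult) (simp add: add_ac)
  then have "reg \<one> \<otimes>\<^sub>o (star a * a + star b * b)
      + reg (z \<otimes> z) \<otimes>\<^sub>o (star b * a) + reg (inv z \<otimes> inv z) \<otimes>\<^sub>o (star a * b)
    = reg \<one> \<otimes>\<^sub>o ?e + reg (z \<otimes> z) \<otimes>\<^sub>o 0 + reg (inv z \<otimes> inv z) \<otimes>\<^sub>o 0"
    by (simp add: \<alpha>one)
  note cols = reg_tensor_eqD[OF car distinct this]
  have "slice \<one> (\<alpha>' (reg z * reg z)) = a * b + b * a"
    using distinct
    by (simp add: star_hom_mult[OF \<alpha>'] reg_in \<alpha>z distrib_left distrib_right slice_one_reg_tensor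
        eq_commute[of _ \<one>] del: reg_mult) (simp add: slice_one_reg_tensor eq_commute[of _ \<one>] add_ac)
  moreover have "slice \<one> (\<alpha>' (reg z * reg z)) = 0"
    using trace[of "reg z * reg z"] order_not_2
    by (simp add: reg_in canonical_trace_left_regular)
  ultimately have anti: "a * b + b * a = 0" by simp
  have unit: "?e * x = x \<and> x * ?e = x" if "x \<in> {a, b, star a, star b}" for x
    using that e ab star_in unfolding is_unit_of_def by blast
  note rel = orthogonal_normal_partial_isometries[OF unit rows(1) cols(1) rows(2,3) cols(3,2) anti]
  show ?thesis
    by (rule that[OF ab \<alpha>z rows(1) rel(1,2) rows(2,3) cols(3,2) rel(3-6)])
qed

text \<open>
  Compare the coefficients of \<open>\<lambda>\<^sub>z\<close> and of its inverse on both sides of the coaction identity.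
\<close>

lemma qiso_object_coproduct:
  assumes obj: "qiso_object G {z, inv z} Q' \<Delta>' \<alpha>'"
    and ab: "a \<in> Q'" "b \<in> Q'" and \<alpha>z: "\<alpha>' (reg z) = reg z \<otimes>\<^sub>o a + reg (inv z) \<otimes>\<^sub>o b"
  shows "\<Delta>' a = a \<otimes>\<^sub>o a + b \<otimes>\<^sub>o star b" "\<Delta>' b = a \<otimes>\<^sub>o b + b \<otimes>\<^sub>o star a"
proof -
  have \<alpha>': "star_hom CG (min_tensor CG Q') \<alpha>'"
    using obj by (simp add: qiso_object_def cqg_action_def unital_star_hom_def)
  from obj obtain F H where F: "tensor_hom CG Q' (min_tensor CG Q') Q' \<alpha>' id F"
    and H: "tensor_hom CG Q' CG (min_tensor Q' Q') id (flip \<circ> \<Delta>') H"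
    and FH: "\<forall>x\<in>CG. assoc_op (F (\<alpha>' x)) = H (\<alpha>' x)"
    unfolding qiso_object_def cqg_action_def by blast
  have "\<alpha>' (star (reg z)) = reg (inv z) \<otimes>\<^sub>o star a + reg z \<otimes>\<^sub>o star b"
    using star_hom_star[OF \<alpha>' reg_in[OF z_in]] by (simp add: \<alpha>z)
  then have \<alpha>iz: "\<alpha>' (reg (inv z)) = reg (inv z) \<otimes>\<^sub>o star a + reg z \<otimes>\<^sub>o star b" by simp
  have "reg z \<otimes>\<^sub>o flip (\<Delta>' a) + reg (inv z) \<otimes>\<^sub>o flip (\<Delta>' b) + reg \<one> \<otimes>\<^sub>o 0 = H (\<alpha>' (reg z))"
    using ab by (simp add: \<alpha>z tensor_hom_tensor_add[OF H] reg_in)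
  also have "\<dots> = assoc_op (F (\<alpha>' (reg z)))" using FH reg_in[OF z_in] by simp
  also have "F (\<alpha>' (reg z)) = \<alpha>' (reg z) \<otimes>\<^sub>o a + \<alpha>' (reg (inv z)) \<otimes>\<^sub>o b"
    unfolding \<alpha>z using tensor_hom_tensor_add[OF F reg_in[OF z_in] ab(1) reg_in[OF inv_closed[OF z_in]] ab(2)]
    by (simp add: \<alpha>z)
  also have "assoc_op \<dots> = reg z \<otimes>\<^sub>o (a \<otimes>\<^sub>o a + star b \<otimes>\<^sub>o b) + reg (inv z) \<otimes>\<^sub>o (b \<otimes>\<^sub>o a + star a \<otimes>\<^sub>o b)
      + reg \<one> \<otimes>\<^sub>o 0"
    by (simp add: \<alpha>z \<alpha>iz tensor_add_left tensor_add_right add_ac)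
  finally have eq: "reg z \<otimes>\<^sub>o flip (\<Delta>' a) + reg (inv z) \<otimes>\<^sub>o flip (\<Delta>' b) + reg \<one> \<otimes>\<^sub>o 0
    = reg z \<otimes>\<^sub>o (a \<otimes>\<^sub>o a + star b \<otimes>\<^sub>o b) + reg (inv z) \<otimes>\<^sub>o (b \<otimes>\<^sub>o a + star a \<otimes>\<^sub>o b) + reg \<one> \<otimes>\<^sub>o 0" .
  have ne: "z \<noteq> inv z" "z \<noteq> \<one>" "inv z \<noteq> \<one>" using inv_z_neq z_not_one by (auto simp: inv_eq_1_iff)
  note coeffs = reg_tensor_eqD[OF z_in inv_closed[OF z_in] one_closed ne eq]
  have "\<Delta>' a = flip (flip (\<Delta>' a))" by simp
  also have "\<dots> = a \<otimes>\<^sub>o a + b \<otimes>\<^sub>o star b" by (simp only: coeffs(1) flip_add flip_tensor)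
  finally show "\<Delta>' a = a \<otimes>\<^sub>o a + b \<otimes>\<^sub>o star b" .
  have "\<Delta>' b = flip (flip (\<Delta>' b))" by simp
  also have "\<dots> = a \<otimes>\<^sub>o b + b \<otimes>\<^sub>o star a" by (simp only: coeffs(2) flip_add flip_tensor)
  finally show "\<Delta>' b = a \<otimes>\<^sub>o b + b \<otimes>\<^sub>o star a" .
qed

text \<open>
  If the corner powers of \<open>a\<close> depend only on the power of the generator, they form a representation of
  the cyclic group.
\<close>

lemma star_rep_corner_power:
  assumes A: "cstar_algebra A" "a \<in> A" and a: "a * star a * a = a" and n: "star a * a = a * star a"
    and wd: "\<And>k l :: nat. z [^] k = z [^] l \<Longrightarrow> corner_power a k = corner_power a l"
  shows "\<exists>U. star_rep G A U \<and> (\<forall>k :: nat. U (z [^] k) = corner_power a k)"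
proof -
  define U where "U = (\<lambda>h. corner_power a (SOME k. z [^] k = h))"
  have U: "U (z [^] k) = corner_power a k" for k :: nat
    unfolding U_def by (rule wd) (rule someI[of _ k], rule refl)
  have "star_rep G A U"
    unfolding star_rep_def
  proof (intro ballI conjI)
    fix g assume g: "g \<in> carrier G"
    then obtain k :: nat where k: "g = z [^] k" using generated by blast
    show "U g \<in> A" unfolding k U by (rule corner_power_in[OF A])
    obtain m :: nat where m: "inv g = z [^] m" using g generated by blast
    have "z [^] (k + m) = z [^] (0 :: nat)"
      using g by (simp add: nat_pow_mult[symmetric] flip: k m)
    from wd[OF this] show "star (U g) = U (inv g)"
      unfolding m unfolding k U by (rule star_corner_power[OF a n])
    fix h assume "h \<in> carrier G"
    then obtain l :: nat where l: "h = z [^] l" using generated by blast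
    show "U g * U h = U (g \<otimes> h)"
      by (simp add: k l nat_pow_mult U corner_power_add[OF a])
  qed
  with U show ?thesis by blast
qed

text \<open>
  As \<open>a b = b a = 0\<close>, the action maps \<open>\<lambda>\<^sub>z\<^sup>k\<close> to \<open>\<lambda>\<^sub>z\<^sup>k \<otimes> a\<^sup>k + \<lambda>\<^sub>z\<^bsup>-k\<^esup> \<otimes> b\<^sup>k\<close> with powers taken in the
  corners. Multiplying by the unit of one corner isolates one term, so \<open>a\<^sup>k\<close> and \<open>b\<^sup>k\<close> depend only on
  \<open>z\<^sup>k\<close>. They are therefore representations of the group, and orthogonal to each other.
\<close>

lemma qiso_object_universal_map:
  assumes obj: "qiso_object G {z, inv z} Q' \<Delta>' \<alpha>'"
  obtains a b \<Phi> where "a \<in> Q'" "b \<in> Q'" "\<alpha>' (reg z) = reg z \<otimes>\<^sub>o a + reg (inv z) \<otimes>\<^sub>o b"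
    "unital_star_hom QG Q' \<Phi>" "\<Phi> (lreg z) = a" "\<Phi> (rreg z) = b"
proof -
  have cst: "cstar_algebra Q'" and \<alpha>': "star_hom CG (min_tensor CG Q') \<alpha>'"
    and \<alpha>'1: "\<alpha>' (unit_of CG) = unit_of (min_tensor CG Q')"
    and Q': "unital_cstar_algebra Q'"
    using obj by (auto simp: qiso_object_def compact_quantum_group_def cqg_action_def
        unital_star_hom_def unital_cstar_algebra_def)
  have sub: "bop.subspace Q'" using cst by (simp add: cstar_algebra_def)
  obtain a b where ab: "a \<in> Q'" "b \<in> Q'" and \<alpha>z: "\<alpha>' (reg z) = reg z \<otimes>\<^sub>o a + reg (inv z) \<otimes>\<^sub>o b"
    and unit: "a * star a + b * star b = unit_of Q'"
    and zero: "a * b = 0" "b * a = 0" "a * star b = 0" "b * star a = 0" "star a * b = 0" "star b * a = 0"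
    and pi: "a * star a * a = a" "b * star b * b = b"
    and normal: "star a * a = a * star a" "star b * b = b * star b"
    by (rule qiso_object_coefficients[OF obj])
  have ab0: "corner_power a k * corner_power b l = 0" and ba0: "corner_power b l * corner_power a k = 0" for k l
    using corner_power_mult_zero[OF pi(1) zero(1,5)] corner_power_mult_zero[OF pi(2) zero(2,6)] by blast+
  have pow: "\<alpha>' (reg (z [^] k)) = reg (z [^] k) \<otimes>\<^sub>o corner_power a k + reg (inv (z [^] k)) \<otimes>\<^sub>o corner_power b k"
    for k :: nat
  proof (induction k)
    case 0
    show ?case
      using \<alpha>'1 unit_of_eqI[OF is_unit_of_min_tensor[OF is_unit_of_group_cstar is_unit_of_unit_of[OF Q']]]
      by (simp add: unit_of_CG tensor_add_right flip: unit)
  next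
    case (Suc k)
    have "\<alpha>' (reg (z [^] Suc k)) = \<alpha>' (reg z * reg (z [^] k))"
      by (simp add: m_comm)
    also have "\<dots> = \<alpha>' (reg z) * \<alpha>' (reg (z [^] k))"
      by (rule star_hom_mult[OF \<alpha>']) (simp_all add: reg_in)
    also have "\<dots> = reg (z \<otimes> z [^] k) \<otimes>\<^sub>o corner_power a (Suc k)
        + reg (inv z \<otimes> inv (z [^] k)) \<otimes>\<^sub>o corner_power b (Suc k)"
      by (simp add: \<alpha>z Suc distrib_left distrib_right mult_corner_power_zero[OF zero(1)]
          mult_corner_power_zero[OF zero(2)])
    also have "z \<otimes> z [^] k = z [^] Suc k" by (simp add: m_comm)
    also have "inv z \<otimes> inv (z [^] k) = inv (z [^] Suc k)" by (simp add: inv_mult m_comm)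
    finally show ?case .
  qed
  have wda: "corner_power a k = corner_power a l" if kl: "z [^] k = z [^] l" for k l :: nat
  proof (rule reg_tensor_inject)
    have "(reg \<one> \<otimes>\<^sub>o corner_power a 0) * \<alpha>' (reg (z [^] m)) = reg (z [^] m) \<otimes>\<^sub>o corner_power a m" for m :: nat
      by (simp add: pow distrib_left ab0 corner_power_add[OF pi(1)] del: corner_power.simps)
    from this[of k] this[of l] kl
    show "reg (z [^] k) \<otimes>\<^sub>o corner_power a k = reg (z [^] k) \<otimes>\<^sub>o corner_power a l" by simp
  qed simp
  have wdb: "corner_power b k = corner_power b l" if kl: "z [^] k = z [^] l" for k l :: nat
  proof (rule reg_tensor_inject)
    have "(reg \<one> \<otimes>\<^sub>o corner_power b 0) * \<alpha>' (reg (z [^] m)) = reg (inv (z [^] m)) \<otimes>\<^sub>o corner_power b m" for m :: nat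
      by (simp add: pow distrib_left ba0 corner_power_add[OF pi(2)] del: corner_power.simps)
    from this[of k] this[of l] kl
    show "reg (inv (z [^] k)) \<otimes>\<^sub>o corner_power b k = reg (inv (z [^] k)) \<otimes>\<^sub>o corner_power b l" by simp
  qed simp
  obtain U where U: "star_rep G Q' U" and Uk: "\<And>k :: nat. U (z [^] k) = corner_power a k"
    using star_rep_corner_power[OF cst ab(1) pi(1) normal(1) wda] by blast
  obtain V where V: "star_rep G Q' V" and Vk: "\<And>k :: nat. V (z [^] k) = corner_power b k"
    using star_rep_corner_power[OF cst ab(2) pi(2) normal(2) wdb] by blast
  have orth: "U g * V h = 0 \<and> V h * U g = 0" if gh: "g \<in> carrier G" "h \<in> carrier G" for g h
  proof -
    obtain k l :: nat where "g = z [^] k" "h = z [^] l" using gh generated by blast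
    then show ?thesis by (simp only: Uk Vk ab0 ba0)
  qed
  obtain \<Phi> where \<Phi>: "star_hom QG Q' \<Phi>"
    and \<Phi>g: "\<And>g. g \<in> carrier G \<Longrightarrow> \<Phi> (lreg g) = U g \<and> \<Phi> (rreg g) = V g"
    using star_hom_QG_exists[OF sub U V orth] by blast
  have "\<Phi> (lreg \<one> + rreg \<one>) = unit_of Q'"
    using Uk[of 0] Vk[of 0] by (simp add: star_hom_add[OF \<Phi>] lreg_in rreg_in \<Phi>g unit)
  then have "unital_star_hom QG Q' \<Phi>" using \<Phi> by (simp add: unital_star_hom_def unit_of_QG)
  moreover have "\<Phi> (lreg z) = a" "\<Phi> (rreg z) = b"
    using \<Phi>g[OF z_in] Uk[of "Suc 0"] Vk[of "Suc 0"] corner_power_one[OF pi(1) normal(1)]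
      corner_power_one[OF pi(2) normal(2)] by (simp_all del: corner_power.simps)
  ultimately show ?thesis by (rule that[OF ab \<alpha>z])
qed

text \<open>
  A morphism intertwines the actions, which are determined by their two coefficients at \<open>\<lambda>\<^sub>z\<close>.
\<close>

lemma qiso_morphism_values:
  assumes mor: "qiso_morphism G QG \<Delta> \<alpha> Q' \<Delta>' \<alpha>' \<Phi>" and \<alpha>z: "\<alpha> (reg z) = act z"
    and \<alpha>'z: "\<alpha>' (reg z) = reg z \<otimes>\<^sub>o a + reg (inv z) \<otimes>\<^sub>o b"
  shows "\<Phi> (lreg z) = a" "\<Phi> (rreg z) = b"
proof -
  from mor obtain F where F: "tensor_hom CG QG CG Q' id \<Phi> F" "\<forall>x\<in>CG. F (\<alpha> x) = \<alpha>' x"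
    unfolding qiso_morphism_def by blast
  have "F (act z) = \<alpha>' (reg z)" using F(2) reg_in[OF z_in] \<alpha>z by force
  then have eq: "reg z \<otimes>\<^sub>o \<Phi> (lreg z) + reg (inv z) \<otimes>\<^sub>o \<Phi> (rreg z) + reg \<one> \<otimes>\<^sub>o 0
      = reg z \<otimes>\<^sub>o a + reg (inv z) \<otimes>\<^sub>o b + reg \<one> \<otimes>\<^sub>o 0"
    by (simp add: tensor_hom_tensor_add[OF F(1)] reg_in lreg_in rreg_in \<alpha>'z)
  have ne: "z \<noteq> inv z" "z \<noteq> \<one>" "inv z \<noteq> \<one>" using inv_z_neq z_not_one by (auto simp: inv_eq_1_iff)
  show "\<Phi> (lreg z) = a" "\<Phi> (rreg z) = b"
    using reg_tensor_eqD[OF z_in inv_closed[OF z_in] one_closed ne eq] by blast+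
qed

text \<open>
  The identities that make the universal map a morphism are equalities of *-homomorphisms, so they need
  to be checked on the generators only, as does uniqueness.
\<close>

lemma is_QISO_QG:
  assumes \<Delta>: "star_hom QG (min_tensor QG QG) \<Delta>"
    and l: "\<And>g. g \<in> carrier G \<Longrightarrow> \<Delta> (lreg g) = cop_l g"
    and r: "\<And>g. g \<in> carrier G \<Longrightarrow> \<Delta> (rreg g) = cop_r g"
    and \<alpha>: "star_hom CG (min_tensor CG QG) \<alpha>"
    and a: "\<And>g. g \<in> carrier G \<Longrightarrow> \<alpha> (reg g) = act g"
  shows "is_QISO TYPE('k) G {z, inv z} QG \<Delta> \<alpha>"
proof -
  have "\<exists>!\<Phi>. \<Phi> \<in> QG \<rightarrow>\<^sub>E Q' \<and> qiso_morphism G QG \<Delta> \<alpha> Q' \<Delta>' \<alpha>' \<Phi>"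
    if obj: "qiso_object G {z, inv z} Q' \<Delta>' \<alpha>'" for Q' :: "'k bop set" and \<Delta>' \<alpha>'
  proof -
    have \<alpha>': "star_hom CG (min_tensor CG Q') \<alpha>'" and \<Delta>': "star_hom Q' (min_tensor Q' Q') \<Delta>'"
      using obj by (auto simp: qiso_object_def compact_quantum_group_def cqg_action_def unital_star_hom_def)
    obtain x y \<Phi>0 where xy: "x \<in> Q'" "y \<in> Q'"
      and \<alpha>'z: "\<alpha>' (reg z) = reg z \<otimes>\<^sub>o x + reg (inv z) \<otimes>\<^sub>o y"
      and \<Phi>0: "unital_star_hom QG Q' \<Phi>0" "\<Phi>0 (lreg z) = x" "\<Phi>0 (rreg z) = y"
      by (rule qiso_object_universal_map[OF obj])
    note \<Delta>'xy = qiso_object_coproduct[OF obj xy \<alpha>'z]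
    define \<Phi> where "\<Phi> = restrict \<Phi>0 QG"
    have \<Phi>hom: "star_hom QG Q' \<Phi>"
      using \<Phi>0(1) fd_cstar_algebraD(1)[OF fd_QG] unfolding unital_star_hom_def \<Phi>_def
      by (auto intro: star_hom_cong)
    have one_in: "unit_of QG \<in> QG" using is_unit_of_QG by (simp add: unit_of_QG is_unit_of_def)
    have \<Phi>unital: "unital_star_hom QG Q' \<Phi>"
      using \<Phi>0(1) \<Phi>hom one_in by (simp add: unital_star_hom_def \<Phi>_def)
    have \<Phi>z: "\<Phi> (lreg z) = x" "\<Phi> (rreg z) = y"
      using \<Phi>0 by (simp_all add: \<Phi>_def lreg_in rreg_in)
    have \<Phi>iz: "\<Phi> (lreg (inv z)) = star x" "\<Phi> (rreg (inv z)) = star y"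
      using star_hom_star[OF \<Phi>hom lreg_in[OF z_in]] star_hom_star[OF \<Phi>hom rreg_in[OF z_in]]
      by (simp_all add: \<Phi>z)
    obtain F where F: "tensor_hom QG QG Q' Q' \<Phi> \<Phi> F"
      using tensor_hom_exists[OF fd_QG fd_QG \<Phi>hom \<Phi>hom] by blast
    have F\<Delta>: "F (\<Delta> q) = \<Delta>' (\<Phi> q)" if "q \<in> QG" for q
    proof -
      have "(F \<circ> \<Delta>) q = (\<Delta>' \<circ> \<Phi>) q"
      proof (rule star_hom_QG_eqI[OF star_hom_comp[OF \<Delta> tensor_hom_star_hom[OF F]]
            star_hom_comp[OF \<Phi>hom \<Delta>'] _ _ that])
        show "(F \<circ> \<Delta>) (lreg z) = (\<Delta>' \<circ> \<Phi>) (lreg z)"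
          by (simp add: l tensor_hom_tensor_add[OF F] lreg_in rreg_in \<Phi>z \<Phi>iz \<Delta>'xy)
        show "(F \<circ> \<Delta>) (rreg z) = (\<Delta>' \<circ> \<Phi>) (rreg z)"
          by (simp add: r tensor_hom_tensor_add[OF F] lreg_in rreg_in \<Phi>z \<Phi>iz \<Delta>'xy)
      qed
      then show ?thesis by simp
    qed
    obtain H where H: "tensor_hom CG QG CG Q' id \<Phi> H"
      using tensor_hom_exists[OF fd_group_cstar fd_QG star_hom_id \<Phi>hom] by blast
    have H\<alpha>: "H (\<alpha> c) = \<alpha>' c" if "c \<in> CG" for c
    proof -
      have "(H \<circ> \<alpha>) c = \<alpha>' c"
        by (rule star_hom_group_cstar_eqI[OF star_hom_comp[OF \<alpha> tensor_hom_star_hom[OF H]] \<alpha>' _ that])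
          (simp add: a tensor_hom_tensor_add[OF H] reg_in lreg_in rreg_in \<Phi>z \<alpha>'z)
      then show ?thesis by simp
    qed
    have mor: "qiso_morphism G QG \<Delta> \<alpha> Q' \<Delta>' \<alpha>' \<Phi>"
      unfolding qiso_morphism_def cqg_morphism_def using \<Phi>unital F F\<Delta> H H\<alpha> by blast
    have \<Phi>ext: "\<Phi> \<in> QG \<rightarrow>\<^sub>E Q'"
      using star_hom_in[OF \<Phi>hom] by (auto simp: \<Phi>_def)
    show ?thesis
    proof (rule ex1I[of _ \<Phi>])
      show "\<Phi> \<in> QG \<rightarrow>\<^sub>E Q' \<and> qiso_morphism G QG \<Delta> \<alpha> Q' \<Delta>' \<alpha>' \<Phi>" using \<Phi>ext mor ..
      fix \<Psi> assume \<Psi>: "\<Psi> \<in> QG \<rightarrow>\<^sub>E Q' \<and> qiso_morphism G QG \<Delta> \<alpha> Q' \<Delta>' \<alpha>' \<Psi>"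
      then have \<Psi>hom: "star_hom QG Q' \<Psi>"
        by (simp add: qiso_morphism_def cqg_morphism_def unital_star_hom_def)
      have \<Psi>z: "\<Psi> (lreg z) = x" "\<Psi> (rreg z) = y"
        using qiso_morphism_values[OF conjunct2[OF \<Psi>] a[OF z_in] \<alpha>'z] by auto
      show "\<Psi> = \<Phi>"
      proof (rule PiE_ext)
        show "\<Psi> \<in> QG \<rightarrow>\<^sub>E Q'" using \<Psi> ..
        show "\<Phi> \<in> QG \<rightarrow>\<^sub>E Q'" by (rule \<Phi>ext)
        show "\<Psi> q = \<Phi> q" if "q \<in> QG" for q
          by (rule star_hom_QG_eqI[OF \<Psi>hom \<Phi>hom _ _ that]) (simp_all add: \<Psi>z \<Phi>z)
      qed
    qed
  qed
  moreover have "qiso_object G {z, inv z} QG \<Delta> \<alpha>"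
    by (rule qiso_object_QG[OF symmetric_generating_set_z \<Delta> l r \<alpha> a])
  ultimately show ?thesis
    unfolding is_QISO_def using is_group symmetric_generating_set_z by blast
qed

abbreviation fundamental_matrix :: "('a + 'a) bop^2^2" where
  "fundamental_matrix \<equiv> vector [vector [lreg z, rreg z], vector [star (rreg z), star (lreg z)]]"

text \<open>
  The entries generate \<open>QG\<close> because a C*-algebra containing \<open>A\<close> and \<open>B\<close> contains all their powers
  and their range projections, which together span \<open>QG\<close>.
\<close>

lemma fundamental_corepresentation_QG:
  assumes \<Delta>: "star_hom QG (min_tensor QG QG) \<Delta>" and l: "\<Delta> (lreg z) = cop_l z" and r: "\<Delta> (rreg z) = cop_r z"
  shows "fundamental_corepresentation QG \<Delta> fundamental_matrix"
proof -
  note Q_in = lreg_in rreg_in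
  have "\<Delta> (star (lreg z)) = star (cop_l z)" "\<Delta> (star (rreg z)) = star (cop_r z)"
    using star_hom_star[OF \<Delta> lreg_in[OF z_in]] star_hom_star[OF \<Delta> rreg_in[OF z_in]] l r by simp_all
  then have "corepresentation QG \<Delta> fundamental_matrix"
    unfolding corepresentation_def
    by (simp add: forall_2 sum_2 vector_2 l r Q_in add.commute)
  moreover have "unitary_matrix QG fundamental_matrix"
    unfolding unitary_matrix_def
    by (simp add: forall_2 sum_2 vector_2 unit_of_QG direct_sum_zero add.commute)
  moreover have "cstar_algebra hull {fundamental_matrix $ i $ j | i j. True} = QG"
  proof
    have "{fundamental_matrix $ i $ j | i j. True} \<subseteq> QG"
    proof clarify
      fix i j :: 2
      show "fundamental_matrix $ i $ j \<in> QG"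
        using exhaust_2[of i] exhaust_2[of j] by (auto simp: vector_2 Q_in)
    qed
    then show "cstar_algebra hull {fundamental_matrix $ i $ j | i j. True} \<subseteq> QG"
      by (rule hull_minimal) (rule fd_cstar_algebraD(1)[OF fd_QG])
    have "QG \<subseteq> T" if T: "cstar_algebra T" and sub: "{fundamental_matrix $ i $ j | i j. True} \<subseteq> T" for T
    proof -
      have "fundamental_matrix $ 1 $ 1 \<in> T" "fundamental_matrix $ 1 $ 2 \<in> T" using sub by blast+
      then have lz: "lreg z \<in> T" and rz: "rreg z \<in> T" by (simp_all only: vector_2)
      have mult: "x * y \<in> T" and star: "star x \<in> T" if "x \<in> T" "y \<in> T" for x y
        using T that by (auto simp: cstar_algebra_def)
      have "lreg (z [^] k) \<in> T \<and> rreg (z [^] k) \<in> T" for k :: nat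
      proof (induction k)
        case 0
        show ?case using mult[OF lz star[OF lz lz]] mult[OF rz star[OF rz rz]] by simp
      next
        case (Suc k)
        then show ?case using mult[OF _ lz, of "lreg (z [^] k)"] mult[OF _ rz, of "rreg (z [^] k)"] by simp
      qed
      then have "lreg ` carrier G \<union> rreg ` carrier G \<subseteq> T" using generated by blast
      then show ?thesis
        unfolding QG_cspan using T by (intro cspan_minimal) (simp_all add: cstar_algebra_def)
    qed
    then show "QG \<subseteq> cstar_algebra hull {fundamental_matrix $ i $ j | i j. True}"
      unfolding hull_def by blast
  qed
  ultimately show ?thesis by (simp add: fundamental_corepresentation_def)
qed

end

section \<open>The quantum isometry group of a finite cyclic group\<close>

theorem theorem3p1:
  fixes n :: nat
  assumes "n \<ge> 1" and "n \<notin> {1, 2, 4}"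
  defines "G \<equiv> integer_mod_group n"
    and "S \<equiv> {1, int n - 1}"
  defines "C \<equiv> group_cstar G"
  defines "Q \<equiv> direct_sum_algebra C C"
  defines "A \<equiv> left_regular G 1 \<oplus>\<^sub>o (0 :: int bop)"
    and "B \<equiv> (0 :: int bop) \<oplus>\<^sub>o left_regular G 1"
  defines "u \<equiv> (vector [vector [A, B], vector [star B, star A]] :: (int + int) bop^2^2)"
  defines "is_formula_action \<equiv> \<lambda>\<alpha>. \<alpha> \<in> extensional C \<and> unital_star_hom C (min_tensor C Q) \<alpha> \<and>
      \<alpha> (left_regular G 1) = left_regular G 1 \<otimes>\<^sub>o A + left_regular G (int n - 1) \<otimes>\<^sub>o B"
    and "is_matrix_coproduct \<equiv> \<lambda>\<Delta>. \<Delta> \<in> extensional Q \<and> unital_star_hom Q (min_tensor Q Q) \<Delta> \<and>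
      fundamental_corepresentation Q \<Delta> u"
  shows "(\<exists>!\<alpha>. is_formula_action \<alpha>) \<and> (\<exists>!\<Delta>. is_matrix_coproduct \<Delta>) \<and>
    (\<forall>\<alpha> \<Delta>. is_formula_action \<alpha> \<longrightarrow> is_matrix_coproduct \<Delta> \<longrightarrow> is_QISO TYPE('k) G S Q \<Delta> \<alpha>)"
proof -
  have n3: "n \<ge> 3" "n \<noteq> 4" using assms(1,2) by auto
  interpret Zn: finite_cyclic_group G 1
  proof -
    interpret comm_group G by (simp add: G_def)
    have fin: "finite (carrier G)" using n3 by (simp add: G_def carrier_integer_mod_group)
    \<comment> \<open>2 is not 0 modulo n since n > 2, and 2 is not -2 since n does not divide 4\<close>
    have "(1 + 1) mod int n \<noteq> 0" using n3 by simp
    moreover have "(1 + 1) mod int n \<noteq> ((- 1) mod int n + (- 1) mod int n) mod int n"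
    proof -
      have "int n > 2" "int n \<noteq> 4" using n3 by auto
      moreover have "(- 1) mod int n = int n - 1" using n3 by (simp add: zmod_minus1)
      moreover have "(int n - 1 + (int n - 1)) mod int n = int n - 2"
      proof -
        have "(int n - 1 + (int n - 1)) mod int n = ((int n - 2) + int n) mod int n"
          by (rule arg_cong[where f = "\<lambda>x. x mod int n"]) linarith
        also have "\<dots> = (int n - 2) mod int n" by (rule mod_add_self2)
        also have "\<dots> = int n - 2" using n3 by (intro mod_pos_pos_trivial) auto
        finally show ?thesis .
      qed
      ultimately show ?thesis by simp
    qed
    moreover have "carrier G \<subseteq> range (\<lambda>k::nat. 1 [^]\<^bsub>G\<^esub> k)"
    proof
      fix x assume "x \<in> carrier G"
      then have "x = 1 [^]\<^bsub>G\<^esub> nat x" using n3 by (simp add: G_def carrier_integer_mod_group)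
      then show "x \<in> range (\<lambda>k::nat. 1 [^]\<^bsub>G\<^esub> k)" by (rule range_eqI)
    qed
    ultimately show "finite_cyclic_group G 1"
      using fin n3 by unfold_locales (simp_all add: G_def)
  qed
  have inv1: "inv\<^bsub>G\<^esub> 1 = int n - 1"
    using n3 by (simp add: G_def zmod_minus1)
  have S_eq: "S = {1, inv\<^bsub>G\<^esub> 1}" by (simp add: S_def inv1)
  have u_eq: "u = Zn.fundamental_matrix" by (simp add: u_def A_def B_def)
  obtain \<alpha>0 where \<alpha>0: "star_hom C (min_tensor C Q) \<alpha>0"
      "\<And>g. g \<in> carrier G \<Longrightarrow> \<alpha>0 (left_regular G g) = Zn.act g"
    using Zn.action_exists unfolding C_def Q_def by blast
  obtain \<Delta>0 where \<Delta>0: "star_hom Q (min_tensor Q Q) \<Delta>0"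
      "\<And>g. g \<in> carrier G \<Longrightarrow> \<Delta>0 (Zn.lreg g) = Zn.cop_l g"
      "\<And>g. g \<in> carrier G \<Longrightarrow> \<Delta>0 (Zn.rreg g) = Zn.cop_r g"
    using Zn.coproduct_exists unfolding C_def Q_def by blast
  have action_on_group: "\<alpha> x = \<alpha>0 x" if "is_formula_action \<alpha>" "x \<in> C" for \<alpha> x
    using that \<alpha>0 Zn.star_hom_group_cstar_eqI[of "min_tensor C Q" \<alpha> "min_tensor C Q" \<alpha>0 x]
    by (simp add: is_formula_action_def unital_star_hom_def C_def A_def B_def inv1)
  have coproduct_on_group: "\<Delta> x = \<Delta>0 x" if \<Delta>: "is_matrix_coproduct \<Delta>" and x: "x \<in> Q" for \<Delta> x
  proof -
    have "corepresentation Q \<Delta> Zn.fundamental_matrix" and hom: "star_hom Q (min_tensor Q Q) \<Delta>"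
      using \<Delta> by (simp_all add: is_matrix_coproduct_def fundamental_corepresentation_def unital_star_hom_def u_eq)
    then have "\<Delta> (Zn.lreg 1) = Zn.cop_l 1" "\<Delta> (Zn.rreg 1) = Zn.cop_r 1"
      by (simp_all add: corepresentation_def forall_2 sum_2 vector_2)
    then show ?thesis
      using Zn.star_hom_QG_eqI[OF hom[unfolded Q_def C_def] \<Delta>0(1)[unfolded Q_def C_def]] \<Delta>0(2,3) x
      by (simp add: Q_def C_def)
  qed
  have C_cstar: "cstar_algebra C" and Q_cstar: "cstar_algebra Q"
    unfolding C_def Q_def by (rule fd_cstar_algebraD(1), rule Zn.fd_group_cstar Zn.fd_QG)+
  have "is_formula_action (restrict \<alpha>0 C)"
  proof -
    have "star_hom C (min_tensor C Q) (restrict \<alpha>0 C)"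
      using star_hom_cong[OF \<alpha>0(1) C_cstar] by simp
    moreover have "restrict \<alpha>0 C (left_regular G g) = Zn.act g" if "g \<in> carrier G" for g
      using that Zn.reg_in[OF that] by (simp add: \<alpha>0 C_def)
    ultimately show ?thesis
      using Zn.unital_action[of "restrict \<alpha>0 C"]
      by (simp add: is_formula_action_def C_def Q_def A_def B_def flip: inv1)
  qed
  moreover have "\<alpha> = restrict \<alpha>0 C" if "is_formula_action \<alpha>" for \<alpha>
    using that action_on_group[OF that]
    by (intro extensionalityI[of _ C]) (simp_all add: is_formula_action_def)
  ultimately have ex_action: "\<exists>!\<alpha>. is_formula_action \<alpha>" by blast
  have "is_matrix_coproduct (restrict \<Delta>0 Q)"
  proof -
    have "star_hom Q (min_tensor Q Q) (restrict \<Delta>0 Q)"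
      using star_hom_cong[OF \<Delta>0(1) Q_cstar] by simp
    moreover have "restrict \<Delta>0 Q (Zn.lreg g) = Zn.cop_l g" "restrict \<Delta>0 Q (Zn.rreg g) = Zn.cop_r g"
      if "g \<in> carrier G" for g
      using that Zn.lreg_in[OF that] Zn.rreg_in[OF that] by (simp_all add: \<Delta>0 Q_def C_def)
    ultimately show ?thesis
      using Zn.unital_coproduct[of "restrict \<Delta>0 Q"] Zn.fundamental_corepresentation_QG[of "restrict \<Delta>0 Q"]
      by (simp add: is_matrix_coproduct_def C_def Q_def u_eq)
  qed
  moreover have "\<Delta> = restrict \<Delta>0 Q" if "is_matrix_coproduct \<Delta>" for \<Delta>
    using that coproduct_on_group[OF that]
    by (intro extensionalityI[of _ Q]) (simp_all add: is_matrix_coproduct_def)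
  ultimately have ex_coproduct: "\<exists>!\<Delta>. is_matrix_coproduct \<Delta>" by blast
  have "is_QISO TYPE('k) G S Q \<Delta> \<alpha>" if \<alpha>: "is_formula_action \<alpha>" and \<Delta>: "is_matrix_coproduct \<Delta>" for \<alpha> \<Delta>
    unfolding S_eq Q_def C_def
  proof (rule Zn.is_QISO_QG)
    show "star_hom Zn.QG (min_tensor Zn.QG Zn.QG) \<Delta>" "star_hom Zn.CG (min_tensor Zn.CG Zn.QG) \<alpha>"
      using \<alpha> \<Delta> by (simp_all add: is_formula_action_def is_matrix_coproduct_def unital_star_hom_def Q_def C_def)
    show "\<Delta> (Zn.lreg g) = Zn.cop_l g" if "g \<in> carrier G" for g
      using coproduct_on_group[OF \<Delta>, of "Zn.lreg g"] \<Delta>0(2)[OF that] Zn.lreg_in[OF that]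
      by (simp add: Q_def C_def)
    show "\<Delta> (Zn.rreg g) = Zn.cop_r g" if "g \<in> carrier G" for g
      using coproduct_on_group[OF \<Delta>, of "Zn.rreg g"] \<Delta>0(3)[OF that] Zn.rreg_in[OF that]
      by (simp add: Q_def C_def)
    show "\<alpha> (left_regular G g) = Zn.act g" if "g \<in> carrier G" for g
      using action_on_group[OF \<alpha>, of "left_regular G g"] \<alpha>0(2)[OF that] Zn.reg_in[OF that]
      by (simp add: C_def)
  qed
  with ex_action ex_coproduct show ?thesis by blast
qed

end
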